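(* Let $i\in\{1,\dots,30\}$, $j\in\{1,\dots,128\}$, let $\Phi_{i,j}$ be the corresponding signed primary 3-form, let $\sigma$ be the number of minus signs in $\Phi_{i,j}$, let $I=e_{1234567}$, and put $$\rho_{i,j}=\tfrac14\bigl(3I-(-1)^{\sigma}\Phi_{i,j}\bigr).$$ Let $A(\Phi_{i,j})$ be the 8-dimensional algebra generated by $\Phi_{i,j}$. Then exactly one of the following holds. (1) $\rho_{i,j}^2=-1$ ("the remainder is $0$"). This happens exactly when $\Phi_{i,j}$ is a calibration, i.e. when $A(\Phi_{i,j})$ is isomorphic to the octonions. In this case $A(\Phi_{i,j})$ has 28 non-associative unique triples and 7 associative unique triples. (2) There are a term $\phi_{i,j}$ of $\Phi_i$ (one of its seven basis 3-forms) and a sign $\pm$ such that $$2I\,(\rho_{i,j}^2+1)=\pm\phi_{i,j}+(-1)^{\sigma}\Phi_{i,j}$$ ("the remainder is $\pm\phi_{i,j}$"). In this case $A(\Phi_{i,j})$ is a non-associative algebra, and the number of its non-associative unique triples is the number $k\in\{4,8,10,12,14,16\}$ that the Primary Table (in the context) assigns to the term $\phi_{i,j}$ in row $i$. Moreover, for the all-positive forms $\Phi_{i,1}=\Phi_i$ the (signed) remainder is the one listed in the last column of row $i$ of the Primary Table; in particular $\Phi_{11}$ and $\Phi_{20}$ have remainder $0$ and generate the octonions.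
   Context: $\mathcal G_7=\mathrm{Cl}(7,0)$ is the real Clifford algebra generated by $e_1,\dots,e_7$ with $e_a^2=1$, $e_ae_b=-e_be_a$ ($a\neq b$); $e_{abc}=e_ae_be_c$, etc. Signed primary 3-forms. The primary 3-forms $\Phi_1,\dots,\Phi_{30}$ are listed below; each is the sum, with coefficients $+1$, of the seven listed basis 3-forms $e_{abc}$, $a<b<c$. For each $i$, $\Phi_{i,j}$, $j=1,\dots,128$, runs over the $2^7$ 3-forms obtained by giving each of the seven terms of $\Phi_i$ a sign $\pm1$, with $\Phi_{i,1}=\Phi_i$. The number $\sigma$ is the number of terms with coefficient $-1$. Generated algebra. $A(\Phi_{i,j})$ is the real algebra with basis $1,p_1,\dots,p_7$, unit $1$, $p_a^2=-1$, and, for each term $s\,e_{abc}$ ($s=\pm1$) of $\Phi_{i,j}$, $p_ap_b=s\,p_c$, $p_bp_c=s\,p_a$, $p_cp_a=s\,p_b$ and $p_bp_a=-s\,p_c$, $p_cp_b=-s\,p_a$, $p_ap_c=-s\,p_b$. (Every pair of distinct indices lies in exactly one term, so this defines all products.) A unique triple is a triple $(p_a,p_b,p_c)$ with $1\le a<b<c\le7$ (35 in total); it is non-associative if $(p_ap_b)p_c\ne p_a(p_bp_c)$ and associative otherwise. $\mathbb P_k$ denotes the class of those $A(\Phi_{i,j})$ of case (2) with $k$ non-associative unique triples. Primary Table. Each row reads: $i$: the seven terms of $\Phi_i$ (where $abc$ abbreviates $e_{abc}$); the seven numbers $k$ assigned to these terms, in the same order; the signed remainder of $\Phi_{i,1}$.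 1: 123,145,167,246,257,347,356; (4,12,12,14,14,14,14); $-e_{246}$ 2: 123,145,167,247,256,346,357; (4,12,12,14,14,14,14); $-e_{357}$ 3: 123,146,157,245,267,347,356; (4,14,14,12,12,14,14); $-e_{157}$ 4: 123,146,157,247,256,345,367; (4,14,14,14,14,12,12); $-e_{146}$ 5: 123,147,156,245,267,346,357; (4,14,14,12,12,14,14); $-e_{346}$ 6: 123,147,156,246,257,345,367; (4,14,14,14,14,12,12); $-e_{257}$ 7: 124,135,167,236,257,347,456; (8,12,12,14,14,14,10); $-e_{135}$ 8: 124,135,167,237,256,346,457; (8,12,12,14,14,14,10); $-e_{124}$ 9: 124,136,157,235,267,347,456; (8,14,14,12,12,14,10); $-e_{267}$ 10: 124,136,157,237,256,345,467; (8,14,14,14,14,12,8); $-e_{237}$ 11: 124,137,156,235,267,346,457; (8,14,14,12,12,14,10); $0$ 12: 124,137,156,236,257,345,467; (8,14,14,14,14,12,8); $-e_{156}$ 13: 125,134,167,236,247,357,456; (10,10,12,14,16,12,10); $-e_{247}$ 14: 125,134,167,237,246,356,457; (10,10,12,14,16,12,10); $-e_{356}$ 15: 125,136,147,234,267,357,456; (10,14,16,10,12,12,10); $-e_{136}$ 16: 125,136,147,237,246,345,567; (12,14,14,14,14,12,4); $-e_{136}$ 17: 125,137,146,234,267,356,457; (10,14,16,10,12,12,10); $-e_{457}$ 18: 125,137,146,236,247,345,567; (12,14,14,14,14,12,4); $-e_{247}$ 19: 126,134,157,235,247,367,456; (12,10,14,12,16,10,10); $-e_{134}$ 20: 126,134,157,237,245,356,467;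 (12,10,14,14,14,12,8); $0$ 21: 126,135,147,234,257,367,456; (12,12,16,10,14,10,10); $-e_{257}$ 22: 126,135,147,237,245,346,567; (12,14,14,14,14,12,4); $-e_{245}$ 23: 126,137,145,234,257,356,467; (12,14,14,10,14,12,8); $-e_{126}$ 24: 126,137,145,235,247,346,567; (12,14,14,14,14,12,4); $-e_{137}$ 25: 127,134,156,235,246,367,457; (12,10,14,12,16,10,10); $-e_{235}$ 26: 127,134,156,236,245,357,467; (12,10,14,14,14,12,8); $-e_{467}$ 27: 127,135,146,234,256,367,457; (12,12,16,10,14,10,10); $-e_{146}$ 28: 127,135,146,236,245,347,567; (12,14,14,14,14,12,4); $-e_{135}$ 29: 127,136,145,234,256,357,467; (12,14,14,10,14,12,8); $-e_{357}$ 30: 127,136,145,235,246,347,567; (12,14,14,14,14,12,4); $-e_{246}$ *)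

theory Defs
  imports "HOL-Analysis.Analysis"
begin

text \<open>
  The Clifford algebra Cl(7,0). An element is given by its coefficients with respect to the \<open>2\<^sup>7\<close> basis blades
  \<open>e\<^sub>S = e\<^sub>s\<^sub>1 \<cdots> e\<^sub>s\<^sub>k\<close>, where \<open>S = {s\<^sub>1 < \<cdots> < s\<^sub>k} \<subseteq> {1..7}\<close>. Sorting the concatenated
  word and cancelling squares gives \<open>e\<^sub>S e\<^sub>T = \<plusminus>e\<^sub>U\<close> with \<open>U\<close> the symmetric
  difference and one sign change for every pair \<open>s \<in> S\<close>, \<open>t \<in> T\<close> with \<open>t < s\<close>.
\<close>

definition symdiff :: "nat set \<Rightarrow> nat set \<Rightarrow> nat set" where
  "symdiff S T = (S - T) \<union> (T - S)"

definition blade_sign :: "nat set \<Rightarrow> nat set \<Rightarrow> real" where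
  "blade_sign S T = (\<Prod>s\<in>S. \<Prod>t\<in>T. if t < s then -1 else 1)"

lemma symdiff_subset: "S \<subseteq> {1..7} \<Longrightarrow> T \<subseteq> {1..7} \<Longrightarrow> symdiff S T \<subseteq> {1..7}"
  by (auto simp: symdiff_def)

lemma symdiff_cancel [simp]: "symdiff S (symdiff S T) = T"
  by (auto simp: symdiff_def)

lemma symdiff_empty [simp]: "symdiff {} T = T" "symdiff T {} = T"
  by (auto simp: symdiff_def)

lemma symdiff_self [simp]: "symdiff S S = {}"
  by (auto simp: symdiff_def)

lemma symdiff_eq_empty: "symdiff S T = {} \<longleftrightarrow> S = T"
  by (auto simp: symdiff_def)

lemma symdiff_commute: "symdiff S T = symdiff T S"
  by (auto simp: symdiff_def)

lemma symdiff_assoc: "symdiff (symdiff R S) T = symdiff R (symdiff S T)"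
  by (auto simp: symdiff_def)

lemma finite_blade: "S \<subseteq> {1..7::nat} \<Longrightarrow> finite S"
  by (rule finite_subset) auto

lemma prod_symdiff:
  fixes f :: "nat \<Rightarrow> real"
  assumes "finite S" "finite T" "\<And>s. f s * f s = 1"
  shows "prod f (symdiff S T) = prod f S * prod f T"
proof -
  have 1: "prod f S = prod f (S - T) * prod f (S \<inter> T)"
    using assms(1) by (metis Diff_disjoint Int_Diff_Un Int_commute Un_commute
      finite_Diff finite_Int prod.union_disjoint Int_Diff_disjoint)
  have 2: "prod f T = prod f (T - S) * prod f (S \<inter> T)"
    using assms(2) by (metis Int_Diff_Un Int_commute Un_commute
      finite_Diff finite_Int prod.union_disjoint Int_Diff_disjoint)
  have 3: "prod f (symdiff S T) = prod f (S - T) * prod f (T - S)"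
    unfolding symdiff_def using assms by (intro prod.union_disjoint) auto
  have 4: "prod f (S \<inter> T) * prod f (S \<inter> T) = 1"
    by (simp add: assms flip: prod.distrib)
  have "prod f S * prod f T = prod f (S - T) * prod f (T - S) * (prod f (S \<inter> T) * prod f (S \<inter> T))"
    unfolding 1 2 by (simp only: ac_simps)
  then show ?thesis by (simp add: 3 4)
qed

lemma blade_sign_square: "blade_sign S T * blade_sign S T = 1"
  unfolding blade_sign_def by (simp flip: prod.distrib) (intro prod.neutral ballI, auto)

lemma blade_sign_empty [simp]: "blade_sign {} T = 1" "blade_sign S {} = 1"
  by (auto simp: blade_sign_def)

lemma blade_sign_symdiff_left:
  assumes "finite R" "finite S"
  shows "blade_sign (symdiff R S) T = blade_sign R T * blade_sign S T"
  unfolding blade_sign_def using assms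
  by (intro prod_symdiff) (auto simp flip: prod.distrib intro!: prod.neutral)

lemma blade_sign_symdiff_right:
  assumes "finite S" "finite T"
  shows "blade_sign R (symdiff S T) = blade_sign R S * blade_sign R T"
  unfolding blade_sign_def using assms
  by (subst prod_symdiff) (auto simp: prod.distrib)

lemma blade_sign_cocycle:
  assumes "finite R" "finite S" "finite U"
  shows "blade_sign R (symdiff R S) * blade_sign S (symdiff S U) =
         blade_sign R (symdiff R U) * blade_sign (symdiff R S) (symdiff S U)"
proof -
  have "finite (symdiff S U)" using assms by (auto simp: symdiff_def)
  then have "blade_sign R (symdiff R U) * blade_sign (symdiff R S) (symdiff S U) =
      (blade_sign R U * blade_sign R U) *
      (blade_sign R R * blade_sign R S * (blade_sign S S * blade_sign S U))"
    by (simp only: blade_sign_symdiff_left[OF assms(1,2)] blade_sign_symdiff_right[OF assms(1,3)]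
        blade_sign_symdiff_right[OF assms(2,3)] ac_simps)
  also have "\<dots> = blade_sign R (symdiff R S) * blade_sign S (symdiff S U)"
    by (simp only: blade_sign_square blade_sign_symdiff_right[OF assms(1,2)]
        blade_sign_symdiff_right[OF assms(2,3)] mult_1_left)
  finally show ?thesis ..
qed

typedef cl7 = "{x :: nat set \<Rightarrow> real. \<forall>S. \<not> S \<subseteq> {1..7} \<longrightarrow> x S = 0}"
  morphisms cl_coeff Abs_cl7
  by (intro exI[of _ "\<lambda>_. 0"]) simp

setup_lifting type_definition_cl7

lemma cl_coeff_outside: "\<not> S \<subseteq> {1..7} \<Longrightarrow> cl_coeff x S = 0"
  using cl_coeff[of x] by simp

lemma cl7_eqI:
  assumes "\<And>S. S \<subseteq> {1..7} \<Longrightarrow> cl_coeff x S = cl_coeff y S"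
  shows "x = y"
proof -
  have "cl_coeff x S = cl_coeff y S" for S
    using assms[of S] by (cases "S \<subseteq> {1..7}") (auto simp: cl_coeff_outside)
  then show ?thesis by (simp add: ext flip: cl_coeff_inject)
qed

instantiation cl7 :: real_algebra_1
begin

lift_definition zero_cl7 :: cl7 is "\<lambda>_. 0" by simp

lift_definition one_cl7 :: cl7 is "\<lambda>S. if S = {} then 1 else 0" by auto

lift_definition plus_cl7 :: "cl7 \<Rightarrow> cl7 \<Rightarrow> cl7" is "\<lambda>x y S. x S + y S" by simp

lift_definition minus_cl7 :: "cl7 \<Rightarrow> cl7 \<Rightarrow> cl7" is "\<lambda>x y S. x S - y S" by simp

lift_definition uminus_cl7 :: "cl7 \<Rightarrow> cl7" is "\<lambda>x S. - x S" by simp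

lift_definition scaleR_cl7 :: "real \<Rightarrow> cl7 \<Rightarrow> cl7" is "\<lambda>r x S. r * x S" by simp

lift_definition times_cl7 :: "cl7 \<Rightarrow> cl7 \<Rightarrow> cl7" is
  "\<lambda>x y U. if U \<subseteq> {1..7}
     then \<Sum>S\<in>Pow {1..7}. blade_sign S (symdiff S U) * x S * y (symdiff S U) else 0"
  by simp

instance
proof
  fix x y z :: cl7 and a b :: real
  show "x + y + z = x + (y + z)" by transfer (simp add: add.assoc)
  show "x + y = y + x" by transfer (simp add: add.commute)
  show "0 + x = x" by transfer simp
  show "- x + x = 0" by transfer simp
  show "x - y = x + - y" by transfer simp
  show "a *\<^sub>R (x + y) = a *\<^sub>R x + a *\<^sub>R y" by transfer (simp add: distrib_left)
  show "(a + b) *\<^sub>R x = a *\<^sub>R x + b *\<^sub>R x" by transfer (simp add: distrib_right)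
  show "a *\<^sub>R b *\<^sub>R x = (a * b) *\<^sub>R x" by transfer (simp add: mult.assoc)
  show "1 *\<^sub>R x = x" by transfer simp
  show "(x + y) * z = x * z + y * z"
    by transfer (auto simp: fun_eq_iff algebra_simps sum.distrib)
  show "x * (y + z) = x * y + x * z"
    by transfer (auto simp: fun_eq_iff algebra_simps sum.distrib)
  show "a *\<^sub>R x * y = a *\<^sub>R (x * y)"
    by transfer (auto simp: fun_eq_iff sum_distrib_left intro!: sum.cong)
  show "x * a *\<^sub>R y = a *\<^sub>R (x * y)"
    by transfer (auto simp: fun_eq_iff sum_distrib_left intro!: sum.cong)
  show "(0::cl7) \<noteq> 1" by transfer (auto simp: fun_eq_iff)
  show "1 * x = x"
  proof (rule cl7_eqI)
    fix U :: "nat set" assume U: "U \<subseteq> {1..7}"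
    have "cl_coeff (1 * x) U = (\<Sum>S\<in>Pow {1..7::nat}. if S = {} then cl_coeff x U else 0)"
      unfolding times_cl7.rep_eq one_cl7.rep_eq if_P[OF U] by (rule sum.cong) auto
    then show "cl_coeff (1 * x) U = cl_coeff x U" by (simp add: sum.delta)
  qed
  show "x * 1 = x"
  proof (rule cl7_eqI)
    fix U :: "nat set" assume U: "U \<subseteq> {1..7}"
    have "cl_coeff (x * 1) U = (\<Sum>S\<in>Pow {1..7}. if S = U then cl_coeff x U else 0)"
      unfolding times_cl7.rep_eq one_cl7.rep_eq if_P[OF U]
      by (rule sum.cong) (auto simp: symdiff_eq_empty)
    then show "cl_coeff (x * 1) U = cl_coeff x U" using U by (simp add: sum.delta)
  qed
  show "x * y * z = x * (y * z)"
  proof (rule cl7_eqI)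
    fix U :: "nat set" assume U: "U \<subseteq> {1..7}"
    have "cl_coeff (x * y * z) U = (\<Sum>S\<in>Pow {1..7}. \<Sum>R\<in>Pow {1..7}.
        cl_coeff x R * (cl_coeff y (symdiff R S) * cl_coeff z (symdiff S U) *
          (blade_sign R (symdiff R S) * blade_sign S (symdiff S U))))"
      unfolding times_cl7.rep_eq[of "x * y" z] if_P[OF U]
      by (rule sum.cong) (simp_all add: times_cl7.rep_eq sum_distrib_left sum_distrib_right mult_ac)
    also have "\<dots> = (\<Sum>R\<in>Pow {1..7}. \<Sum>S\<in>Pow {1..7}.
        cl_coeff x R * (cl_coeff y (symdiff R S) * cl_coeff z (symdiff S U) *
          (blade_sign R (symdiff R U) * blade_sign (symdiff R S) (symdiff S U))))"
      using U by (subst sum.swap, intro sum.cong refl)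
        (simp add: blade_sign_cocycle finite_blade)
    also have "\<dots> = (\<Sum>R\<in>Pow {1..7}. \<Sum>T\<in>Pow {1..7}.
        cl_coeff x R * (cl_coeff y T * cl_coeff z (symdiff T (symdiff R U)) *
          (blade_sign R (symdiff R U) * blade_sign T (symdiff T (symdiff R U)))))"
    proof (rule sum.cong[OF refl])
      fix R assume R: "R \<in> Pow {1..7::nat}"
      have *: "symdiff (symdiff R S) (symdiff R U) = symdiff S U" for S
        by (auto simp: symdiff_def)
      show "(\<Sum>S\<in>Pow {1..7}. cl_coeff x R * (cl_coeff y (symdiff R S) * cl_coeff z (symdiff S U) *
          (blade_sign R (symdiff R U) * blade_sign (symdiff R S) (symdiff S U)))) =
        (\<Sum>T\<in>Pow {1..7}. cl_coeff x R * (cl_coeff y T * cl_coeff z (symdiff T (symdiff R U)) *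
          (blade_sign R (symdiff R U) * blade_sign T (symdiff T (symdiff R U)))))"
        by (rule sum.reindex_bij_witness[of _ "symdiff R" "symdiff R"])
          (use R symdiff_subset in \<open>simp_all add: *\<close>)
    qed
    also have "\<dots> = cl_coeff (x * (y * z)) U"
      unfolding times_cl7.rep_eq[of x "y * z"] if_P[OF U]
    proof (rule sum.cong[OF refl])
      fix R assume "R \<in> Pow {1..7::nat}"
      then have "symdiff R U \<subseteq> {1..7}" using U symdiff_subset by blast
      then show "(\<Sum>T\<in>Pow {1..7}. cl_coeff x R * (cl_coeff y T * cl_coeff z (symdiff T (symdiff R U)) *
          (blade_sign R (symdiff R U) * blade_sign T (symdiff T (symdiff R U))))) =
        blade_sign R (symdiff R U) * cl_coeff x R * cl_coeff (y * z) (symdiff R U)"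
        by (simp only: times_cl7.rep_eq if_True sum_distrib_left mult_ac)
    qed
    finally show "cl_coeff (x * y * z) U = cl_coeff (x * (y * z)) U" .
  qed
qed

end

lift_definition blade :: "nat set \<Rightarrow> cl7" is "\<lambda>S U. if U = S \<and> S \<subseteq> {1..7} then 1 else 0"
  by auto

definition cl_e :: "nat \<Rightarrow> cl7" where
  "cl_e a = blade {a}"

lemma blade_times_blade:
  assumes "S \<subseteq> {1..7}" "T \<subseteq> {1..7}"
  shows "blade S * blade T = blade_sign S T *\<^sub>R blade (symdiff S T)"
proof (rule cl7_eqI)
  fix U :: "nat set" assume U: "U \<subseteq> {1..7}"
  have eq: "symdiff S U = T \<longleftrightarrow> U = symdiff S T" by (auto simp: symdiff_def)
  have "cl_coeff (blade S * blade T) U =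
      (\<Sum>R\<in>Pow {1..7}. if R = S then (if U = symdiff S T then blade_sign S T else 0) else 0)"
    unfolding times_cl7.rep_eq if_P[OF U]
    by (rule sum.cong) (use assms eq in \<open>auto simp: blade.rep_eq\<close>)
  then show "cl_coeff (blade S * blade T) U = cl_coeff (blade_sign S T *\<^sub>R blade (symdiff S T)) U"
    using assms symdiff_subset[OF assms]
    by (simp add: sum.delta scaleR_cl7.rep_eq blade.rep_eq)
qed

lemma blade_empty: "blade {} = 1"
  by transfer (auto simp: fun_eq_iff)

lemma cl_e_square: "a \<in> {1..7} \<Longrightarrow> cl_e a * cl_e a = 1"
  by (simp add: cl_e_def blade_times_blade blade_empty blade_sign_def)

lemma cl_e_anticommute:
  assumes "a \<in> {1..7}" "b \<in> {1..7}" "a \<noteq> b"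
  shows "cl_e a * cl_e b = - (cl_e b * cl_e a)"
proof -
  have "blade_sign {a} {b} = - blade_sign {b} {a}"
    using assms(3) by (auto simp: blade_sign_def)
  then show ?thesis using assms symdiff_commute[of "{a}" "{b}"]
    by (simp add: cl_e_def blade_times_blade)
qed

lemma blade_insert:
  assumes "a \<in> {1..7}" "S \<subseteq> {1..7}" "\<And>s. s \<in> S \<Longrightarrow> a < s"
  shows "blade (insert a S) = cl_e a * blade S"
proof -
  have "blade_sign {a} S = 1"
    using assms(3) by (force simp: blade_sign_def intro!: prod.neutral)
  moreover have "symdiff {a} S = insert a S" using assms(3) by (auto simp: symdiff_def)
  ultimately show ?thesis using assms by (simp add: cl_e_def blade_times_blade)
qed

lemma cl_coeff_sum: "cl_coeff (sum f A) S = (\<Sum>i\<in>A. cl_coeff (f i) S)"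
  by (induction A rule: infinite_finite_induct) (auto simp: zero_cl7.rep_eq plus_cl7.rep_eq)

lemma blade_expansion: "x = (\<Sum>S\<in>Pow {1..7}. cl_coeff x S *\<^sub>R blade S)"
proof (rule cl7_eqI)
  fix U :: "nat set" assume U: "U \<subseteq> {1..7}"
  have "cl_coeff (\<Sum>S\<in>Pow {1..7}. cl_coeff x S *\<^sub>R blade S) U =
      (\<Sum>S\<in>Pow {1..7}. if S = U then cl_coeff x U else 0)"
    unfolding cl_coeff_sum by (rule sum.cong) (auto simp: scaleR_cl7.rep_eq blade.rep_eq)
  then show "cl_coeff x U = cl_coeff (\<Sum>S\<in>Pow {1..7}. cl_coeff x S *\<^sub>R blade S) U"
    using U by (simp add: sum.delta)
qed

type_synonym triple = "nat \<times> nat \<times> nat"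

fun e3 :: "triple \<Rightarrow> cl7" where
  "e3 (a, b, c) = cl_e a * cl_e b * cl_e c"

definition pseudoscalar :: cl7 where
  "pseudoscalar = cl_e 1 * cl_e 2 * cl_e 3 * cl_e 4 * cl_e 5 * cl_e 6 * cl_e 7"

text \<open>
  A row consists of the terms of the form, the numbers assigned to them, and the signed
  remainder of the all-positive form, with \<^const>\<open>None\<close> for the remainder 0.
\<close>

definition primary_table :: "(triple list \<times> nat list \<times> (int \<times> triple) option) list" where
  "primary_table = [
    ([(1,2,3), (1,4,5), (1,6,7), (2,4,6), (2,5,7), (3,4,7), (3,5,6)],
     [4, 12, 12, 14, 14, 14, 14], Some (-1, (2,4,6))),
    ([(1,2,3), (1,4,5), (1,6,7), (2,4,7), (2,5,6), (3,4,6), (3,5,7)],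
     [4, 12, 12, 14, 14, 14, 14], Some (-1, (3,5,7))),
    ([(1,2,3), (1,4,6), (1,5,7), (2,4,5), (2,6,7), (3,4,7), (3,5,6)],
     [4, 14, 14, 12, 12, 14, 14], Some (-1, (1,5,7))),
    ([(1,2,3), (1,4,6), (1,5,7), (2,4,7), (2,5,6), (3,4,5), (3,6,7)],
     [4, 14, 14, 14, 14, 12, 12], Some (-1, (1,4,6))),
    ([(1,2,3), (1,4,7), (1,5,6), (2,4,5), (2,6,7), (3,4,6), (3,5,7)],
     [4, 14, 14, 12, 12, 14, 14], Some (-1, (3,4,6))),
    ([(1,2,3), (1,4,7), (1,5,6), (2,4,6), (2,5,7), (3,4,5), (3,6,7)],
     [4, 14, 14, 14, 14, 12, 12], Some (-1, (2,5,7))),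
    ([(1,2,4), (1,3,5), (1,6,7), (2,3,6), (2,5,7), (3,4,7), (4,5,6)],
     [8, 12, 12, 14, 14, 14, 10], Some (-1, (1,3,5))),
    ([(1,2,4), (1,3,5), (1,6,7), (2,3,7), (2,5,6), (3,4,6), (4,5,7)],
     [8, 12, 12, 14, 14, 14, 10], Some (-1, (1,2,4))),
    ([(1,2,4), (1,3,6), (1,5,7), (2,3,5), (2,6,7), (3,4,7), (4,5,6)],
     [8, 14, 14, 12, 12, 14, 10], Some (-1, (2,6,7))),
    ([(1,2,4), (1,3,6), (1,5,7), (2,3,7), (2,5,6), (3,4,5), (4,6,7)],
     [8, 14, 14, 14, 14, 12, 8], Some (-1, (2,3,7))),
    ([(1,2,4), (1,3,7), (1,5,6), (2,3,5), (2,6,7), (3,4,6), (4,5,7)],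
     [8, 14, 14, 12, 12, 14, 10], None),
    ([(1,2,4), (1,3,7), (1,5,6), (2,3,6), (2,5,7), (3,4,5), (4,6,7)],
     [8, 14, 14, 14, 14, 12, 8], Some (-1, (1,5,6))),
    ([(1,2,5), (1,3,4), (1,6,7), (2,3,6), (2,4,7), (3,5,7), (4,5,6)],
     [10, 10, 12, 14, 16, 12, 10], Some (-1, (2,4,7))),
    ([(1,2,5), (1,3,4), (1,6,7), (2,3,7), (2,4,6), (3,5,6), (4,5,7)],
     [10, 10, 12, 14, 16, 12, 10], Some (-1, (3,5,6))),
    ([(1,2,5), (1,3,6), (1,4,7), (2,3,4), (2,6,7), (3,5,7), (4,5,6)],
     [10, 14, 16, 10, 12, 12, 10], Some (-1, (1,3,6))),
    ([(1,2,5), (1,3,6), (1,4,7), (2,3,7), (2,4,6), (3,4,5), (5,6,7)],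
     [12, 14, 14, 14, 14, 12, 4], Some (-1, (1,3,6))),
    ([(1,2,5), (1,3,7), (1,4,6), (2,3,4), (2,6,7), (3,5,6), (4,5,7)],
     [10, 14, 16, 10, 12, 12, 10], Some (-1, (4,5,7))),
    ([(1,2,5), (1,3,7), (1,4,6), (2,3,6), (2,4,7), (3,4,5), (5,6,7)],
     [12, 14, 14, 14, 14, 12, 4], Some (-1, (2,4,7))),
    ([(1,2,6), (1,3,4), (1,5,7), (2,3,5), (2,4,7), (3,6,7), (4,5,6)],
     [12, 10, 14, 12, 16, 10, 10], Some (-1, (1,3,4))),
    ([(1,2,6), (1,3,4), (1,5,7), (2,3,7), (2,4,5), (3,5,6), (4,6,7)],
     [12, 10, 14, 14, 14, 12, 8], None),
    ([(1,2,6), (1,3,5), (1,4,7), (2,3,4), (2,5,7), (3,6,7), (4,5,6)],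
     [12, 12, 16, 10, 14, 10, 10], Some (-1, (2,5,7))),
    ([(1,2,6), (1,3,5), (1,4,7), (2,3,7), (2,4,5), (3,4,6), (5,6,7)],
     [12, 14, 14, 14, 14, 12, 4], Some (-1, (2,4,5))),
    ([(1,2,6), (1,3,7), (1,4,5), (2,3,4), (2,5,7), (3,5,6), (4,6,7)],
     [12, 14, 14, 10, 14, 12, 8], Some (-1, (1,2,6))),
    ([(1,2,6), (1,3,7), (1,4,5), (2,3,5), (2,4,7), (3,4,6), (5,6,7)],
     [12, 14, 14, 14, 14, 12, 4], Some (-1, (1,3,7))),
    ([(1,2,7), (1,3,4), (1,5,6), (2,3,5), (2,4,6), (3,6,7), (4,5,7)],
     [12, 10, 14, 12, 16, 10, 10], Some (-1, (2,3,5))),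
    ([(1,2,7), (1,3,4), (1,5,6), (2,3,6), (2,4,5), (3,5,7), (4,6,7)],
     [12, 10, 14, 14, 14, 12, 8], Some (-1, (4,6,7))),
    ([(1,2,7), (1,3,5), (1,4,6), (2,3,4), (2,5,6), (3,6,7), (4,5,7)],
     [12, 12, 16, 10, 14, 10, 10], Some (-1, (1,4,6))),
    ([(1,2,7), (1,3,5), (1,4,6), (2,3,6), (2,4,5), (3,4,7), (5,6,7)],
     [12, 14, 14, 14, 14, 12, 4], Some (-1, (1,3,5))),
    ([(1,2,7), (1,3,6), (1,4,5), (2,3,4), (2,5,6), (3,5,7), (4,6,7)],
     [12, 14, 14, 10, 14, 12, 8], Some (-1, (3,5,7))),
    ([(1,2,7), (1,3,6), (1,4,5), (2,3,5), (2,4,6), (3,4,7), (5,6,7)],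
     [12, 14, 14, 14, 14, 12, 4], Some (-1, (2,4,6)))
]"

definition primary_terms :: "nat \<Rightarrow> triple list" where
  "primary_terms i = fst (primary_table ! (i - 1))"

definition primary_numbers :: "nat \<Rightarrow> nat list" where
  "primary_numbers i = fst (snd (primary_table ! (i - 1)))"

definition primary_remainder :: "nat \<Rightarrow> (int \<times> triple) option" where
  "primary_remainder i = snd (snd (primary_table ! (i - 1)))"

text \<open>
  The 21 pairs of indices occurring in the seven terms of a form are distinct, so every pair
  of indices lies in exactly one term.
\<close>

lemma primary_table_pairs:
  "list_all (\<lambda>(ts, _). length ts = 7 \<and>
     list_all (\<lambda>(a, b, c). 1 \<le> a \<and> a < b \<and> b < c \<and> c \<le> 7) ts \<and>
     distinct (concat (map (\<lambda>(a, b, c). [(a, b), (a, c), (b, c)]) ts))) primary_table"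
  unfolding primary_table_def by simp

definition sign_patterns :: "int list set" where
  "sign_patterns = {ss. length ss = 7 \<and> set ss \<subseteq> {1, -1}}"

definition signed_form :: "nat \<Rightarrow> int list \<Rightarrow> cl7" where
  "signed_form i ss = (\<Sum>m<7. real_of_int (ss ! m) *\<^sub>R e3 (primary_terms i ! m))"

definition num_minus :: "int list \<Rightarrow> nat" where
  "num_minus ss = count_list ss (-1)"

definition rho :: "nat \<Rightarrow> int list \<Rightarrow> cl7" where
  "rho i ss = (1 / 4) *\<^sub>R (3 *\<^sub>R pseudoscalar - (-1) ^ num_minus ss * signed_form i ss)"

definition has_remainder :: "nat \<Rightarrow> int list \<Rightarrow> int \<Rightarrow> triple \<Rightarrow> bool" where
  "has_remainder i ss s t \<longleftrightarrow> t \<in> set (primary_terms i) \<and> s \<in> {1, -1} \<and>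
     2 * pseudoscalar * ((rho i ss)\<^sup>2 + 1) =
       real_of_int s *\<^sub>R e3 t + (-1) ^ num_minus ss * signed_form i ss"

text \<open>
  The grade 3 part of a Clifford element, read as a constant 3-form on \<open>\<real>\<^sup>7\<close>: the
  blade \<open>e\<^sub>a\<^sub>b\<^sub>c\<close> becomes \<open>dx\<^sub>a \<and> dx\<^sub>b \<and> dx\<^sub>c\<close>. The coordinate with index 7 is the one with
  index \<open>0 = 7\<close> in the finite type \<open>7\<close>. Constant forms are closed, so such a form is a
  calibration iff its comass is 1.
\<close>

definition unique_triples :: "triple set" where
  "unique_triples = {(a, b, c). 1 \<le> a \<and> a < b \<and> b < c \<and> c \<le> 7}"

definition form3 :: "cl7 \<Rightarrow> real^7 \<Rightarrow> real^7 \<Rightarrow> real^7 \<Rightarrow> real" where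
  "form3 x u v w = (\<Sum>(a, b, c)\<in>unique_triples. cl_coeff x {a, b, c} *
     det (vector [vector [u $ of_nat a, u $ of_nat b, u $ of_nat c],
                  vector [v $ of_nat a, v $ of_nat b, v $ of_nat c],
                  vector [w $ of_nat a, w $ of_nat b, w $ of_nat c]] :: real^3^3))"

definition comass :: "cl7 \<Rightarrow> real" where
  "comass x = Sup {form3 x u v w | u v w.
     norm u = 1 \<and> norm v = 1 \<and> norm w = 1 \<and> u \<bullet> v = 0 \<and> u \<bullet> w = 0 \<and> v \<bullet> w = 0}"

definition calibration :: "cl7 \<Rightarrow> bool" where
  "calibration x \<longleftrightarrow> comass x = 1"

text \<open>
  The algebra generated by a signed form lives on \<open>\<real>\<^sup>8\<close>; the basis vector with index 0 is
  its unit. Since every pair of indices lies in exactly one term, at most one summand of the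
  sum in \<open>basis_product\<close> is nonzero.
\<close>

definition alg_p :: "nat \<Rightarrow> real^8" where
  "alg_p a = axis (of_nat a) 1"

fun term_product :: "nat \<Rightarrow> nat \<Rightarrow> int \<times> triple \<Rightarrow> real^8" where
  "term_product a b (s, (u, v, w)) =
     (if (a, b) = (u, v) then of_int s *\<^sub>R alg_p w
      else if (a, b) = (v, w) then of_int s *\<^sub>R alg_p u
      else if (a, b) = (w, u) then of_int s *\<^sub>R alg_p v
      else if (a, b) = (v, u) then - of_int s *\<^sub>R alg_p w
      else if (a, b) = (w, v) then - of_int s *\<^sub>R alg_p u
      else if (a, b) = (u, w) then - of_int s *\<^sub>R alg_p v
      else 0)"

definition basis_product :: "nat \<Rightarrow> int list \<Rightarrow> nat \<Rightarrow> nat \<Rightarrow> real^8" where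
  "basis_product i ss a b =
     (if a = 0 then alg_p b else if b = 0 then alg_p a else if a = b then - alg_p 0
      else sum_list (map (term_product a b) (zip ss (primary_terms i))))"

definition alg_mult :: "nat \<Rightarrow> int list \<Rightarrow> real^8 \<Rightarrow> real^8 \<Rightarrow> real^8" where
  "alg_mult i ss x y = (\<Sum>a\<le>7. \<Sum>b\<le>7. (x $ of_nat a * y $ of_nat b) *\<^sub>R basis_product i ss a b)"

lemma alg_mult_alg_p:
  assumes "a \<le> 7" "b \<le> 7"
  shows "alg_mult i ss (alg_p a) (alg_p b) = basis_product i ss a b"
proof -
  have inj: "(of_nat c :: 8) = of_nat d \<longleftrightarrow> c = d" if "c \<le> 7" "d \<le> 7" for c d
    using that by (simp add: bit0.of_nat_eq Abs_bit0_inject)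
  have "alg_mult i ss (alg_p a) (alg_p b) =
      (\<Sum>c\<le>7. \<Sum>d\<le>7. if d = b then (if c = a then basis_product i ss a b else 0) else 0)"
    unfolding alg_mult_def alg_p_def using assms
    by (intro sum.cong refl) (auto simp: axis_def inj)
  then show ?thesis using assms by simp
qed

definition assoc_at :: "('a \<Rightarrow> 'a \<Rightarrow> 'a) \<Rightarrow> 'a \<Rightarrow> 'a \<Rightarrow> 'a \<Rightarrow> bool" where
  "assoc_at f x y z \<longleftrightarrow> f (f x y) z = f x (f y z)"

definition nonassoc_triples :: "(real^8 \<Rightarrow> real^8 \<Rightarrow> real^8) \<Rightarrow> triple set" where
  "nonassoc_triples f = {(a, b, c)\<in>unique_triples. \<not> assoc_at f (alg_p a) (alg_p b) (alg_p c)}"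

definition assoc_triples :: "(real^8 \<Rightarrow> real^8 \<Rightarrow> real^8) \<Rightarrow> triple set" where
  "assoc_triples f = {(a, b, c)\<in>unique_triples. assoc_at f (alg_p a) (alg_p b) (alg_p c)}"

text \<open>The Cayley-Dickson construction, applied twice to the complex numbers.\<close>

type_synonym quat = "complex \<times> complex"
type_synonym oct = "quat \<times> quat"

fun quat_mult :: "quat \<Rightarrow> quat \<Rightarrow> quat" where
  "quat_mult (a, b) (c, d) = (a * c - cnj d * b, d * a + b * cnj c)"

fun quat_cnj :: "quat \<Rightarrow> quat" where
  "quat_cnj (a, b) = (cnj a, - b)"

fun oct_mult :: "oct \<Rightarrow> oct \<Rightarrow> oct" where
  "oct_mult (x, y) (z, w) =
     (quat_mult x z - quat_mult (quat_cnj w) y, quat_mult w x + quat_mult y (quat_cnj z))"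

definition iso_octonions :: "(real^8 \<Rightarrow> real^8 \<Rightarrow> real^8) \<Rightarrow> bool" where
  "iso_octonions f \<longleftrightarrow> (\<exists>h :: real^8 \<Rightarrow> oct. linear h \<and> bij h \<and>
     (\<forall>x y. h (f x y) = oct_mult (h x) (h y)))"

end

theory Submission
  imports Defs
begin

text \<open>
  The seven terms of a primary form are the lines of a Fano plane on the points 1, ..., 7, and
  any two Fano planes differ by a relabelling of the points. Every row is relabelled onto row 11,
  whose all-positive form generates the octonions; the price is a change of the seven signs and of
  the order of the indices. Everything except the number of non-associative triples is insensitive
  to that order, so the theorem is about row 11 with arbitrary signs \<open>t\<close>
  (\<open>sum_relabel\<close>, \<open>prod_relative_signs\<close>, \<open>alg_mult_relabel\<close>).

  For a point \<open>p\<close> let \<open>point_sign t p\<close> be the product of the signs of the four lines that miss \<open>p\<close>. If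
  \<open>p\<close>, \<open>q\<close>, \<open>r\<close> are the points of a line, each of the other six lines contains exactly one of them
  and hence misses two, so the three point signs multiply to 1. The point signs therefore form a
  character of the group of order 8 whose non-trivial elements are the points and in which the
  points of a line multiply to 1. Such a character is trivial, or its kernel consists of the
  identity and the points of one line (\<open>character_cases\<close>). These are the two cases of the theorem,
  and the line in the second case is the term in the remainder.

  In the Clifford algebra, the signed terms \<open>F\<^sub>k\<close> commute, square to -1, and for three lines through a
  point the product of two of them is \<open>\<plusminus>\<close> the volume element times the third. Squaring gives
  \<open>2I(\<rho>\<^sup>2 + 1)\<close> as the combination of the \<open>F\<^sub>k\<close> with coefficients
  \<open>(-1)\<^sup>\<sigma>(3 - s\<^sub>k)/4\<close>, where \<open>s\<^sub>k\<close> is the sum of the three point signs on the line \<open>k\<close>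
  (\<open>remainder_identity\<close>). For the trivial character all \<open>s\<^sub>k\<close> are 3; otherwise \<open>s\<^sub>k\<close> is 3 on the kernel line and
  -1 on the other lines.

  In the generated algebra, the two bracketings of \<open>p\<^sub>x p\<^sub>y p\<^sub>z\<close>, for points not on a line, use exactly the four
  lines that miss the third point \<open>q\<close> of the line through \<open>x\<close> and \<open>z\<close>; they agree iff the point sign of
  \<open>q\<close> is -1 (\<open>std_assoc_iff\<close>). So the non-associative unique triples are the 28 triples off the
  lines in the trivial case, and those with \<open>q\<close> on the kernel line in the other case; the
  numbers of the table count the latter.

  If the character is trivial, changing the signs of basis vectors turns the algebra into the octonions,
  isometrically. Then \<open>norm (xy) = norm x * norm y\<close>, and since \<open>\<Phi>(u, v, w) = (uv) \<bullet> w\<close>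
  (\<open>form3_alg_mult\<close>), the form has comass 1. If some point sign is -1, there are four basis vectors
  with \<open>(p\<^sub>a + p\<^sub>b)(p\<^sub>c - s p\<^sub>d) = 0\<close> while all products add up in \<open>(p\<^sub>a + p\<^sub>b)(p\<^sub>c + s p\<^sub>d)\<close>
  (\<open>std_degenerate_square\<close>). The first equation excludes the octonions, the second gives a value
  \<open>sqrt 2\<close> of the form on orthonormal vectors.
\<close>

section \<open>Relabelling the rows\<close>

fun orient :: "triple \<Rightarrow> triple \<Rightarrow> int" where
  "orient (a, b, c) t =
     (if t = (a, b, c) \<or> t = (b, c, a) \<or> t = (c, a, b) then 1
      else if t = (b, a, c) \<or> t = (a, c, b) \<or> t = (c, b, a) then -1 else 0)"

fun relabel :: "(nat \<Rightarrow> nat) \<Rightarrow> triple \<Rightarrow> triple" where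
  "relabel l (a, b, c) = (l a, l b, l c)"

text \<open>
  The third entry of a triple containing \<open>a\<close> and \<open>b\<close>. The value 0 for all other
  triples makes the sum in \<open>third\<close> pick out the only triple with both entries.
\<close>

fun other :: "nat \<Rightarrow> nat \<Rightarrow> triple \<Rightarrow> nat" where
  "other a b (u, v, w) =
     (if (a, b) = (u, v) \<or> (a, b) = (v, u) then w
      else if (a, b) = (v, w) \<or> (a, b) = (w, v) then u
      else if (a, b) = (u, w) \<or> (a, b) = (w, u) then v else 0)"

definition third :: "triple list \<Rightarrow> nat \<Rightarrow> nat \<Rightarrow> nat" where
  "third ts a b = sum_list (map (other a b) ts)"

text \<open>
  Row 11 serves as the standard Fano plane, since its all-positive form is octonionic.
\<close>

abbreviation std :: "triple list" where "std \<equiv> primary_terms 11"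

text \<open>
  Two points and a third one off their line generate a Fano plane, so a relabelling is fixed by the
  images of 1, 2 and 3; the other entries follow the lines 124, 235, 346 and 137 of the standard plane.
  The entry 0 at the front stands for the unit of the algebra and aligns positions with labels.
\<close>

definition labelling :: "triple list \<Rightarrow> nat list" where
  "labelling ts = (let d = third ts 1 2; c = (if d = 3 then 4 else 3) in
     [0, 1, 2, c, d, third ts 2 c, third ts c d, third ts 1 c])"

definition line_order :: "triple list \<Rightarrow> nat list \<Rightarrow> nat list" where
  "line_order ts l =
     map (\<lambda>u. the (find (\<lambda>m. orient (ts ! m) (relabel ((!) l) u) \<noteq> 0) [0..<7])) std"

definition orientations :: "triple list \<Rightarrow> nat list \<Rightarrow> nat list \<Rightarrow> int list" where
  "orientations ts l ms = map2 (\<lambda>m u. orient (ts ! m) (relabel ((!) l) u)) ms std"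

text \<open>
  The sign of the permutation that sorts a list of distinct numbers.
\<close>

fun word_sign :: "nat list \<Rightarrow> int" where
  "word_sign [] = 1"
| "word_sign (x # xs) = (\<Prod>y\<leftarrow>xs. if y < x then -1 else 1) * word_sign xs"

text \<open>
  The labelling permutes the indices, the lines of the standard plane go to the lines of the row, and the
  orientations of the lines multiply to the sign of the labelling. The last condition makes
  \<open>\<rho>\<close> agree, up to sign, with the same expression in the relabelled generators. The
  next two predicates only arrange that each list is evaluated once.
\<close>

definition well_matched :: "nat list \<Rightarrow> nat list \<Rightarrow> int list \<Rightarrow> bool" where
  "well_matched l ms os \<longleftrightarrow> hd l = 0 \<and> sort l = [0..<8] \<and> sort ms = [0..<7] \<and>
     set os \<subseteq> {1, -1} \<and> prod_list os = word_sign (tl l)"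

definition well_ordered :: "triple list \<Rightarrow> nat list \<Rightarrow> nat list \<Rightarrow> bool" where
  "well_ordered ts l ms \<longleftrightarrow> well_matched l ms (orientations ts l ms)"

definition well_labelled :: "triple list \<Rightarrow> nat list \<Rightarrow> bool" where
  "well_labelled ts l \<longleftrightarrow> well_ordered ts l (line_order ts l)"

lemma std_terms:
  "std = [(1,2,4), (1,3,7), (1,5,6), (2,3,5), (2,6,7), (3,4,6), (4,5,7)]"
  by (simp add: primary_terms_def primary_table_def)

lemma rows_well_labelled: "list_all (\<lambda>r. well_labelled (fst r) (labelling (fst r))) primary_table"
  unfolding primary_table_def list.pred_inject fst_conv
  by (intro conjI TrueI; simp add: labelling_def third_def Let_def well_labelled_def well_ordered_def
    well_matched_def line_order_def orientations_def std_terms upt_rec del: One_nat_def)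

definition label :: "nat \<Rightarrow> nat \<Rightarrow> nat" where
  "label i x = labelling (primary_terms i) ! x"

definition line :: "nat \<Rightarrow> nat \<Rightarrow> nat" where
  "line i k = line_order (primary_terms i) (labelling (primary_terms i)) ! k"

definition orientation :: "nat \<Rightarrow> nat \<Rightarrow> int" where
  "orientation i k = orient (primary_terms i ! line i k) (relabel (label i) (std ! k))"

text \<open>
  The signs of the form with respect to the images of the standard lines with their standard orientation.
\<close>

definition relative_signs :: "nat \<Rightarrow> int list \<Rightarrow> int list" where
  "relative_signs i ss = map (\<lambda>k. ss ! line i k * orientation i k) [0..<7]"

lemma row_in_table:
  assumes "i \<in> {1..30}"
  shows "primary_table ! (i - 1) \<in> set primary_table"
  using assms by (intro nth_mem) (auto simp: primary_table_def)

lemma row_well_labelled: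
  assumes "i \<in> {1..30}"
  shows "well_labelled (primary_terms i) (labelling (primary_terms i))"
  using row_in_table[OF assms] rows_well_labelled
  by (auto simp: list_all_iff primary_terms_def)

lemma row_terms:
  assumes "i \<in> {1..30}"
  shows "length (primary_terms i) = 7"
    "t \<in> set (primary_terms i) \<Longrightarrow> \<exists>a b c. t = (a, b, c) \<and> 1 \<le> a \<and> a < b \<and> b < c \<and> c \<le> 7"
    "distinct (primary_terms i)"
proof -
  have *: "length ts = 7 \<and> list_all (\<lambda>(a, b, c). 1 \<le> a \<and> a < b \<and> b < c \<and> c \<le> 7) ts \<and>
     distinct (concat (map (\<lambda>(a, b, c). [(a, b), (a, c), (b, c)]) ts))"
    if "ts = primary_terms i" for ts
    using bspec[OF primary_table_pairs[unfolded list_all_iff] row_in_table[OF assms]]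
    unfolding that primary_terms_def case_prod_beta list_all_iff by simp
  show "length (primary_terms i) = 7" using * by blast
  show "t \<in> set (primary_terms i) \<Longrightarrow> \<exists>a b c. t = (a, b, c) \<and> 1 \<le> a \<and> a < b \<and> b < c \<and> c \<le> 7"
    using *[OF refl] by (cases t) (auto simp: list_all_iff dest!: bspec)
  have "distinct (removeAll [] (map (\<lambda>(a, b, c). [(a, b), (a, c), (b, c)]) (primary_terms i)))"
    using *[OF refl] by (simp only: distinct_concat_iff)
  moreover have "removeAll [] (map (\<lambda>(a, b, c). [(a, b), (a, c), (b, c)]) (primary_terms i)) =
      map (\<lambda>(a, b, c). [(a, b), (a, c), (b, c)]) (primary_terms i)"
    by (rule removeAll_id) auto
  ultimately show "distinct (primary_terms i)" by (simp only: distinct_map)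
qed

locale primary_row =
  fixes i :: nat
  assumes row: "i \<in> {1..30}"
begin

lemmas terms = row_terms[OF row]

lemma
  label_0: "label i 0 = 0" and
  label_set: "set (map (label i) [0..<8]) = {0..<8}" and
  label_distinct: "distinct (map (label i) [0..<8])" and
  line_set: "set (map (line i) [0..<7]) = {0..<7}" and
  line_distinct: "distinct (map (line i) [0..<7])" and
  orientation_map: "map (orientation i) [0..<7] =
    orientations (primary_terms i) (labelling (primary_terms i)) (line_order (primary_terms i) (labelling (primary_terms i)))" and
  orientation: "k < 7 \<Longrightarrow> orientation i k \<in> {1, -1}" and
  prod_orientation: "(\<Prod>k<7. orientation i k) = word_sign (map (label i) [1..<8])"
proof -
  define l where "l = labelling (primary_terms i)"
  define ms where "ms = line_order (primary_terms i) l"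
  define os where "os = orientations (primary_terms i) l ms"
  have wm: "hd l = 0" "sort l = [0..<8]" "sort ms = [0..<7]" "set os \<subseteq> {1, -1}" "prod_list os = word_sign (tl l)"
    using row_well_labelled[OF row]
    unfolding well_labelled_def well_ordered_def well_matched_def os_def ms_def l_def by auto
  have len: "length l = 8" "length ms = 7"
    using arg_cong[OF wm(2), of length] arg_cong[OF wm(3), of length] by auto
  have ml: "map (label i) [0..<8] = l"
    by (rule nth_equalityI) (auto simp: label_def l_def[symmetric] len)
  have mm: "map (line i) [0..<7] = ms"
    by (rule nth_equalityI) (auto simp: line_def l_def[symmetric] ms_def[symmetric] len)
  have mo: "map (orientation i) [0..<7] = os"
  proof (rule nth_equalityI)
    fix k assume "k < length (map (orientation i) [0..<7])"
    then have "k < 7" by simp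
    moreover have "(!) l = label i" by (auto simp: fun_eq_iff label_def l_def)
    ultimately show "map (orientation i) [0..<7] ! k = os ! k"
      by (simp add: orientation_def os_def orientations_def len std_terms line_def l_def[symmetric] ms_def[symmetric])
  qed (auto simp: os_def orientations_def len std_terms)
  then show "map (orientation i) [0..<7] =
    orientations (primary_terms i) (labelling (primary_terms i)) (line_order (primary_terms i) (labelling (primary_terms i)))"
    by (simp only: os_def ms_def l_def)
  show "set (map (label i) [0..<8]) = {0..<8}"
    unfolding ml using arg_cong[OF wm(2), of set] by simp
  show "distinct (map (label i) [0..<8])"
    unfolding ml using arg_cong[OF wm(2), of distinct] by simp
  show "set (map (line i) [0..<7]) = {0..<7}"
    unfolding mm using arg_cong[OF wm(3), of set] by simp
  show "distinct (map (line i) [0..<7])"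
    unfolding mm using arg_cong[OF wm(3), of distinct] by simp
  have "l \<noteq> []" using len by auto
  then show "label i 0 = 0" using wm(1) by (simp add: label_def l_def[symmetric] hd_conv_nth)
  show "orientation i k \<in> {1, -1}" if "k < 7"
  proof -
    have "orientation i k \<in> set (map (orientation i) [0..<7])" using that by auto
    then show ?thesis using mo wm(4) by auto
  qed
  have "tl l = map (label i) [1..<8]"
    unfolding ml[symmetric] map_tl[symmetric] by (simp add: upt_rec)
  moreover have "prod_list os = (\<Prod>k<7. orientation i k)"
    unfolding mo[symmetric] by (subst prod.distinct_set_conv_list[symmetric]) (auto simp: atLeast0LessThan)
  ultimately show "(\<Prod>k<7. orientation i k) = word_sign (map (label i) [1..<8])"
    using wm(5) by simp
qed

lemma label_inj: "inj_on (label i) {..7}"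
  using label_distinct by (simp add: distinct_map inj_on_def atMost_def less_Suc_eq_le[symmetric])

lemma label_bij: "bij_betw (label i) {1..7} {1..7}"
proof -
  have "bij_betw (label i) {0..<8} {0..<8}"
    using label_set label_distinct by (simp add: bij_betw_def distinct_map)
  then have "bij_betw (label i) ({0..<8} - {0}) ({0..<8} - {label i 0})"
    by (rule bij_betw_DiffI) (auto simp: bij_betw_def label_0)
  moreover have "{0..<8} - {0} = {1..7::nat}" by auto
  ultimately show ?thesis by (simp add: label_0)
qed

lemma line_bij: "bij_betw (line i) {..<7} {..<7}"
  using line_set line_distinct by (simp add: bij_betw_def distinct_map atLeast0LessThan)

end

text \<open>
  Clifford terms, structure constants and determinants all depend on a triple of indices in this way, so
  one lemma relabels all three.
\<close>

definition alternating :: "(triple \<Rightarrow> 'a::real_vector) \<Rightarrow> bool" where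
  "alternating X \<longleftrightarrow> (\<forall>a\<in>{1..7}. \<forall>b\<in>{1..7}. \<forall>c\<in>{1..7}. a \<noteq> b \<and> a \<noteq> c \<and> b \<noteq> c \<longrightarrow>
     X (b, a, c) = - X (a, b, c) \<and> X (a, c, b) = - X (a, b, c))"

lemma alternating_orient:
  assumes "alternating X" "a < b" "b < c" "1 \<le> a" "c \<le> 7" "orient (a, b, c) u \<noteq> 0"
  shows "X (a, b, c) = of_int (orient (a, b, c) u) *\<^sub>R X u"
proof -
  have *: "\<lbrakk>x \<in> {1..7}; y \<in> {1..7}; z \<in> {1..7}; x \<noteq> y; x \<noteq> z; y \<noteq> z\<rbrakk> \<Longrightarrow>
      X (y, x, z) = - X (x, y, z) \<and> X (x, z, y) = - X (x, y, z)" for x y z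
    using assms(1) unfolding alternating_def by blast
  have in7: "a \<in> {1..7}" "b \<in> {1..7}" "c \<in> {1..7}" using assms by auto
  have ne: "a \<noteq> b" "b \<noteq> a" "a \<noteq> c" "c \<noteq> a" "b \<noteq> c" "c \<noteq> b" using assms(2,3) by auto
  have swaps: "X (b, a, c) = - X (a, b, c)" "X (a, c, b) = - X (a, b, c)" "X (b, c, a) = - X (b, a, c)"
    "X (c, a, b) = - X (a, c, b)" "X (c, b, a) = - X (b, c, a)"
    using *[of a b c] *[of b a c] *[of a c b] *[of b c a] in7 ne by blast+
  moreover have "u \<in> {(a, b, c), (b, c, a), (c, a, b), (b, a, c), (a, c, b), (c, b, a)}"
    using assms(6) by (auto split: if_splits)
  ultimately show ?thesis using assms(2,3)
    by (elim insertE emptyE) (simp_all add: swaps)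
qed

context primary_row
begin

text \<open>
  Moving to the images of the standard lines reorders the terms and turns every orientation into a sign.
\<close>

lemma sum_relabel:
  fixes X :: "triple \<Rightarrow> 'a::real_vector"
  assumes "alternating X"
  shows "(\<Sum>m<7. of_int (ss ! m) *\<^sub>R X (primary_terms i ! m)) =
    (\<Sum>k<7. of_int (relative_signs i ss ! k) *\<^sub>R X (relabel (label i) (std ! k)))"
proof -
  have "(\<Sum>m<7. of_int (ss ! m) *\<^sub>R X (primary_terms i ! m)) =
      (\<Sum>k<7. of_int (ss ! line i k) *\<^sub>R X (primary_terms i ! line i k))"
    by (rule sum.reindex_bij_betw[OF line_bij, symmetric])
  also have "\<dots> = (\<Sum>k<7. of_int (relative_signs i ss ! k) *\<^sub>R X (relabel (label i) (std ! k)))"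
  proof (rule sum.cong[OF refl])
    fix k :: nat assume "k \<in> {..<7}"
    then have k: "k < 7" by simp
    have "line i k < 7" using line_bij k by (auto simp: bij_betw_def)
    then have "primary_terms i ! line i k \<in> set (primary_terms i)" using terms(1) by auto
    then obtain a b c where t: "primary_terms i ! line i k = (a, b, c)" "1 \<le> a" "a < b" "b < c" "c \<le> 7"
      using terms(2) by blast
    have "orient (a, b, c) (relabel (label i) (std ! k)) \<noteq> 0"
      using orientation[OF k] unfolding orientation_def t(1)
      by (metis insert_iff singletonD zero_neq_neg_one zero_neq_one)
    then have "X (a, b, c) = of_int (orient (a, b, c) (relabel (label i) (std ! k))) *\<^sub>R X (relabel (label i) (std ! k))"
      using t by (intro alternating_orient[OF assms])
    then have "X (primary_terms i ! line i k) = of_int (orientation i k) *\<^sub>R X (relabel (label i) (std ! k))"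
      by (simp only: orientation_def t(1))
    then show "of_int (ss ! line i k) *\<^sub>R X (primary_terms i ! line i k) =
        of_int (relative_signs i ss ! k) *\<^sub>R X (relabel (label i) (std ! k))"
      using k by (simp add: relative_signs_def)
  qed
  finally show ?thesis .
qed

lemma relative_signs_signs:
  assumes "ss \<in> sign_patterns"
  shows "relative_signs i ss \<in> sign_patterns"
proof -
  have "ss ! line i k * orientation i k \<in> {1, -1}" if "k < 7" for k
  proof -
    have "line i k < length ss" using line_bij that assms by (auto simp: bij_betw_def sign_patterns_def)
    then have "ss ! line i k \<in> {1, -1}" using assms nth_mem unfolding sign_patterns_def by blast
    then show ?thesis using orientation[OF that] by auto
  qed
  then have "set (relative_signs i ss) \<subseteq> {1, -1}"
    unfolding relative_signs_def set_map by (intro image_subsetI) (simp only: set_upt atLeastLessThan_iff)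
  then show ?thesis by (simp add: relative_signs_def sign_patterns_def)
qed

lemma prod_signs:
  assumes "ss \<in> sign_patterns"
  shows "(-1) ^ num_minus ss = (\<Prod>m<7. ss ! m)"
proof -
  have "(-1) ^ count_list xs (-1) = prod_list xs" if "set xs \<subseteq> {1, -1::int}" for xs
    using that by (induction xs) auto
  then have "(-1) ^ num_minus ss = prod_list ss"
    using assms by (simp add: num_minus_def sign_patterns_def)
  also have "\<dots> = (\<Prod>m<7. ss ! m)"
    using assms by (simp add: prod.list_conv_set_nth sign_patterns_def atLeast0LessThan)
  finally show ?thesis .
qed

text \<open>
  Relabelling multiplies \<open>(-1)\<^sup>\<sigma>\<close> by the sign of the labelling, just as it does
  the pseudoscalar.
\<close>

lemma prod_relative_signs:
  assumes "ss \<in> sign_patterns"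
  shows "(-1) ^ num_minus ss = word_sign (map (label i) [1..<8]) * (\<Prod>k<7. relative_signs i ss ! k)"
proof -
  have "(\<Prod>k<7. relative_signs i ss ! k) = (\<Prod>k<7. ss ! line i k) * word_sign (map (label i) [1..<8])"
    by (simp add: relative_signs_def prod.distrib prod_orientation)
  also have "(\<Prod>k<7. ss ! line i k) = (-1) ^ num_minus ss"
    unfolding prod_signs[OF assms] by (rule prod.reindex_bij_betw[OF line_bij])
  finally have *: "(\<Prod>k<7. relative_signs i ss ! k) = (-1) ^ num_minus ss * word_sign (map (label i) [1..<8])" .
  have "word_sign xs \<in> {1, -1}" for xs
  proof (induction xs)
    case (Cons x xs)
    have "(\<Prod>y\<leftarrow>ys. if y < x then -1 else (1::int)) \<in> {1, -1}" for ys
      by (induction ys) auto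
    from this[of xs] Cons show ?case by auto
  qed auto
  then have "word_sign (map (label i) [1..<8]) * word_sign (map (label i) [1..<8]) = 1"
    by (metis insert_iff mult_1 mult_minus_left mult_minus_right minus_minus singletonD)
  then show ?thesis unfolding * by (simp add: mult.left_commute)
qed

end

section \<open>The character of point signs\<close>

fun on_line :: "nat \<Rightarrow> triple \<Rightarrow> bool" where
  "on_line p (a, b, c) \<longleftrightarrow> p = a \<or> p = b \<or> p = c"

definition point_sign :: "int list \<Rightarrow> nat \<Rightarrow> int" where
  "point_sign ts p = (\<Prod>k<7. if on_line p (std ! k) then 1 else ts ! k)"

lemma sum_upto_7: "(\<Sum>k<7::nat. g k) = g 0 + g 1 + g 2 + g 3 + g 4 + g 5 + (g 6 :: 'a::comm_monoid_add)"
  by (simp add: eval_nat_numeral)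

lemma prod_upto_7: "(\<Prod>k<7::nat. g k) = g 0 * g 1 * g 2 * g 3 * g 4 * g 5 * (g 6 :: 'a::comm_monoid_mult)"
  by (simp add: eval_nat_numeral)

lemma less_7_cases: "k < (7::nat) \<longleftrightarrow> k \<in> {0, 1, 2, 3, 4, 5, 6}"
  by auto

lemma points_cases: "{1..7::nat} = {1, 2, 3, 4, 5, 6, 7}"
  by auto

lemma point_sign_products:
  "point_sign ts 1 = ts ! 3 * ts ! 4 * ts ! 5 * ts ! 6"
  "point_sign ts 2 = ts ! 1 * ts ! 2 * ts ! 5 * ts ! 6"
  "point_sign ts 3 = ts ! 0 * ts ! 2 * ts ! 4 * ts ! 6"
  "point_sign ts 4 = ts ! 1 * ts ! 2 * ts ! 3 * ts ! 4"
  "point_sign ts 5 = ts ! 0 * ts ! 1 * ts ! 4 * ts ! 5"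
  "point_sign ts 6 = ts ! 0 * ts ! 1 * ts ! 3 * ts ! 6"
  "point_sign ts 7 = ts ! 0 * ts ! 2 * ts ! 3 * ts ! 5"
  by (simp_all add: point_sign_def prod_upto_7 std_terms del: One_nat_def)

lemma pattern_signs:
  assumes "ts \<in> sign_patterns" "k < 7"
  shows "ts ! k * ts ! k = 1" "ts ! k = 1 \<or> ts ! k = -1"
proof -
  have "ts ! k \<in> set ts" using assms by (simp add: sign_patterns_def)
  then show "ts ! k = 1 \<or> ts ! k = -1" using assms unfolding sign_patterns_def by blast
  then show "ts ! k * ts ! k = 1" by auto
qed

lemma prod_of_signs:
  fixes g :: "'a \<Rightarrow> int"
  assumes "\<And>k. k \<in> A \<Longrightarrow> g k = 1 \<or> g k = -1"
  shows "prod g A = 1 \<or> prod g A = -1"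
  using assms by (induction A rule: infinite_finite_induct) fastforce+

text \<open>
  These four products follow the lines 124, 137, 235 and 346. The three points of each product lie on one
  line, and the sign of any other line occurs twice, because that line misses exactly two of them.
\<close>

lemma point_sign_character:
  assumes "ts \<in> sign_patterns"
  shows "point_sign ts 1 * point_sign ts 2 = point_sign ts 4" "point_sign ts 1 * point_sign ts 3 = point_sign ts 7"
    "point_sign ts 2 * point_sign ts 3 = point_sign ts 5" "point_sign ts 3 * point_sign ts 4 = point_sign ts 6"
    "point_sign ts p = 1 \<or> point_sign ts p = -1"
proof -
  have sq: "ts ! k * ts ! k = 1" "ts ! k * (ts ! k * x) = x" if "k < 7" for k x
    using pattern_signs[OF assms that] by (auto simp flip: mult.assoc)
  note sq' = sq[of 0] sq[of 1] sq[of 2] sq[of 3] sq[of 4] sq[of 5] sq[of 6]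
  show "point_sign ts 1 * point_sign ts 2 = point_sign ts 4" "point_sign ts 1 * point_sign ts 3 = point_sign ts 7"
    "point_sign ts 2 * point_sign ts 3 = point_sign ts 5" "point_sign ts 3 * point_sign ts 4 = point_sign ts 6"
    unfolding point_sign_products by (simp_all add: sq' mult_ac del: One_nat_def)
  show "point_sign ts p = 1 \<or> point_sign ts p = -1"
    unfolding point_sign_def using pattern_signs(2)[OF assms] by (intro prod_of_signs) auto
qed

definition trivial_character :: "int list \<Rightarrow> bool" where
  "trivial_character ts \<longleftrightarrow> (\<forall>p\<in>{1..7}. point_sign ts p = 1)"

definition kernel_line :: "int list \<Rightarrow> nat \<Rightarrow> bool" where
  "kernel_line ts k \<longleftrightarrow> k < 7 \<and> (\<forall>p\<in>{1..7}. point_sign ts p = (if on_line p (std ! k) then 1 else -1))"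

lemma trivial_character_iff:
  assumes "ts \<in> sign_patterns"
  shows "trivial_character ts \<longleftrightarrow> point_sign ts 1 = 1 \<and> point_sign ts 2 = 1 \<and> point_sign ts 3 = 1"
  using point_sign_character(1-4)[OF assms, symmetric] unfolding trivial_character_def points_cases by auto

text \<open>
  The point signs of 1, 2 and 3 determine the character, and the seven non-trivial choices have the seven
  lines as kernels.
\<close>

lemma character_cases:
  assumes "ts \<in> sign_patterns"
  shows "trivial_character ts \<or> (\<exists>k. kernel_line ts k)"
proof -
  note c = point_sign_character[OF assms]
  have "\<exists>k\<in>{0, 1, 2, 3, 4, 5, 6}. kernel_line ts k" if "\<not> trivial_character ts"
    using that c(5)[of 1] c(5)[of 2] c(5)[of 3] unfolding trivial_character_iff[OF assms]
    by (elim disjE) (simp_all add: kernel_line_def points_cases std_terms c(1-4)[symmetric] del: One_nat_def)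
  then show ?thesis by blast
qed

lemma kernel_line_nontrivial: "kernel_line ts k \<Longrightarrow> \<not> trivial_character ts"
  unfolding kernel_line_def trivial_character_def points_cases less_7_cases
  by (elim conjE insertE emptyE) (simp_all add: std_terms del: One_nat_def)

text \<open>
  The line \<open>k\<close> enters the remainder with the coefficient \<open>(3 - line_sum ts
  k)/4\<close>, up to sign.
\<close>

definition line_sum :: "int list \<Rightarrow> nat \<Rightarrow> int" where
  "line_sum ts k = (case std ! k of (a, b, c) \<Rightarrow> point_sign ts a + point_sign ts b + point_sign ts c)"

lemma line_sum_trivial: "trivial_character ts \<Longrightarrow> k < 7 \<Longrightarrow> line_sum ts k = 3"
  unfolding trivial_character_def points_cases less_7_cases
  by (elim insertE emptyE) (simp_all add: std_terms line_sum_def del: One_nat_def)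

lemma line_sum_kernel: "kernel_line ts n \<Longrightarrow> k < 7 \<Longrightarrow> line_sum ts k = (if k = n then 3 else -1)"
  unfolding kernel_line_def points_cases less_7_cases
  by (elim conjE insertE emptyE) (simp_all add: std_terms line_sum_def del: One_nat_def)

text \<open>
  Multiplied by the product of all signs and by the sign of the line \<open>k\<close>, the sign of a
  point of \<open>k\<close> leaves the product of the signs of the other two lines through that point:
  this is the coefficient that squaring the form produces.
\<close>

lemma line_sum_expand:
  assumes "ts \<in> sign_patterns"
  defines "P \<equiv> (\<Prod>k<7. ts ! k)"
  shows
   "P * (3 - line_sum ts 0) * ts ! 0 = 3 * P * ts ! 0 - (ts ! 1 * ts ! 2 + ts ! 3 * ts ! 4 + ts ! 5 * ts ! 6)"
   "P * (3 - line_sum ts 1) * ts ! 1 = 3 * P * ts ! 1 - (ts ! 0 * ts ! 2 + ts ! 3 * ts ! 5 + ts ! 4 * ts ! 6)"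
   "P * (3 - line_sum ts 2) * ts ! 2 = 3 * P * ts ! 2 - (ts ! 0 * ts ! 1 + ts ! 3 * ts ! 6 + ts ! 4 * ts ! 5)"
   "P * (3 - line_sum ts 3) * ts ! 3 = 3 * P * ts ! 3 - (ts ! 0 * ts ! 4 + ts ! 1 * ts ! 5 + ts ! 2 * ts ! 6)"
   "P * (3 - line_sum ts 4) * ts ! 4 = 3 * P * ts ! 4 - (ts ! 0 * ts ! 3 + ts ! 2 * ts ! 5 + ts ! 1 * ts ! 6)"
   "P * (3 - line_sum ts 5) * ts ! 5 = 3 * P * ts ! 5 - (ts ! 1 * ts ! 3 + ts ! 0 * ts ! 6 + ts ! 2 * ts ! 4)"
   "P * (3 - line_sum ts 6) * ts ! 6 = 3 * P * ts ! 6 - (ts ! 0 * ts ! 5 + ts ! 2 * ts ! 3 + ts ! 1 * ts ! 4)"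
proof -
  have sq: "ts ! k * ts ! k = 1" "ts ! k * (ts ! k * x) = x" if "k < 7" for k x
    using pattern_signs[OF assms(1) that] by (auto simp flip: mult.assoc)
  note sq' = sq[of 0] sq[of 1] sq[of 2] sq[of 3] sq[of 4] sq[of 5] sq[of 6]
  show
   "P * (3 - line_sum ts 0) * ts ! 0 = 3 * P * ts ! 0 - (ts ! 1 * ts ! 2 + ts ! 3 * ts ! 4 + ts ! 5 * ts ! 6)"
   "P * (3 - line_sum ts 1) * ts ! 1 = 3 * P * ts ! 1 - (ts ! 0 * ts ! 2 + ts ! 3 * ts ! 5 + ts ! 4 * ts ! 6)"
   "P * (3 - line_sum ts 2) * ts ! 2 = 3 * P * ts ! 2 - (ts ! 0 * ts ! 1 + ts ! 3 * ts ! 6 + ts ! 4 * ts ! 5)"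
   "P * (3 - line_sum ts 3) * ts ! 3 = 3 * P * ts ! 3 - (ts ! 0 * ts ! 4 + ts ! 1 * ts ! 5 + ts ! 2 * ts ! 6)"
   "P * (3 - line_sum ts 4) * ts ! 4 = 3 * P * ts ! 4 - (ts ! 0 * ts ! 3 + ts ! 2 * ts ! 5 + ts ! 1 * ts ! 6)"
   "P * (3 - line_sum ts 5) * ts ! 5 = 3 * P * ts ! 5 - (ts ! 1 * ts ! 3 + ts ! 0 * ts ! 6 + ts ! 2 * ts ! 4)"
   "P * (3 - line_sum ts 6) * ts ! 6 = 3 * P * ts ! 6 - (ts ! 0 * ts ! 5 + ts ! 2 * ts ! 3 + ts ! 1 * ts ! 4)"
    by (simp_all add: P_def prod_upto_7 line_sum_def std_terms point_sign_products sq' algebra_simps del: One_nat_def)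
qed

text \<open>
  Only the relations are assumed, so that the results apply to the generators in any order.
\<close>

locale clifford_generators =
  fixes f :: "nat \<Rightarrow> 'a::real_algebra_1"
  assumes square: "a \<in> {1..7} \<Longrightarrow> f a * f a = 1"
    and anticommute: "a \<in> {1..7} \<Longrightarrow> b \<in> {1..7} \<Longrightarrow> a \<noteq> b \<Longrightarrow> f a * f b = - (f b * f a)"
begin

definition word :: "triple \<Rightarrow> 'a" where
  "word t = (case t of (a, b, c) \<Rightarrow> f a * f b * f c)"

definition volume :: 'a where
  "volume = f 1 * f 2 * f 3 * f 4 * f 5 * f 6 * f 7"

lemma square_left: "a \<in> {1..7} \<Longrightarrow> f a * (f a * x) = x"
  by (simp add: square flip: mult.assoc)

lemma anticommute_left: "a \<in> {1..7} \<Longrightarrow> b \<in> {1..7} \<Longrightarrow> a \<noteq> b \<Longrightarrow> f a * (f b * x) = - (f b * (f a * x))"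
  by (metis anticommute minus_mult_left mult.assoc)

text \<open>
  Rewriting with these rules sorts a word in the generators.
\<close>

lemmas sort_words =
  anticommute[of 2 1] anticommute[of 3 1] anticommute[of 3 2] anticommute[of 4 1] anticommute[of 4 2]
  anticommute[of 4 3] anticommute[of 5 1] anticommute[of 5 2] anticommute[of 5 3] anticommute[of 5 4]
  anticommute[of 6 1] anticommute[of 6 2] anticommute[of 6 3] anticommute[of 6 4] anticommute[of 6 5]
  anticommute[of 7 1] anticommute[of 7 2] anticommute[of 7 3] anticommute[of 7 4] anticommute[of 7 5]
  anticommute[of 7 6]
  anticommute_left[of 2 1] anticommute_left[of 3 1] anticommute_left[of 3 2] anticommute_left[of 4 1] anticommute_left[of 4 2]
  anticommute_left[of 4 3] anticommute_left[of 5 1] anticommute_left[of 5 2] anticommute_left[of 5 3] anticommute_left[of 5 4]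
  anticommute_left[of 6 1] anticommute_left[of 6 2] anticommute_left[of 6 3] anticommute_left[of 6 4] anticommute_left[of 6 5]
  anticommute_left[of 7 1] anticommute_left[of 7 2] anticommute_left[of 7 3] anticommute_left[of 7 4] anticommute_left[of 7 5]
  anticommute_left[of 7 6]

lemma volume_square: "volume * volume = -1"
  unfolding volume_def
  by (simp add: mult.assoc sort_words square square_left del: One_nat_def)

lemma volume_word: "k < 7 \<Longrightarrow> word (std ! k) * volume = volume * word (std ! k)"
  unfolding less_7_cases
  by (elim insertE emptyE)
    (simp_all add: std_terms word_def volume_def mult.assoc sort_words square square_left del: One_nat_def)

lemma word_square: "k < 7 \<Longrightarrow> word (std ! k) * word (std ! k) = -1"
  unfolding less_7_cases
  by (elim insertE emptyE)
    (simp_all add: std_terms word_def mult.assoc sort_words square square_left del: One_nat_def)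

text \<open>
  The third line through the common point of two lines; the diagonal is filled with \<open>k\<close>
  itself.
\<close>

fun third_line :: "nat \<Rightarrow> nat \<Rightarrow> nat" where
  "third_line k m = [[0, 2, 1, 4, 3, 6, 5], [2, 1, 0, 5, 6, 3, 4], [1, 0, 2, 6, 5, 4, 3],
     [4, 5, 6, 3, 0, 1, 2], [3, 6, 5, 0, 4, 2, 1], [6, 3, 4, 1, 2, 5, 0], [5, 4, 3, 2, 1, 0, 6]] ! k ! m"

text \<open>
  Two lines share one point, and together with the third line through that point they use each of the
  other six points once; so the product of the three words is a multiple of the volume. With the
  orientations of row 11 the factor is -1 at every point; that it does not depend on the point makes the
  all-positive form octonionic.
\<close>

lemma word_mult: "k < 7 \<Longrightarrow> m < 7 \<Longrightarrow> k \<noteq> m \<Longrightarrow>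
    word (std ! k) * word (std ! m) = volume * word (std ! third_line k m)"
  unfolding less_7_cases
  by (elim insertE emptyE)
    (simp_all add: std_terms word_def volume_def mult.assoc sort_words square square_left del: One_nat_def)

end

section \<open>The Clifford identity\<close>

text \<open>
  Points are numerals, and facts about the point 1 only apply as long as it is not rewritten to \<open>Suc 0\<close>.
\<close>

declare One_nat_def [simp del]

context clifford_generators
begin

text \<open>
  The terms commute, so each unordered pair of lines counts twice, and the pairs are grouped by the third
  line through their common point.
\<close>

lemma form_square:
  fixes t :: "nat \<Rightarrow> real"
  assumes t: "\<And>k. t k * t k = 1"
  shows "(\<Sum>k<7. t k *\<^sub>R word (std ! k)) * (\<Sum>k<7. t k *\<^sub>R word (std ! k)) =
    - 7 + 2 * volume *
     ((t 1 * t 2 + t 3 * t 4 + t 5 * t 6) *\<^sub>R word (std ! 0) +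
      (t 0 * t 2 + t 3 * t 5 + t 4 * t 6) *\<^sub>R word (std ! 1) +
      (t 0 * t 1 + t 3 * t 6 + t 4 * t 5) *\<^sub>R word (std ! 2) +
      (t 0 * t 4 + t 1 * t 5 + t 2 * t 6) *\<^sub>R word (std ! 3) +
      (t 0 * t 3 + t 2 * t 5 + t 1 * t 6) *\<^sub>R word (std ! 4) +
      (t 1 * t 3 + t 0 * t 6 + t 2 * t 4) *\<^sub>R word (std ! 5) +
      (t 0 * t 5 + t 2 * t 3 + t 1 * t 4) *\<^sub>R word (std ! 6))" (is "?F * ?F = -7 + 2 * volume * ?R")
proof -
  define w where "w = (\<lambda>k. word (std ! k))"
  define v where "v = (\<lambda>k. volume * w k)"
  have m: "w k * w l = (if k = l then -1 else v (third_line k l))"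
    if "k < 7" "l < 7" for k l
    using word_square[of k] word_mult[of k l] that by (auto simp: w_def v_def)
  have "?F * ?F = (\<Sum>k<7. \<Sum>l<7. (t k * t l) *\<^sub>R (w k * w l))"
    by (simp add: sum_product w_def mult.commute)
  also have "\<dots> = (\<Sum>k<7. \<Sum>l<7. (t k * t l) *\<^sub>R (if k = l then -1 else v (third_line k l)))"
    by (intro sum.cong refl) (simp add: m)
  also have "\<dots> = - 7 + 2 * volume * ?R"
    unfolding sum_upto_7 v_def w_def
    by (simp add: t distrib_left distrib_right scaleR_add_left mult.commute mult_2 algebra_simps del: One_nat_def)
  finally show ?thesis .
qed

lemma volume_form: "volume * (\<Sum>k<7. t k *\<^sub>R word (std ! k)) = (\<Sum>k<7. t k *\<^sub>R word (std ! k)) * volume"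
  by (simp add: sum_distrib_left sum_distrib_right volume_word)

text \<open>
  The cross term of the square gives \<open>3P\<close> times the form and the square of the form gives
  the sums of products of two signs; \<open>line_sum_expand\<close> combines them.
\<close>

lemma remainder_identity:
  assumes ts: "ts \<in> sign_patterns"
  defines "P \<equiv> real_of_int (\<Prod>k<7. ts ! k)"
  defines "r \<equiv> (1 / 4) *\<^sub>R (3 *\<^sub>R volume - P *\<^sub>R (\<Sum>k<7. of_int (ts ! k) *\<^sub>R word (std ! k)))"
  shows "2 * volume * (r\<^sup>2 + 1) =
    (P / 4) *\<^sub>R (\<Sum>k<7. of_int ((3 - line_sum ts k) * ts ! k) *\<^sub>R word (std ! k))"
proof -
  define F where "F = (\<Sum>k<7. of_int (ts ! k) *\<^sub>R word (std ! k))"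
  define t where "t = (\<lambda>k. if k < 7 then real_of_int (ts ! k) else 1)"
  \<comment> \<open>the coefficients of the squared form, in the shape that the claim needs\<close>
  define c where "c = (\<lambda>k. 3 * P * t k - P * (3 - line_sum ts k) * t k)"
  define R where "R = (\<Sum>k<7. c k *\<^sub>R word (std ! k))"
  have tt: "t k * t k = 1" for k
    using pattern_signs(1)[OF ts, of k] by (auto simp: t_def simp flip: of_int_mult)
  have PP: "P * P = 1"
    using prod_of_signs[of "{..<7}" "\<lambda>k. ts ! k"] pattern_signs(2)[OF ts] unfolding P_def by fastforce
  have Ft: "F = (\<Sum>k<7. t k *\<^sub>R word (std ! k))" by (simp add: F_def t_def)
  have c: "c 0 = t 1 * t 2 + t 3 * t 4 + t 5 * t 6" "c 1 = t 0 * t 2 + t 3 * t 5 + t 4 * t 6"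
    "c 2 = t 0 * t 1 + t 3 * t 6 + t 4 * t 5" "c 3 = t 0 * t 4 + t 1 * t 5 + t 2 * t 6"
    "c 4 = t 0 * t 3 + t 2 * t 5 + t 1 * t 6" "c 5 = t 1 * t 3 + t 0 * t 6 + t 2 * t 4"
    "c 6 = t 0 * t 5 + t 2 * t 3 + t 1 * t 4"
    using line_sum_expand[OF ts, THEN arg_cong[where f=real_of_int]]
    unfolding c_def t_def P_def by (simp_all del: of_int_prod One_nat_def)
  have FF: "F * F = - 7 + 2 * volume * R"
    unfolding Ft form_square[of t, OF tt] by (simp only: R_def sum_upto_7 c)
  have vF: "F * volume = volume * F" unfolding F_def by (rule volume_form[symmetric])
  have "(3 *\<^sub>R volume - P *\<^sub>R F) * (3 *\<^sub>R volume - P *\<^sub>R F) =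
      9 *\<^sub>R (volume * volume) - (3 * P) *\<^sub>R (volume * F) - (3 * P) *\<^sub>R (F * volume) + (P * P) *\<^sub>R (F * F)"
    by (simp add: left_diff_distrib right_diff_distrib scaleR_diff_right mult.commute algebra_simps)
  also have "9 *\<^sub>R (volume * volume) = - 9"
    by (simp add: volume_square scaleR_conv_of_real)
  also have "- 9 - (3 * P) *\<^sub>R (volume * F) - (3 * P) *\<^sub>R (F * volume) + (P * P) *\<^sub>R (F * F) =
      - 16 - (6 * P) *\<^sub>R (volume * F) + 2 * volume * R"
    unfolding vF FF PP using scaleR_add_left[of "3 * P" "3 * P" "volume * F"] by simp
  finally have "(3 *\<^sub>R volume - P *\<^sub>R F) * (3 *\<^sub>R volume - P *\<^sub>R F) =
      - 16 - (6 * P) *\<^sub>R (volume * F) + 2 * volume * R" .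
  then have r: "r\<^sup>2 = (1 / 16) *\<^sub>R (- 16 - (6 * P) *\<^sub>R (volume * F) + 2 * volume * R)"
    unfolding r_def F_def[symmetric] by (simp add: power2_eq_square)
  have vv: "volume * (volume * x) = - x" for x
    by (simp add: volume_square flip: mult.assoc)
  have "r\<^sup>2 + 1 = (1 / 16) *\<^sub>R (2 * volume * R - (6 * P) *\<^sub>R (volume * F))"
  proof -
    have "(1 / 16) *\<^sub>R (16 :: 'a) = (1 / 16 * 16) *\<^sub>R 1"
      by (simp only: scaleR_scaleR[symmetric]) (simp add: scaleR_conv_of_real)
    then have "1 = (1 / 16) *\<^sub>R (16 :: 'a)" by simp
    then show ?thesis unfolding r by (simp add: scaleR_add_right scaleR_diff_right)
  qed
  moreover have "volume * (2 * volume * R - (6 * P) *\<^sub>R (volume * F)) = (6 * P) *\<^sub>R F - 2 * R"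
    by (simp add: right_diff_distrib vv mult_2 distrib_left distrib_right mult.assoc)
  ultimately have "2 * volume * (r\<^sup>2 + 1) = 2 * (1 / 16) *\<^sub>R ((6 * P) *\<^sub>R F - 2 * R)"
    by (simp add: mult.assoc)
  also have "\<dots> = (1 / 4) *\<^sub>R ((3 * P) *\<^sub>R F - R)"
    by (simp add: mult_2 scaleR_diff_right flip: scaleR_2)
  finally have "2 * volume * (r\<^sup>2 + 1) = (1 / 4) *\<^sub>R ((3 * P) *\<^sub>R F - R)" .
  also have "(3 * P) *\<^sub>R F - R = (\<Sum>k<7. (3 * P * t k - c k) *\<^sub>R word (std ! k))"
    unfolding Ft R_def by (simp add: scaleR_sum_right sum_subtractf scaleR_diff_left)
  also have "\<dots> = P *\<^sub>R (\<Sum>k<7. of_int ((3 - line_sum ts k) * ts ! k) *\<^sub>R word (std ! k))"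
    unfolding scaleR_sum_right by (rule sum.cong) (auto simp: c_def t_def algebra_simps)
  finally show ?thesis by simp
qed

end

text \<open>
  Moving the first letter past the smaller ones produces the sign.
\<close>

lemma blade_of_word:
  assumes "distinct xs" "set xs \<subseteq> {1..7}"
  shows "prod_list (map cl_e xs) = of_int (word_sign xs) *\<^sub>R blade (set xs)"
  using assms
proof (induction xs)
  case (Cons a xs)
  have "(\<Prod>y\<in>set ys. if y < a then -1 else (1::real)) = of_int (\<Prod>y\<leftarrow>ys. if y < a then -1 else 1)"
    if "distinct ys" for ys
    using that by (induction ys) auto
  then have "blade_sign {a} (set xs) = of_int (\<Prod>y\<leftarrow>xs. if y < a then -1 else 1)"
    using Cons.prems(1) by (simp add: blade_sign_def)
  moreover have "symdiff {a} (set xs) = set (a # xs)" using Cons.prems by (auto simp: symdiff_def)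
  ultimately show ?case
    using Cons by (simp add: cl_e_def blade_times_blade mult.commute)
qed (simp add: blade_empty)

lemma e3_blade: "1 \<le> a \<Longrightarrow> a < b \<Longrightarrow> b < c \<Longrightarrow> c \<le> 7 \<Longrightarrow> e3 (a, b, c) = blade {a, b, c}"
  using blade_of_word[of "[a, b, c]"] by (simp add: mult.assoc)

lemma e3_alternating: "alternating e3"
  unfolding alternating_def
proof (intro ballI impI conjI)
  fix a b c :: nat assume "a \<in> {1..7}" "b \<in> {1..7}" "c \<in> {1..7}" "a \<noteq> b \<and> a \<noteq> c \<and> b \<noteq> c"
  then have "cl_e b * cl_e a = - (cl_e a * cl_e b)" "cl_e c * cl_e b = - (cl_e b * cl_e c)"
    using cl_e_anticommute[of b a] cl_e_anticommute[of c b] by auto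
  then show "e3 (b, a, c) = - e3 (a, b, c)" "e3 (a, c, b) = - e3 (a, b, c)"
    by (simp_all add: mult.assoc)
qed

lemma ex_other_line: "\<exists>k<7. k \<noteq> (n::nat)"
  by (rule exI[of _ "if n = 0 then 1 else 0"]) simp

lemma neg_one_power_mult: "(-1) ^ n * (x :: cl7) = of_int ((-1) ^ n) *\<^sub>R x"
  by (induction n) auto

lemma cl_coeff_e3:
  assumes "1 \<le> a" "a < b" "b < c" "c \<le> 7"
  shows "cl_coeff (e3 (a, b, c)) U = (if U = {a, b, c} then 1 else 0)"
  using assms by (auto simp: e3_blade blade.rep_eq simp del: e3.simps)

lemma sorted_triple_eq:
  assumes "{a, b, c} = {a', b', c'}" "a < b" "b < c" "a' < b'" "b' < (c' :: nat)"
  shows "a = a' \<and> b = b' \<and> c = c'"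
proof -
  have "Min {a, b, c} = a" "Min {a', b', c'} = a'" "Max {a, b, c} = c" "Max {a', b', c'} = c'"
    using assms(2-5) by (auto intro!: Min_eqI Max_eqI)
  then have "a = a'" "c = c'" using assms(1) by auto
  moreover have "b \<in> {a', b', c'}" using assms(1) by auto
  ultimately show ?thesis using assms(2-5) by auto
qed

context primary_row
begin

lemma in_points: "x \<in> {1..7} \<Longrightarrow> label i x \<in> {1..7}"
  using label_bij by (auto simp: bij_betw_def)

sublocale gen: clifford_generators "\<lambda>x. cl_e (label i x)"
proof
  fix x y :: nat assume x: "x \<in> {1..7}"
  then show "cl_e (label i x) * cl_e (label i x) = 1"
    by (intro cl_e_square in_points)
  assume y: "y \<in> {1..7}" "x \<noteq> y"
  have "label i x \<noteq> label i y" using label_inj x y by (auto simp: inj_on_def)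
  then show "cl_e (label i x) * cl_e (label i y) = - (cl_e (label i y) * cl_e (label i x))"
    using x y by (intro cl_e_anticommute in_points)
qed

abbreviation label_sign :: int where
  "label_sign \<equiv> word_sign (map (label i) [1..<8])"

lemma label_sign: "label_sign = 1 \<or> label_sign = -1"
proof -
  have "(\<Prod>k<7. orientation i k) = 1 \<or> (\<Prod>k<7. orientation i k) = -1"
    using orientation by (intro prod_of_signs) auto
  then show ?thesis by (simp only: prod_orientation)
qed

text \<open>
  The labelled generators multiply to the pseudoscalar up to the sign of the labelling, because both
  sides are the blade of all seven indices up to the sign of sorting.
\<close>

lemma pseudoscalar_volume: "pseudoscalar = of_int label_sign *\<^sub>R gen.volume"
proof -
  have 8: "[1..<8] = [1, 2, 3, 4, 5, 6, 7]" by (simp add: upt_rec)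
  have "set (map (label i) [1..<8]) = {1..7}" "distinct (map (label i) [1..<8])"
  proof -
    have "set [1..<8] = {1..7::nat}" by auto
    then show "set (map (label i) [1..<8]) = {1..7}" "distinct (map (label i) [1..<8])"
      using label_bij by (auto simp: bij_betw_def distinct_map)
  qed
  then have "prod_list (map cl_e (map (label i) [1..<8])) = of_int label_sign *\<^sub>R blade {1..7}"
    using blade_of_word[of "map (label i) [1..<8]"] by simp
  moreover have "prod_list (map cl_e (map (label i) [1..<8])) = gen.volume"
    by (simp add: 8 gen.volume_def mult.assoc)
  ultimately have "gen.volume = of_int label_sign *\<^sub>R blade {1..7}" by simp
  moreover have "pseudoscalar = blade {1..7}"
  proof -
    have "prod_list (map cl_e [1..<8]) = of_int (word_sign [1..<8]) *\<^sub>R blade (set [1..<8])"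
      by (intro blade_of_word) auto
    moreover have "set [1..<8] = {1..7::nat}" by auto
    ultimately show ?thesis by (simp add: 8 pseudoscalar_def mult.assoc)
  qed
  ultimately show ?thesis using label_sign by auto
qed

lemma signed_form_relative_signs:
  "signed_form i ss = (\<Sum>k<7. of_int (relative_signs i ss ! k) *\<^sub>R gen.word (std ! k))"
proof -
  have "gen.word t = e3 (relabel (label i) t)" for t
    by (cases t) (simp add: gen.word_def)
  then show ?thesis unfolding signed_form_def by (simp add: sum_relabel[OF e3_alternating])
qed

lemma term_at_line:
  assumes "k < 7"
  obtains a b c where "primary_terms i ! line i k = (a, b, c)" "1 \<le> a" "a < b" "b < c" "c \<le> 7"
proof -
  have "line i k < 7" using line_bij assms by (auto simp: bij_betw_def)
  then have "primary_terms i ! line i k \<in> set (primary_terms i)" using terms(1) by auto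
  then show ?thesis using terms(2) that by blast
qed

text \<open>
  Back from labelled standard lines to the terms of the row: the orientation enters both factors and
  cancels.
\<close>

lemma word_at_line:
  assumes "k < 7" "ss \<in> sign_patterns"
  shows "of_int (relative_signs i ss ! k) *\<^sub>R gen.word (std ! k) =
    of_int (ss ! line i k) *\<^sub>R e3 (primary_terms i ! line i k)"
proof -
  obtain a b c where t: "primary_terms i ! line i k = (a, b, c)" "1 \<le> a" "a < b" "b < c" "c \<le> 7"
    using assms term_at_line by blast
  have o: "orientation i k = orient (a, b, c) (relabel (label i) (std ! k))"
    by (simp add: orientation_def t(1))
  have "orientation i k \<noteq> 0" using orientation[OF assms(1)] by auto
  then have "e3 (a, b, c) = of_int (orientation i k) *\<^sub>R e3 (relabel (label i) (std ! k))"
    unfolding o using t by (intro alternating_orient[OF e3_alternating])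
  moreover have "gen.word (std ! k) = e3 (relabel (label i) (std ! k))"
    by (cases "std ! k") (simp add: gen.word_def)
  ultimately show ?thesis using assms(1) by (simp add: relative_signs_def t(1))
qed

text \<open>
  The sign of the labelling occurs in the pseudoscalar and in \<open>(-1)\<^sup>\<sigma>\<close>, so it
  cancels in the square of \<open>\<rho>\<close> and remains once on either side.
\<close>

lemma remainder_relative_signs:
  assumes "ss \<in> sign_patterns"
  shows "2 * pseudoscalar * ((rho i ss)\<^sup>2 + 1) = (of_int ((-1) ^ num_minus ss) / 4) *\<^sub>R
    (\<Sum>k<7. of_int ((3 - line_sum (relative_signs i ss) k) * ss ! line i k) *\<^sub>R e3 (primary_terms i ! line i k))"
proof -
  define P where "P = real_of_int (\<Prod>k<7. relative_signs i ss ! k)"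
  define F where "F = (\<Sum>k<7. of_int (relative_signs i ss ! k) *\<^sub>R gen.word (std ! k))"
  define w where "w = real_of_int label_sign"
  have w: "w * w = 1" using label_sign by (auto simp: w_def)
  have s: "of_int ((-1) ^ num_minus ss) = w * P"
    unfolding prod_relative_signs[OF assms] by (simp add: w_def P_def)
  have "rho i ss = w *\<^sub>R ((1 / 4) *\<^sub>R (3 *\<^sub>R gen.volume - P *\<^sub>R F))"
    unfolding rho_def neg_one_power_mult s signed_form_relative_signs F_def[symmetric]
    by (simp add: pseudoscalar_volume w_def[symmetric] scaleR_diff_right mult.commute)
  then have "(rho i ss)\<^sup>2 = ((1 / 4) *\<^sub>R (3 *\<^sub>R gen.volume - P *\<^sub>R F))\<^sup>2"
    by (simp add: power2_eq_square w)
  then have "2 * pseudoscalar * ((rho i ss)\<^sup>2 + 1) =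
      w *\<^sub>R (2 * gen.volume * (((1 / 4) *\<^sub>R (3 *\<^sub>R gen.volume - P *\<^sub>R F))\<^sup>2 + 1))"
    by (simp add: pseudoscalar_volume w_def[symmetric])
  also have "\<dots> = w *\<^sub>R ((P / 4) *\<^sub>R
      (\<Sum>k<7. of_int ((3 - line_sum (relative_signs i ss) k) * relative_signs i ss ! k) *\<^sub>R gen.word (std ! k)))"
    using gen.remainder_identity[OF relative_signs_signs[OF assms]] by (simp only: P_def F_def)
  also have "(\<Sum>k<7. of_int ((3 - line_sum (relative_signs i ss) k) * relative_signs i ss ! k) *\<^sub>R gen.word (std ! k)) =
      (\<Sum>k<7. of_int ((3 - line_sum (relative_signs i ss) k) * ss ! line i k) *\<^sub>R e3 (primary_terms i ! line i k))"
  proof (rule sum.cong[OF refl])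
    fix k :: nat assume "k \<in> {..<7}"
    then have k: "k < 7" by simp
    show "of_int ((3 - line_sum (relative_signs i ss) k) * relative_signs i ss ! k) *\<^sub>R gen.word (std ! k) =
        of_int ((3 - line_sum (relative_signs i ss) k) * ss ! line i k) *\<^sub>R e3 (primary_terms i ! line i k)"
      using arg_cong[OF word_at_line[OF k assms], of "scaleR (of_int (3 - line_sum (relative_signs i ss) k))"]
      by (simp only: scaleR_scaleR of_int_mult)
  qed
  finally show ?thesis unfolding s by simp
qed

lemma signed_form_lines:
  assumes "ss \<in> sign_patterns"
  shows "signed_form i ss = (\<Sum>k<7. of_int (ss ! line i k) *\<^sub>R e3 (primary_terms i ! line i k))"
  unfolding signed_form_relative_signs by (rule sum.cong) (simp_all add: word_at_line assms)

lemma line_eq_iff: "k < 7 \<Longrightarrow> l < 7 \<Longrightarrow> primary_terms i ! line i k = primary_terms i ! line i l \<longleftrightarrow> k = l"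
proof -
  assume "k < 7" "l < 7"
  then have "line i k < 7" "line i l < 7" "line i k = line i l \<longleftrightarrow> k = l"
    using line_bij by (auto simp: bij_betw_def inj_on_eq_iff)
  then show ?thesis using terms(1,3) by (simp add: nth_eq_iff_index_eq)
qed

lemma lines_independent:
  assumes "(\<Sum>k<7. x k *\<^sub>R e3 (primary_terms i ! line i k)) = (\<Sum>k<7. y k *\<^sub>R e3 (primary_terms i ! line i k))"
    and n: "n < 7"
  shows "x n = y n"
proof -
  obtain a b c where t: "primary_terms i ! line i n = (a, b, c)" "1 \<le> a" "a < b" "b < c" "c \<le> 7"
    using n term_at_line by blast
  have "cl_coeff (\<Sum>k<7. z k *\<^sub>R e3 (primary_terms i ! line i k)) {a, b, c} = (\<Sum>k<7. if k = n then z n else 0)" for z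
    unfolding cl_coeff_sum
  proof (rule sum.cong[OF refl])
    fix k :: nat assume "k \<in> {..<7}"
    then have k: "k < 7" by simp
    then obtain a' b' c' where t': "primary_terms i ! line i k = (a', b', c')" "1 \<le> a'" "a' < b'" "b' < c'" "c' \<le> 7"
      using term_at_line by blast
    have "{a, b, c} = {a', b', c'} \<longleftrightarrow> k = n"
      using sorted_triple_eq[of a b c a' b' c'] t t' line_eq_iff[OF k n] by auto
    then show "cl_coeff (z k *\<^sub>R e3 (primary_terms i ! line i k)) {a, b, c} = (if k = n then z n else 0)"
      using t' by (simp add: scaleR_cl7.rep_eq cl_coeff_e3 del: e3.simps)
  qed
  then have "cl_coeff (\<Sum>k<7. z k *\<^sub>R e3 (primary_terms i ! line i k)) {a, b, c} = z n" for z
    using n by simp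
  then show ?thesis using assms(1) by metis
qed

text \<open>
  The pseudoscalar is invertible and the terms are linearly independent, so the remainder vanishes iff
  all line sums are 3, which no character with a kernel line satisfies.
\<close>

lemma rho_square_iff:
  assumes ss: "ss \<in> sign_patterns"
  shows "(rho i ss)\<^sup>2 = -1 \<longleftrightarrow> trivial_character (relative_signs i ss)"
proof
  note ts = relative_signs_signs[OF ss]
  assume "trivial_character (relative_signs i ss)"
  then have "2 * pseudoscalar * ((rho i ss)\<^sup>2 + 1) = 0"
    unfolding remainder_relative_signs[OF ss] by (simp add: line_sum_trivial)
  then have "pseudoscalar * (pseudoscalar * ((rho i ss)\<^sup>2 + 1)) = 0"
    by (simp add: mult_2 distrib_right mult.assoc flip: scaleR_2)
  moreover have "pseudoscalar * pseudoscalar = -1"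
    using gen.volume_square label_sign by (auto simp: pseudoscalar_volume)
  then have "pseudoscalar * (pseudoscalar * x) = - x" for x
    by (simp flip: mult.assoc)
  ultimately have "(rho i ss)\<^sup>2 + 1 = 0" by (metis neg_equal_0_iff_equal)
  then show "(rho i ss)\<^sup>2 = -1" by (simp only: eq_neg_iff_add_eq_0)
next
  note ts = relative_signs_signs[OF ss]
  assume "(rho i ss)\<^sup>2 = -1"
  then have *: "(\<Sum>k<7. of_int ((3 - line_sum (relative_signs i ss) k) * ss ! line i k) *\<^sub>R e3 (primary_terms i ! line i k)) =
      (\<Sum>k<7. 0 *\<^sub>R e3 (primary_terms i ! line i k))"
    using remainder_relative_signs[OF ss] by simp
  have sum3: "line_sum (relative_signs i ss) k = 3" if "k < 7" for k
  proof -
    have "line i k < 7" using line_bij that by (auto simp: bij_betw_def)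
    then have "ss ! line i k \<noteq> 0" using pattern_signs(2)[OF ss] by fastforce
    then show ?thesis using lines_independent[OF * that] by simp
  qed
  show "trivial_character (relative_signs i ss)"
  proof (rule ccontr)
    assume "\<not> trivial_character (relative_signs i ss)"
    then obtain n where n: "kernel_line (relative_signs i ss) n" using character_cases[OF ts] by blast
    obtain k where "k < 7" "k \<noteq> n" using ex_other_line by blast
    then show False using line_sum_kernel[OF n, of k] sum3[of k] by simp
  qed
qed

lemma has_remainder_if_kernel:
  assumes ss: "ss \<in> sign_patterns" and ker: "kernel_line (relative_signs i ss) n"
  shows "has_remainder i ss (- ((-1) ^ num_minus ss) * ss ! line i n) (primary_terms i ! line i n)"
proof -
  have n: "n < 7" using ker by (simp add: kernel_line_def)
  have ln: "line i n < 7" using line_bij n by (auto simp: bij_betw_def)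
  define P :: int where "P = (-1) ^ num_minus ss"
  define E where "E = (\<lambda>k. real_of_int (ss ! line i k) *\<^sub>R e3 (primary_terms i ! line i k))"
  have "(of_int P / 4) *\<^sub>R (\<Sum>k<7. of_int ((3 - line_sum (relative_signs i ss) k) * ss ! line i k) *\<^sub>R e3 (primary_terms i ! line i k)) =
      of_int P *\<^sub>R (\<Sum>k<7. E k - (if k = n then E n else 0))"
    unfolding scaleR_sum_right by (rule sum.cong) (auto simp: line_sum_kernel[OF ker] E_def)
  also have "\<dots> = of_int (- P * ss ! line i n) *\<^sub>R e3 (primary_terms i ! line i n) + of_int P *\<^sub>R signed_form i ss"
    using n by (simp add: sum_subtractf scaleR_diff_right signed_form_lines[OF ss] E_def)
  finally have "2 * pseudoscalar * ((rho i ss)\<^sup>2 + 1) =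
      of_int (- P * ss ! line i n) *\<^sub>R e3 (primary_terms i ! line i n) + (-1) ^ num_minus ss * signed_form i ss"
    unfolding remainder_relative_signs[OF ss] neg_one_power_mult P_def .
  moreover have "- P * ss ! line i n \<in> {1, -1}"
    using pattern_signs(2)[OF ss ln] by (auto simp: P_def minus_one_power_iff)
  ultimately show ?thesis
    unfolding has_remainder_def P_def using ln terms(1) by simp
qed

text \<open>
  Comparing coefficients forces the line sum -1 on every line other than the remainder term, which
  singles it out as the kernel line.
\<close>

lemma kernel_if_has_remainder:
  assumes ss: "ss \<in> sign_patterns" and rem: "has_remainder i ss s t"
  obtains n where "kernel_line (relative_signs i ss) n" "t = primary_terms i ! line i n"
proof -
  note ts = relative_signs_signs[OF ss]
  obtain m where m: "m < 7" "t = primary_terms i ! m"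
    using rem terms(1) by (auto simp: has_remainder_def in_set_conv_nth)
  then obtain n where n: "n < 7" "m = line i n"
    using line_bij by (auto simp: bij_betw_def image_iff)
  define P where "P = real_of_int ((-1) ^ num_minus ss)"
  have P: "P * P = 1" by (simp add: P_def minus_one_power_iff)
  have "(\<Sum>k<7. (P / 4 * of_int ((3 - line_sum (relative_signs i ss) k) * ss ! line i k)) *\<^sub>R e3 (primary_terms i ! line i k)) =
     (\<Sum>k<7. ((if k = n then of_int s else 0) + P * of_int (ss ! line i k)) *\<^sub>R e3 (primary_terms i ! line i k))"
  proof -
    have "(\<Sum>k<7. (if k = n then real_of_int s else 0) *\<^sub>R e3 (primary_terms i ! line i k)) =
        (\<Sum>k<7. if k = n then of_int s *\<^sub>R e3 t else 0)"
      by (rule sum.cong) (auto simp: m n(2))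
    also have "\<dots> = of_int s *\<^sub>R e3 t" using n by simp
    finally show ?thesis
      using rem unfolding has_remainder_def remainder_relative_signs[OF ss] neg_one_power_mult
      by (simp add: signed_form_lines[OF ss] scaleR_sum_right scaleR_add_left sum.distrib P_def)
  qed
  note * = lines_independent[OF this]
  have sums: "line_sum (relative_signs i ss) k = -1" if "k < 7" "k \<noteq> n" for k
  proof -
    have "line i k < 7" using line_bij that by (auto simp: bij_betw_def)
    then have "ss ! line i k \<noteq> 0" using pattern_signs(2)[OF ss] by fastforce
    moreover have "P \<noteq> 0" using P by auto
    ultimately have "3 - real_of_int (line_sum (relative_signs i ss) k) = 4"
      using *[OF that(1)] that(2) by simp
    then show ?thesis by linarith
  qed
  \<comment> \<open>a single line with sum -1 already makes the character non-trivial\<close>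
  obtain k where "k < 7" "k \<noteq> n" using ex_other_line by blast
  then have "\<not> trivial_character (relative_signs i ss)"
    using sums[of k] line_sum_trivial[of "relative_signs i ss" k] by auto
  then obtain n' where n': "kernel_line (relative_signs i ss) n'" using character_cases[OF ts] by blast
  then have "n' < 7" by (simp add: kernel_line_def)
  then have "n' = n" using line_sum_kernel[OF n', of n'] sums[of n'] by auto
  then show ?thesis using that n' m n by blast
qed

end

section \<open>Relabelling the generated algebras\<close>

text \<open>
  Indexing coordinates by natural numbers avoids arithmetic in the finite index type.
\<close>

definition component :: "real^8 \<Rightarrow> nat \<Rightarrow> real" where
  "component x a = x $ of_nat a"

lemma component_linear [simp]:
  "component (x + y) a = component x a + component y a"
  "component (x - y) a = component x a - component y a"
  "component (- x) a = - component x a"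
  "component (r *\<^sub>R x) a = r * component x a"
  "component 0 a = 0"
  by (simp_all add: component_def)

lemma component_sum: "component (sum f A) a = (\<Sum>i\<in>A. component (f i) a)"
  by (simp add: component_def)

lemma of_nat_8_inj: "a \<le> 7 \<Longrightarrow> b \<le> 7 \<Longrightarrow> (of_nat a :: 8) = of_nat b \<longleftrightarrow> a = b"
  by (simp add: bit0.of_nat_eq Abs_bit0_inject)

lemma of_nat_8_surj: "bij_betw (of_nat :: nat \<Rightarrow> 8) {..7} UNIV"
proof -
  have inj: "inj_on (of_nat :: nat \<Rightarrow> 8) {..7}" by (auto simp: inj_on_def of_nat_8_inj)
  then have "of_nat ` {..7::nat} = (UNIV :: 8 set)" by (intro card_subset_eq) (auto simp: card_image)
  with inj show ?thesis by (simp add: bij_betw_def)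
qed

lemma component_alg_p [simp]: "a \<le> 7 \<Longrightarrow> b \<le> 7 \<Longrightarrow> component (alg_p a) b = (if a = b then 1 else 0)"
  by (auto simp: component_def alg_p_def axis_def of_nat_8_inj)

lemma component_eqI: "(\<And>a. a \<le> 7 \<Longrightarrow> component x a = component y a) \<Longrightarrow> x = y"
  unfolding vec_eq_iff
proof
  fix j :: 8
  assume eq: "\<And>a. a \<le> 7 \<Longrightarrow> component x a = component y a"
  have "j \<in> of_nat ` {..7}" using of_nat_8_surj by (simp add: bij_betw_def)
  then show "x $ j = y $ j" using eq by (auto simp: component_def)
qed

lemma component_expansion: "x = (\<Sum>a\<le>7. component x a *\<^sub>R alg_p a)"
  by (rule component_eqI) (simp add: component_sum if_distrib cong: if_cong)

lemma inner_components: "x \<bullet> y = (\<Sum>a\<le>7. component x a * component y a)"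
  unfolding inner_vec_def component_def by (simp add: sum.reindex_bij_betw[OF of_nat_8_surj, symmetric])

lemma norm_components: "(norm x)\<^sup>2 = (\<Sum>a\<le>7. (component x a)\<^sup>2)"
  unfolding power2_norm_eq_inner inner_components by (simp add: power2_eq_square)

lemma sum_atMost_7: "(\<Sum>k\<le>7::nat. g k) = g 0 + g 1 + g 2 + g 3 + g 4 + g 5 + g 6 + (g 7 :: 'a::comm_monoid_add)"
proof -
  have "{..7::nat} = {0, 1, 2, 3, 4, 5, 6, 7}" by auto
  then show ?thesis by (simp add: add.assoc)
qed

lemma le_7_cases: "a \<le> (7::nat) \<longleftrightarrow> a \<in> {0, 1, 2, 3, 4, 5, 6, 7}"
  by auto

lemma alg_mult_components:
  "alg_mult i ss x y = (\<Sum>a\<le>7. \<Sum>b\<le>7. (component x a * component y b) *\<^sub>R basis_product i ss a b)"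
  by (simp add: alg_mult_def component_def)

lemma alg_mult_bilinear [simp]:
  "alg_mult i ss (x + y) z = alg_mult i ss x z + alg_mult i ss y z"
  "alg_mult i ss z (x + y) = alg_mult i ss z x + alg_mult i ss z y"
  "alg_mult i ss (x - y) z = alg_mult i ss x z - alg_mult i ss y z"
  "alg_mult i ss z (x - y) = alg_mult i ss z x - alg_mult i ss z y"
  "alg_mult i ss (r *\<^sub>R x) z = r *\<^sub>R alg_mult i ss x z"
  "alg_mult i ss z (r *\<^sub>R x) = r *\<^sub>R alg_mult i ss z x"
  "alg_mult i ss (- x) z = - alg_mult i ss x z"
  "alg_mult i ss z (- x) = - alg_mult i ss z x"
  by (simp_all add: alg_mult_components distrib_left distrib_right left_diff_distrib right_diff_distrib
    scaleR_add_left scaleR_diff_left sum.distrib sum_subtractf sum_negf scaleR_sum_right mult.assoc mult.left_commute)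

lemma std_nth: "std ! 0 = (1, 2, 4)" "std ! 1 = (1, 3, 7)" "std ! 2 = (1, 5, 6)" "std ! 3 = (2, 3, 5)"
    "std ! 4 = (2, 6, 7)" "std ! 5 = (3, 4, 6)" "std ! 6 = (4, 5, 7)"
  by (simp_all add: std_terms)

lemma std_in: "k < 7 \<Longrightarrow> std ! k \<in> set std"
  by (rule nth_mem) (simp add: std_terms)

lemma std_third:
    "third std 1 2 = 4" "third std 1 3 = 7" "third std 1 4 = 2" "third std 1 5 = 6" "third std 1 6 = 5" "third std 1 7 = 3"
    "third std 2 1 = 4" "third std 2 3 = 5" "third std 2 4 = 1" "third std 2 5 = 3" "third std 2 6 = 7" "third std 2 7 = 6"
    "third std 3 1 = 7" "third std 3 2 = 5" "third std 3 4 = 6" "third std 3 5 = 2" "third std 3 6 = 4" "third std 3 7 = 1"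
    "third std 4 1 = 2" "third std 4 2 = 1" "third std 4 3 = 6" "third std 4 5 = 7" "third std 4 6 = 3" "third std 4 7 = 5"
    "third std 5 1 = 6" "third std 5 2 = 3" "third std 5 3 = 2" "third std 5 4 = 7" "third std 5 6 = 1" "third std 5 7 = 4"
    "third std 6 1 = 5" "third std 6 2 = 7" "third std 6 3 = 4" "third std 6 4 = 3" "third std 6 5 = 1" "third std 6 7 = 2"
    "third std 7 1 = 3" "third std 7 2 = 6" "third std 7 3 = 1" "third std 7 4 = 5" "third std 7 5 = 4" "third std 7 6 = 2"
  by (simp_all add: third_def std_terms)

lemma term_product_scale: "term_product a b (s, t) = of_int s *\<^sub>R term_product a b (1, t)"
  by (cases t) (simp only: term_product.simps if_distrib[of "scaleR _"] scaleR_scaleR scaleR_zero_right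
    of_int_1 mult_1_right scaleR_one scaleR_minus_right scaleR_minus1_left scaleR_minus_left mult_minus_right)

lemma term_product_alternating: "alternating (\<lambda>t. term_product a b (1, t))"
  unfolding alternating_def
proof (intro ballI impI)
  fix u v w :: nat assume "u \<noteq> v \<and> u \<noteq> w \<and> v \<noteq> w"
  then have ne: "u \<noteq> v" "v \<noteq> u" "u \<noteq> w" "w \<noteq> u" "v \<noteq> w" "w \<noteq> v" by auto
  consider "(a, b) \<in> {(u, v), (v, w), (w, u), (v, u), (w, v), (u, w)}"
    | "(a, b) \<notin> {(u, v), (v, w), (w, u), (v, u), (w, v), (u, w)}" by blast
  then show "term_product a b (1, (v, u, w)) = - term_product a b (1, (u, v, w)) \<and>
      term_product a b (1, (u, w, v)) = - term_product a b (1, (u, v, w))"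
  proof cases
    case 1
    then show ?thesis by (elim insertE emptyE) (simp_all add: ne)
  next
    case 2
    then show ?thesis
      by (simp only: term_product.simps insert_iff empty_iff de_Morgan_disj if_False minus_zero simp_thms)
  qed
qed

lemma basis_product_sum:
  assumes "length ss = 7" "length (primary_terms i) = 7" "a \<noteq> 0" "b \<noteq> 0" "a \<noteq> b"
  shows "basis_product i ss a b = (\<Sum>m<7. of_int (ss ! m) *\<^sub>R term_product a b (1, primary_terms i ! m))"
proof -
  have "basis_product i ss a b = sum_list (map (term_product a b) (zip ss (primary_terms i)))"
    using assms by (simp add: basis_product_def)
  also have "\<dots> = (\<Sum>m<7. term_product a b (ss ! m, primary_terms i ! m))"
    using assms by (simp add: sum_list_sum_nth atLeast0LessThan)
  finally show ?thesis by (simp only: term_product_scale[of a b "ss ! _"])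
qed

text \<open>
  The linear map that permutes the basis vectors by the labelling; it is an isometry and an isomorphism
  from the standard algebra with the relative signs.
\<close>

definition relabel_vec :: "nat \<Rightarrow> real^8 \<Rightarrow> real^8" where
  "relabel_vec i x = (\<Sum>a\<le>7. component x a *\<^sub>R alg_p (label i a))"

context primary_row
begin

lemma label_le: "a \<le> 7 \<Longrightarrow> label i a \<le> 7"
  using in_points[of a] label_0 by (cases "a = 0") auto

lemma label_eq_iff: "a \<le> 7 \<Longrightarrow> b \<le> 7 \<Longrightarrow> label i a = label i b \<longleftrightarrow> a = b"
  using label_inj by (auto simp: inj_on_def)

lemma relabel_vec_linear [simp]:
  "relabel_vec i (x + y) = relabel_vec i x + relabel_vec i y"
  "relabel_vec i (r *\<^sub>R x) = r *\<^sub>R relabel_vec i x"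
  "relabel_vec i (- x) = - relabel_vec i x"
  "relabel_vec i 0 = 0"
  by (simp_all add: relabel_vec_def scaleR_add_left sum.distrib scaleR_sum_right sum_negf)

lemma relabel_vec_sum: "relabel_vec i (sum f A) = (\<Sum>k\<in>A. relabel_vec i (f k))"
  by (induction A rule: infinite_finite_induct) auto

lemma relabel_vec_alg_p: "a \<le> 7 \<Longrightarrow> relabel_vec i (alg_p a) = alg_p (label i a)"
  by (simp add: relabel_vec_def if_distrib[of "\<lambda>r. r *\<^sub>R _"] cong: if_cong)

lemma component_relabel_vec: "a \<le> 7 \<Longrightarrow> component (relabel_vec i x) (label i a) = component x a"
  by (simp add: relabel_vec_def component_sum label_le label_eq_iff if_distrib cong: if_cong)

lemma label_bij_8: "bij_betw (label i) {..7} {..7}"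
proof -
  have "label i ` {..7} \<subseteq> {..7}" using label_le by auto
  then show ?thesis using label_inj by (simp add: bij_betw_def endo_inj_surj)
qed

lemma norm_relabel_vec: "norm (relabel_vec i x) = norm x"
proof -
  have "(norm (relabel_vec i x))\<^sup>2 = (\<Sum>a\<le>7. (component (relabel_vec i x) (label i a))\<^sup>2)"
    unfolding norm_components by (rule sum.reindex_bij_betw[OF label_bij_8, symmetric])
  then have "(norm (relabel_vec i x))\<^sup>2 = (norm x)\<^sup>2"
    by (simp add: component_relabel_vec norm_components)
  then show ?thesis by simp
qed

lemma relabel_vec_bij: "linear (relabel_vec i)" "bij (relabel_vec i)"
proof -
  show lin: "linear (relabel_vec i)" by (rule linearI) auto
  have "inj (relabel_vec i)"
    using norm_relabel_vec by (subst linear_injective_0[OF lin]) (metis norm_eq_zero)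
  then show "bij (relabel_vec i)"
    using linear_injective_imp_surjective[OF lin] by (simp add: bij_def)
qed

lemma term_product_relabel:
  assumes "t \<in> set std" "x \<in> {1..7}" "y \<in> {1..7}"
  shows "term_product (label i x) (label i y) (1, relabel (label i) t) = relabel_vec i (term_product x y (1, t))"
proof (cases t)
  case (fields u v w)
  have le: "u \<le> 7" "v \<le> 7" "w \<le> 7" "x \<le> 7" "y \<le> 7" using assms fields by (auto simp: std_terms)
  show ?thesis
    by (simp only: fields relabel.simps term_product.simps prod.inject label_eq_iff le
      if_distrib[of "relabel_vec i"] relabel_vec_linear relabel_vec_alg_p)
qed

text \<open>
  Structure constants are an alternating function of the term, so they relabel like the form itself.
\<close>

lemma basis_product_relabel:
  assumes "x \<le> 7" "y \<le> 7" and ss: "ss \<in> sign_patterns"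
  shows "basis_product i ss (label i x) (label i y) = relabel_vec i (basis_product 11 (relative_signs i ss) x y)"
proof (cases "x = 0 \<or> y = 0 \<or> x = y")
  case True
  then show ?thesis using assms label_eq_iff[of x 0] label_eq_iff[of y 0]
    by (auto simp: basis_product_def label_0 relabel_vec_alg_p label_eq_iff)
next
  case False
  then have xy: "x \<in> {1..7}" "y \<in> {1..7}" "label i x \<noteq> 0" "label i y \<noteq> 0" "label i x \<noteq> label i y"
    using assms label_eq_iff[of x 0] label_eq_iff[of y 0] by (auto simp: label_0 label_eq_iff)
  have "basis_product i ss (label i x) (label i y) =
      (\<Sum>m<7. of_int (ss ! m) *\<^sub>R term_product (label i x) (label i y) (1, primary_terms i ! m))"
    using ss xy terms(1) by (intro basis_product_sum) (auto simp: sign_patterns_def)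
  also have "\<dots> = (\<Sum>k<7. of_int (relative_signs i ss ! k) *\<^sub>R term_product (label i x) (label i y) (1, relabel (label i) (std ! k)))"
    by (rule sum_relabel[OF term_product_alternating])
  also have "\<dots> = relabel_vec i (\<Sum>k<7. of_int (relative_signs i ss ! k) *\<^sub>R term_product x y (1, std ! k))"
  proof -
    show ?thesis using xy by (simp add: std_in relabel_vec_sum term_product_relabel del: term_product.simps relabel.simps)
  qed
  also have "(\<Sum>k<7. of_int (relative_signs i ss ! k) *\<^sub>R term_product x y (1, std ! k)) = basis_product 11 (relative_signs i ss) x y"
    using False by (intro basis_product_sum[symmetric]) (auto simp: relative_signs_def std_terms)
  finally show ?thesis .
qed

lemma alg_mult_relabel:
  assumes ss: "ss \<in> sign_patterns"
  shows "alg_mult i ss (relabel_vec i x) (relabel_vec i y) = relabel_vec i (alg_mult 11 (relative_signs i ss) x y)"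
proof -
  let ?x = "component (relabel_vec i x)" and ?y = "component (relabel_vec i y)"
  have "alg_mult i ss (relabel_vec i x) (relabel_vec i y) =
     (\<Sum>a\<le>7. \<Sum>b\<le>7. (?x (label i a) * ?y (label i b)) *\<^sub>R basis_product i ss (label i a) (label i b))"
    unfolding alg_mult_components
    by (subst sum.reindex_bij_betw[OF label_bij_8, symmetric], rule sum.cong[OF refl],
        subst sum.reindex_bij_betw[OF label_bij_8, symmetric], rule refl)
  also have "\<dots> = relabel_vec i (alg_mult 11 (relative_signs i ss) x y)"
    unfolding alg_mult_components relabel_vec_sum
    by (intro sum.cong refl) (simp add: component_relabel_vec basis_product_relabel ss)
  finally show ?thesis .
qed

lemma assoc_at_relabel:
  assumes "ss \<in> sign_patterns"
  shows "assoc_at (alg_mult i ss) (relabel_vec i x) (relabel_vec i y) (relabel_vec i z) \<longleftrightarrow>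
    assoc_at (alg_mult 11 (relative_signs i ss)) x y z"
  using relabel_vec_bij(2) by (simp add: assoc_at_def alg_mult_relabel assms bij_def inj_eq)

lemma third_relabel:
  assumes x: "x \<in> {1..7}" and y: "y \<in> {1..7}" and "x \<noteq> y"
  shows "third (primary_terms i) (label i x) (label i y) = label i (third std x y)"
proof -
  let ?o = "other (label i x) (label i y)"
  have "third (primary_terms i) (label i x) (label i y) = (\<Sum>m<7. ?o (primary_terms i ! m))"
    using terms(1) by (simp add: third_def sum_list_sum_nth atLeast0LessThan)
  also have "\<dots> = (\<Sum>k<7. ?o (primary_terms i ! line i k))"
    by (rule sum.reindex_bij_betw[OF line_bij, symmetric])
  also have "\<dots> = (\<Sum>k<7. ?o (relabel (label i) (std ! k)))"
  proof (rule sum.cong[OF refl])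
    fix k :: nat assume "k \<in> {..<7}"
    then have k: "k < 7" by simp
    obtain a b c where t: "primary_terms i ! line i k = (a, b, c)" "a < b" "b < c"
      using term_at_line[OF k] by blast
    have "orient (a, b, c) (relabel (label i) (std ! k)) \<noteq> 0"
      using orientation[OF k] unfolding orientation_def t(1)
      by (metis insert_iff singletonD zero_neq_neg_one zero_neq_one)
    then have "relabel (label i) (std ! k) \<in> {(a, b, c), (b, c, a), (c, a, b), (b, a, c), (a, c, b), (c, b, a)}"
      by (auto split: if_splits)
    then show "?o (primary_terms i ! line i k) = ?o (relabel (label i) (std ! k))"
      using t by (elim insertE emptyE) auto
  qed
  also have "\<dots> = (\<Sum>k<7. label i (other x y (std ! k)))"
  proof (rule sum.cong[OF refl])
    fix k :: nat assume "k \<in> {..<7}"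
    obtain a b c where t: "std ! k = (a, b, c)" by (cases "std ! k")
    moreover have "std ! k \<in> set std" using \<open>k \<in> {..<7}\<close> by (simp add: std_in)
    ultimately have le: "a \<le> 7" "b \<le> 7" "c \<le> 7" "x \<le> 7" "y \<le> 7" using x y by (auto simp: std_terms)
    show "?o (relabel (label i) (std ! k)) = label i (other x y (std ! k))"
      unfolding t
      by (simp only: relabel.simps other.simps prod.inject label_eq_iff le if_distrib[of "label i"] label_0)
  qed
  also have "\<dots> = label i (third std x y)"
    using assms unfolding points_cases
    by (elim insertE emptyE) (simp_all add: sum_upto_7 std_nth std_third label_0)
  finally show ?thesis .
qed

end

text \<open>
  The structure constants of the standard algebra: \<open>p\<^sub>x p\<^sub>y\<close> is this sign times
  the basis vector of the third point.
\<close>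

definition std_sign :: "int list \<Rightarrow> nat \<Rightarrow> nat \<Rightarrow> int" where
  "std_sign ts x y = (\<Sum>m<7. ts ! m * orient (std ! m) (x, y, third std x y))"

lemma std_sign:
    "std_sign ts 1 2 = ts ! 0" "std_sign ts 1 3 = ts ! 1" "std_sign ts 1 4 = - ts ! 0" "std_sign ts 1 5 = ts ! 2" "std_sign ts 1 6 = - ts ! 2" "std_sign ts 1 7 = - ts ! 1"
    "std_sign ts 2 1 = - ts ! 0" "std_sign ts 2 3 = ts ! 3" "std_sign ts 2 4 = ts ! 0" "std_sign ts 2 5 = - ts ! 3" "std_sign ts 2 6 = ts ! 4" "std_sign ts 2 7 = - ts ! 4"
    "std_sign ts 3 1 = - ts ! 1" "std_sign ts 3 2 = - ts ! 3" "std_sign ts 3 4 = ts ! 5" "std_sign ts 3 5 = ts ! 3" "std_sign ts 3 6 = - ts ! 5" "std_sign ts 3 7 = ts ! 1"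
    "std_sign ts 4 1 = ts ! 0" "std_sign ts 4 2 = - ts ! 0" "std_sign ts 4 3 = - ts ! 5" "std_sign ts 4 5 = ts ! 6" "std_sign ts 4 6 = ts ! 5" "std_sign ts 4 7 = - ts ! 6"
    "std_sign ts 5 1 = - ts ! 2" "std_sign ts 5 2 = ts ! 3" "std_sign ts 5 3 = - ts ! 3" "std_sign ts 5 4 = - ts ! 6" "std_sign ts 5 6 = ts ! 2" "std_sign ts 5 7 = ts ! 6"
    "std_sign ts 6 1 = ts ! 2" "std_sign ts 6 2 = - ts ! 4" "std_sign ts 6 3 = ts ! 5" "std_sign ts 6 4 = - ts ! 5" "std_sign ts 6 5 = - ts ! 2" "std_sign ts 6 7 = ts ! 4"
    "std_sign ts 7 1 = ts ! 1" "std_sign ts 7 2 = ts ! 4" "std_sign ts 7 3 = - ts ! 1" "std_sign ts 7 4 = ts ! 6" "std_sign ts 7 5 = - ts ! 6" "std_sign ts 7 6 = - ts ! 4"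
  unfolding std_sign_def std_third sum_upto_7 by (simp_all add: std_nth)

lemma std_product:
  assumes "length ts = 7" "x \<in> {1..7}" "y \<in> {1..7}" "x \<noteq> y"
  shows "alg_mult 11 ts (alg_p x) (alg_p y) = of_int (std_sign ts x y) *\<^sub>R alg_p (third std x y)"
proof -
  have "alg_mult 11 ts (alg_p x) (alg_p y) = (\<Sum>m<7. of_int (ts ! m) *\<^sub>R term_product x y (1, std ! m))"
    using assms by (simp add: alg_mult_alg_p basis_product_sum std_terms del: term_product.simps)
  also have "\<dots> = of_int (std_sign ts x y) *\<^sub>R alg_p (third std x y)"
    using assms(2-4) unfolding points_cases
    by (elim insertE emptyE) (simp_all add: sum_upto_7 std_nth std_sign std_third)
  finally show ?thesis .
qed

section \<open>Associativity and zero divisors in row 11\<close>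

lemma third_std_points:
  assumes "x \<in> {1..7}" "y \<in> {1..7}" "x \<noteq> y"
  shows "third std x y \<in> {1..7}" "third std x y \<noteq> x" "third std x y \<noteq> y"
    "third std x (third std x y) = y" "third std (third std x y) y = x" "third std y (third std x y) = x"
proof -
  have "\<forall>x\<in>{1, 2, 3, 4, 5, 6, 7}. \<forall>y\<in>{1, 2, 3, 4, 5, 6, 7}. x \<noteq> y \<longrightarrow> third std x y \<in> {1, 2, 3, 4, 5, 6, 7} \<and>
    third std x y \<noteq> x \<and> third std x y \<noteq> y \<and>
    third std x (third std x y) = y \<and> third std (third std x y) y = x \<and> third std y (third std x y) = x"
    by (simp add: std_third)
  then show "third std x y \<in> {1..7}" "third std x y \<noteq> x" "third std x y \<noteq> y"
    "third std x (third std x y) = y" "third std (third std x y) y = x" "third std y (third std x y) = x"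
    unfolding points_cases[symmetric] using assms by blast+
qed

text \<open>
  Adding the unit as identity, the third point of a line is the product in an elementary abelian group of
  order 8.
\<close>

lemma third_std_assoc:
  assumes "x \<in> {1..7}" "y \<in> {1..7}" "z \<in> {1..7}" "x \<noteq> y" "x \<noteq> z" "y \<noteq> z" "third std x y \<noteq> z"
  shows "third std (third std x y) z = third std x (third std y z)" "x \<noteq> third std y z"
proof -
  have "\<forall>x\<in>{1, 2, 3, 4, 5, 6, 7}. \<forall>y\<in>{1, 2, 3, 4, 5, 6, 7}. x \<noteq> y \<longrightarrow> (\<forall>z\<in>{1, 2, 3, 4, 5, 6, 7}.
    x \<noteq> z \<longrightarrow> y \<noteq> z \<longrightarrow> third std x y \<noteq> z \<longrightarrow>
    third std (third std x y) z = third std x (third std y z) \<and> x \<noteq> third std y z)"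
    by (simp add: std_third)
  then show "third std (third std x y) z = third std x (third std y z)" "x \<noteq> third std y z"
    unfolding points_cases[symmetric] using assms by blast+
qed

text \<open>
  The two bracketings run through the lines \<open>xy\<close>, \<open>(xy)z\<close>, \<open>yz\<close>
  and \<open>x(yz)\<close>. None of them contains the third point of \<open>x\<close> and
  \<open>z\<close>, so they are the four lines that miss it. The sign in front is -1 because all
  bracketings off the lines disagree in the octonions.
\<close>

lemma std_sign_quadrangle:
  assumes "x \<in> {1..7}" "y \<in> {1..7}" "z \<in> {1..7}" "x \<noteq> y" "x \<noteq> z" "y \<noteq> z" "third std x y \<noteq> z"
  shows "std_sign ts x y * std_sign ts (third std x y) z * (std_sign ts y z * std_sign ts x (third std y z)) =
    - point_sign ts (third std x z)"
proof -
  have "\<forall>x\<in>{1, 2, 3, 4, 5, 6, 7}. \<forall>y\<in>{1, 2, 3, 4, 5, 6, 7}. x \<noteq> y \<longrightarrow> (\<forall>z\<in>{1, 2, 3, 4, 5, 6, 7}.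
    x \<noteq> z \<longrightarrow> y \<noteq> z \<longrightarrow> third std x y \<noteq> z \<longrightarrow>
    std_sign ts x y * std_sign ts (third std x y) z * (std_sign ts y z * std_sign ts x (third std y z)) =
    - point_sign ts (third std x z))"
    by (simp add: std_third std_sign point_sign_products mult_ac)
  then show ?thesis
    unfolding points_cases[symmetric] using assms by blast
qed

lemma std_sign_line:
  assumes "x \<in> {1..7}" "y \<in> {1..7}" "x \<noteq> y"
  shows "std_sign ts y (third std x y) = std_sign ts x y"
  using assms unfolding points_cases
  by (elim insertE emptyE; simp add: std_third std_sign)

lemma std_sign_unit:
  assumes "ts \<in> sign_patterns" "x \<in> {1..7}" "y \<in> {1..7}" "x \<noteq> y"
  shows "std_sign ts x y = 1 \<or> std_sign ts x y = -1"
proof -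
  have "std_sign ts x y * std_sign ts x y = 1"
    using assms(2-4) unfolding points_cases
    by (elim insertE emptyE; simp add: std_sign pattern_signs(1)[OF assms(1)])
  then show ?thesis by (simp add: square_eq_1_iff)
qed

lemma std_square: "x \<in> {1..7} \<Longrightarrow> alg_mult 11 ts (alg_p x) (alg_p x) = - alg_p 0"
  by (simp add: alg_mult_alg_p basis_product_def)

lemma alg_p_nonzero: "a \<le> 7 \<Longrightarrow> alg_p a \<noteq> 0"
  using component_alg_p[of a a] component_linear(5)[of a] by fastforce

lemma std_assoc_iff:
  assumes ts: "ts \<in> sign_patterns" and x: "x \<in> {1..7}" and y: "y \<in> {1..7}" and z: "z \<in> {1..7}"
    and ne: "x \<noteq> y" "x \<noteq> z" "y \<noteq> z"
  shows "assoc_at (alg_mult 11 ts) (alg_p x) (alg_p y) (alg_p z) \<longleftrightarrow>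
    third std x y = z \<or> point_sign ts (third std x z) = -1"
proof (cases "third std x y = z")
  case True
  have len: "length ts = 7" using ts by (simp add: sign_patterns_def)
  have "alg_mult 11 ts (alg_mult 11 ts (alg_p x) (alg_p y)) (alg_p z) = - (of_int (std_sign ts x y) *\<^sub>R alg_p 0)"
    by (simp add: std_product len x y z ne True std_square del: atLeastAtMost_iff)
  moreover have "third std y z = x" "std_sign ts y z = std_sign ts x y"
    using third_std_points(6)[OF x y ne(1)] std_sign_line[OF x y ne(1)] by (simp_all add: True)
  ultimately show ?thesis using True
    by (simp add: assoc_at_def std_product len y z ne x std_square del: atLeastAtMost_iff)
next
  case False
  have len: "length ts = 7" using ts by (simp add: sign_patterns_def)
  note xy = third_std_points(1)[OF x y ne(1)] and yz = third_std_points(1)[OF y z ne(3)]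
  note q = third_std_assoc[OF x y z ne False]
  define a b where "a = std_sign ts x y * std_sign ts (third std x y) z"
    and "b = std_sign ts y z * std_sign ts x (third std y z)"
  have "alg_mult 11 ts (alg_mult 11 ts (alg_p x) (alg_p y)) (alg_p z) =
      of_int a *\<^sub>R alg_p (third std x (third std y z))"
    by (simp add: std_product len x y z ne False xy q(1) a_def del: atLeastAtMost_iff)
  moreover have "alg_mult 11 ts (alg_p x) (alg_mult 11 ts (alg_p y) (alg_p z)) =
      of_int b *\<^sub>R alg_p (third std x (third std y z))"
    by (simp add: std_product len x y z ne yz q b_def del: atLeastAtMost_iff)
  moreover have "third std x (third std y z) \<le> 7"
    using third_std_points(1)[OF x yz q(2)] by simp
  ultimately have "assoc_at (alg_mult 11 ts) (alg_p x) (alg_p y) (alg_p z) \<longleftrightarrow> a = b"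
    by (simp add: assoc_at_def alg_p_nonzero)
  moreover have "a = 1 \<or> a = -1" "b = 1 \<or> b = -1"
    unfolding a_def b_def
    using std_sign_unit[OF ts x y ne(1)] std_sign_unit[OF ts xy z False] std_sign_unit[OF ts y z ne(3)]
      std_sign_unit[OF ts x yz q(2)] by auto
  moreover have "a * b = - point_sign ts (third std x z)"
    unfolding a_def b_def by (rule std_sign_quadrangle[OF x y z ne False])
  ultimately show ?thesis using False by auto
qed

text \<open>
  Four basis vectors whose products pairwise coincide up to sign, with signs that let all of them cancel
  or all of them add up. The vectors \<open>q\<close> and \<open>r\<close> are the two values of the
  products.
\<close>

definition has_degenerate_square :: "(real^8 \<Rightarrow> real^8 \<Rightarrow> real^8) \<Rightarrow> bool" where
  "has_degenerate_square f \<longleftrightarrow> (\<exists>a b c d q r s s' s''. {a, b, c, d, q, r} \<subseteq> {1..7} \<and>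
     distinct [a, b, c, d, q, r] \<and> s \<in> {1, -1} \<and> s' \<in> {1, -1} \<and> s'' \<in> {1, -1} \<and>
     f (alg_p a + alg_p b) (alg_p c - s *\<^sub>R alg_p d) = 0 \<and>
     f (alg_p a + alg_p b) (alg_p c + s *\<^sub>R alg_p d) = (2 * s') *\<^sub>R alg_p q + (2 * s'') *\<^sub>R alg_p r)"

text \<open>
  Let \<open>p\<close> have point sign -1, let \<open>a\<close>, \<open>b\<close> be the other points of
  a line through \<open>p\<close>, let \<open>c\<close> be off that line and \<open>d\<close> the third
  point of \<open>p\<close> and \<open>c\<close>. Then \<open>ac\<close> and \<open>bd\<close> have the
  same third point, as have \<open>ad\<close> and \<open>bc\<close>, and the four lines are those that
  miss \<open>p\<close>. As their signs multiply to that of \<open>p\<close>, one choice of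
  \<open>s\<close> makes both pairs cancel.
\<close>

lemma std_degenerate_square:
  assumes ts: "ts \<in> sign_patterns" and "\<not> trivial_character ts"
  shows "has_degenerate_square (alg_mult 11 ts)"
proof -
  have len: "length ts = 7" using ts by (simp add: sign_patterns_def)
  have *: "has_degenerate_square (alg_mult 11 ts)"
    if "{a, b, c, d} \<subseteq> {1..7}" "distinct [a, b, c, d]" "third std b d = third std a c" "third std a d = third std b c"
      "third std a c \<noteq> third std b c"
      "std_sign ts a c * std_sign ts b d = std_sign ts b c * std_sign ts a d" for a b c d
  proof -
    have pts: "a \<in> {1..7}" "b \<in> {1..7}" "c \<in> {1..7}" "d \<in> {1..7}" "a \<noteq> b" "a \<noteq> c" "a \<noteq> d" "b \<noteq> c" "b \<noteq> d" "c \<noteq> d"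
      using that(1,2) by auto
    note unit = std_sign_unit[OF ts]
    define s where "s = real_of_int (std_sign ts a c * std_sign ts b d)"
    have s: "s \<in> {1, -1}" using unit[of a c] unit[of b d] pts unfolding s_def by auto
    have sac: "s * of_int (std_sign ts b d) = of_int (std_sign ts a c)"
      using unit[of b d] pts unfolding s_def by auto
    have sbc: "s * of_int (std_sign ts a d) = of_int (std_sign ts b c)"
      using unit[of a d] pts unfolding s_def that(6) by auto
    have expand: "alg_mult 11 ts (alg_p a + alg_p b) (alg_p c + r *\<^sub>R alg_p d) =
        (of_int (std_sign ts a c) + r * of_int (std_sign ts b d)) *\<^sub>R alg_p (third std a c) +
        (of_int (std_sign ts b c) + r * of_int (std_sign ts a d)) *\<^sub>R alg_p (third std b c)" for r
      using pts by (simp add: std_product len that(3,4) scaleR_add_left scaleR_add_right)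
    have "alg_mult 11 ts (alg_p a + alg_p b) (alg_p c - s *\<^sub>R alg_p d) = 0"
      using expand[of "- s"] by (simp add: sac sbc)
    moreover have "alg_mult 11 ts (alg_p a + alg_p b) (alg_p c + s *\<^sub>R alg_p d) =
        (2 * of_int (std_sign ts a c)) *\<^sub>R alg_p (third std a c) + (2 * of_int (std_sign ts b c)) *\<^sub>R alg_p (third std b c)"
      using expand[of s] by (simp add: sac sbc)
    moreover have "real_of_int (std_sign ts a c) \<in> {1, -1}" "real_of_int (std_sign ts b c) \<in> {1, -1}"
      using unit[of a c] unit[of b c] pts by auto
    moreover have "{a, b, c, d, third std a c, third std b c} \<subseteq> {1..7}"
      using that(1) third_std_points(1) pts by auto
    moreover have "distinct [a, b, c, d, third std a c, third std b c]"
      using third_std_points(2,3)[of a c] third_std_points(2,3)[of b c] third_std_points(2,3)[of b d]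
        third_std_points(2,3)[of a d] pts that(3-5) by (auto simp del: atLeastAtMost_iff)
    ultimately show ?thesis
      unfolding has_degenerate_square_def using s
      by (intro exI[of _ a] exI[of _ b] exI[of _ c] exI[of _ d] exI[of _ "third std a c"] exI[of _ "third std b c"]
        exI[of _ s] exI[of _ "real_of_int (std_sign ts a c)"] exI[of _ "real_of_int (std_sign ts b c)"] conjI)
  qed
  have u: "ts ! 0 = 1 \<or> ts ! 0 = -1" "ts ! 1 = 1 \<or> ts ! 1 = -1" "ts ! 2 = 1 \<or> ts ! 2 = -1"
    "ts ! 3 = 1 \<or> ts ! 3 = -1" "ts ! 4 = 1 \<or> ts ! 4 = -1" "ts ! 5 = 1 \<or> ts ! 5 = -1" "ts ! 6 = 1 \<or> ts ! 6 = -1"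
    by (simp_all add: pattern_signs(2)[OF ts])
  consider "point_sign ts 1 = -1" | "point_sign ts 2 = -1" | "point_sign ts 3 = -1"
    using assms(2) point_sign_character(5)[OF ts] unfolding trivial_character_iff[OF ts] by blast
  then show ?thesis
  proof cases
    \<comment> \<open>the lines through \<open>p\<close> used here are 124 and 137, 124 and 235, 137 and 235\<close>
    case 1
    have "std_sign ts 2 3 * std_sign ts 4 7 = std_sign ts 4 3 * std_sign ts 2 7"
      using 1 u(4) u(5) u(6) u(7) unfolding point_sign_products std_sign by (elim disjE) simp_all
    then show ?thesis by (intro *[of 2 4 3 7]) (simp_all add: std_third)
  next
    case 2
    have "std_sign ts 1 3 * std_sign ts 4 5 = std_sign ts 4 3 * std_sign ts 1 5"
      using 2 u(2) u(3) u(6) u(7) unfolding point_sign_products std_sign by (elim disjE) simp_all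
    then show ?thesis by (intro *[of 1 4 3 5]) (simp_all add: std_third)
  next
    case 3
    have "std_sign ts 1 2 * std_sign ts 7 5 = std_sign ts 7 2 * std_sign ts 1 5"
      using 3 u(1) u(3) u(5) u(7) unfolding point_sign_products std_sign by (elim disjE) simp_all
    then show ?thesis by (intro *[of 1 7 2 5]) (simp_all add: std_third)
  qed
qed

section \<open>The octonions\<close>

lemma quat_mult_linear:
  "quat_mult (x + y) z = quat_mult x z + quat_mult y z" "quat_mult z (x + y) = quat_mult z x + quat_mult z y"
  "quat_mult (r *\<^sub>R x) z = r *\<^sub>R quat_mult x z" "quat_mult z (r *\<^sub>R x) = r *\<^sub>R quat_mult z x"
  by (cases x; cases y; cases z; simp add: algebra_simps)+

lemma quat_cnj_linear: "quat_cnj (x + y) = quat_cnj x + quat_cnj y" "quat_cnj (r *\<^sub>R x) = r *\<^sub>R quat_cnj x"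
  by (cases x; cases y; simp)+

lemma oct_mult_linear:
  "oct_mult (x + y) z = oct_mult x z + oct_mult y z" "oct_mult z (x + y) = oct_mult z x + oct_mult z y"
  "oct_mult (r *\<^sub>R x) z = r *\<^sub>R oct_mult x z" "oct_mult z (r *\<^sub>R x) = r *\<^sub>R oct_mult z x"
proof -
  obtain a b c d e f where xyz: "x = (a, b)" "y = (c, d)" "z = (e, f)" by (metis surj_pair)
  show "oct_mult (x + y) z = oct_mult x z + oct_mult y z" "oct_mult z (x + y) = oct_mult z x + oct_mult z y"
    "oct_mult (r *\<^sub>R x) z = r *\<^sub>R oct_mult x z" "oct_mult z (r *\<^sub>R x) = r *\<^sub>R oct_mult z x"
    by (simp_all only: xyz oct_mult.simps add_Pair scaleR_Pair prod.inject quat_mult_linear quat_cnj_linear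
      scaleR_add_right scaleR_diff_right add_diff_add simp_thms add.assoc add.left_commute)
qed

lemma oct_mult_sum:
  assumes "finite A" "finite B"
  shows "oct_mult (\<Sum>a\<in>A. f a) (\<Sum>b\<in>B. g b) = (\<Sum>a\<in>A. \<Sum>b\<in>B. oct_mult (f a) (g b))"
proof -
  have "oct_mult (0 *\<^sub>R x) y = 0 *\<^sub>R oct_mult x y" "oct_mult x (0 *\<^sub>R y) = 0 *\<^sub>R oct_mult x y" for x y
    by (rule oct_mult_linear)+
  then have zero: "oct_mult 0 y = 0" "oct_mult x 0 = 0" for x y by simp_all
  have "oct_mult x (\<Sum>b\<in>B. g b) = (\<Sum>b\<in>B. oct_mult x (g b))" for x
    using assms(2) by induction (simp_all only: sum.empty sum.insert zero oct_mult_linear not_False_eq_True)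
  note right = this
  show ?thesis
    using assms(1) unfolding right
    by induction (simp_all only: sum.empty sum.insert zero oct_mult_linear not_False_eq_True sum.distrib sum.neutral_const)
qed

lemma quat_norm_square: "(norm (a, b :: complex))\<^sup>2 = (Re a)\<^sup>2 + (Im a)\<^sup>2 + ((Re b)\<^sup>2 + (Im b)\<^sup>2)"
  by (simp add: norm_Pair cmod_power2)

lemma oct_norm_square: "(norm ((a, b), (c, d :: complex)))\<^sup>2 =
    (Re a)\<^sup>2 + (Im a)\<^sup>2 + ((Re b)\<^sup>2 + (Im b)\<^sup>2) + ((Re c)\<^sup>2 + (Im c)\<^sup>2 + ((Re d)\<^sup>2 + (Im d)\<^sup>2))"
  by (simp add: norm_Pair[of "(a, b)"] quat_norm_square)

text \<open>
  In real coordinates this is the eight squares identity.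
\<close>

lemma norm_oct_mult: "norm (oct_mult x y) = norm x * norm y"
proof -
  obtain a b c d where x: "x = ((a, b), (c, d))" by (metis surj_pair)
  obtain a' b' c' d' where y: "y = ((a', b'), (c', d'))" by (metis surj_pair)
  have "(norm (oct_mult x y))\<^sup>2 = (norm x)\<^sup>2 * (norm y)\<^sup>2"
    unfolding x y oct_mult.simps quat_mult.simps quat_cnj.simps diff_Pair add_Pair oct_norm_square
    by (simp add: power2_eq_square) algebra
  then show ?thesis by (metis norm_ge_zero mult_nonneg_nonneg power_mult_distrib power2_eq_imp_eq)
qed

text \<open>
  The Cayley-Dickson units \<open>i\<close>, \<open>j\<close>, \<open>l\<close> sit at 1, 2, 3, and the
  others are the products of two earlier ones along the lines 124, 235, 346, 137; hence the minus sign at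
  6.
\<close>

definition oct_unit :: "nat \<Rightarrow> oct" where
  "oct_unit a = [((1, 0), (0, 0)), ((\<i>, 0), (0, 0)), ((0, 1), (0, 0)), ((0, 0), (1, 0)),
     ((0, \<i>), (0, 0)), ((0, 0), (0, 1)), ((0, 0), (0, - \<i>)), ((0, 0), (\<i>, 0))] ! a"

text \<open>
  The signs that make the products defining the points 4, 5, 6 and 7 positive.
\<close>

definition gauge :: "int list \<Rightarrow> nat \<Rightarrow> int" where
  "gauge ts a = [1, 1, 1, 1, ts ! 0, ts ! 3, ts ! 0 * ts ! 5, ts ! 1] ! a"

definition to_oct :: "int list \<Rightarrow> real^8 \<Rightarrow> oct" where
  "to_oct ts x = (\<Sum>a\<le>7. component x a *\<^sub>R (of_int (gauge ts a) *\<^sub>R oct_unit a))"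

lemma to_oct_linear: "linear (to_oct ts)"
  by (rule linearI) (simp_all add: to_oct_def distrib_right mult.assoc scaleR_add_left sum.distrib scaleR_sum_right)

lemma to_oct_alg_p: "a \<le> 7 \<Longrightarrow> to_oct ts (alg_p a) = of_int (gauge ts a) *\<^sub>R oct_unit a"
  by (simp add: to_oct_def if_distrib[of "\<lambda>r. r * _"] if_distrib[of "\<lambda>r. r *\<^sub>R _"] cong: if_cong)

lemma std_basis_product:
  assumes "length ts = 7" "x \<in> {1..7}" "y \<in> {1..7}" "x \<noteq> y"
  shows "basis_product 11 ts x y = of_int (std_sign ts x y) *\<^sub>R alg_p (third std x y)"
  using std_product[OF assms] assms by (simp add: alg_mult_alg_p)

text \<open>
  The gauge takes care of four lines. For the other three, the point signs of 5, 6 and 7 express the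
  signs of the lines 267, 457 and 156 by the signs of these four, and the expressions are what the gauge
  requires.
\<close>

lemma to_oct_basis:
  assumes ts: "ts \<in> sign_patterns" and triv: "trivial_character ts"
  shows "\<forall>a\<in>{0, 1, 2, 3, 4, 5, 6, 7}. \<forall>b\<in>{0, 1, 2, 3, 4, 5, 6, 7}. to_oct ts (basis_product 11 ts a b) = oct_mult (to_oct ts (alg_p a)) (to_oct ts (alg_p b))"
proof -
  have len: "length ts = 7" using ts by (simp add: sign_patterns_def)
  have u: "ts ! 0 = 1 \<or> ts ! 0 = -1" "ts ! 1 = 1 \<or> ts ! 1 = -1" "ts ! 2 = 1 \<or> ts ! 2 = -1"
    "ts ! 3 = 1 \<or> ts ! 3 = -1" "ts ! 4 = 1 \<or> ts ! 4 = -1" "ts ! 5 = 1 \<or> ts ! 5 = -1" "ts ! 6 = 1 \<or> ts ! 6 = -1"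
    by (simp_all add: pattern_signs(2)[OF ts])
  have m: "point_sign ts 7 = 1" "point_sign ts 5 = 1" "point_sign ts 6 = 1" using triv by (auto simp: trivial_character_def)
  have s: "ts ! 2 = ts ! 0 * ts ! 3 * ts ! 5" "ts ! 4 = ts ! 0 * ts ! 1 * ts ! 5" "ts ! 6 = ts ! 0 * ts ! 1 * ts ! 3"
    using m u unfolding point_sign_products by auto
  have sq: "real_of_int (ts ! k) * real_of_int (ts ! k) = 1" "real_of_int (ts ! k) * (real_of_int (ts ! k) * x) = x"
    if "k < 7" for k x
    using pattern_signs(1)[OF ts that] by (auto simp flip: mult.assoc of_int_mult)
  have lin: "to_oct ts (q *\<^sub>R x) = q *\<^sub>R to_oct ts x" "to_oct ts (- x) = - to_oct ts x" for q x
    using to_oct_linear by (auto simp: linear_cmul linear_neg)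
  show ?thesis
    by (simp add: std_basis_product len lin std_third std_sign to_oct_alg_p gauge_def oct_unit_def basis_product_def[of _ _ 0]
      basis_product_def[of _ _ _ 0] basis_product_def[of _ _ 1 1] basis_product_def[of _ _ 2 2] basis_product_def[of _ _ 3 3]
      basis_product_def[of _ _ 4 4] basis_product_def[of _ _ 5 5] basis_product_def[of _ _ 6 6] basis_product_def[of _ _ 7 7]
      s oct_mult_linear sq mult_ac zero_prod_def)
qed

lemma to_oct_mult:
  assumes "ts \<in> sign_patterns" "trivial_character ts"
  shows "to_oct ts (alg_mult 11 ts x y) = oct_mult (to_oct ts x) (to_oct ts y)"
proof -
  interpret linear "to_oct ts" by (rule to_oct_linear)
  have basis: "to_oct ts (basis_product 11 ts a b) = oct_mult (to_oct ts (alg_p a)) (to_oct ts (alg_p b))"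
    if "a \<le> 7" "b \<le> 7" for a b
    using to_oct_basis[OF assms] that unfolding le_7_cases by blast
  have expand: "to_oct ts z = (\<Sum>a\<le>7. component z a *\<^sub>R to_oct ts (alg_p a))" for z
    by (subst component_expansion) (simp only: sum scale)
  have "oct_mult (to_oct ts x) (to_oct ts y) =
      (\<Sum>a\<le>7. \<Sum>b\<le>7. (component x a * component y b) *\<^sub>R oct_mult (to_oct ts (alg_p a)) (to_oct ts (alg_p b)))"
    unfolding expand[of x] expand[of y] by (simp add: oct_mult_sum oct_mult_linear mult.commute)
  then show ?thesis
    unfolding alg_mult_components sum scale by (simp add: basis)
qed

lemma norm_to_oct:
  assumes ts: "ts \<in> sign_patterns"
  shows "norm (to_oct ts x) = norm x"
proof -
  have sq: "real_of_int (ts ! k) * real_of_int (ts ! k) = 1" if "k < 7" for k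
    using pattern_signs(1)[OF ts that] by (simp flip: of_int_mult)
  have sq2: "(u * real_of_int (ts ! k))\<^sup>2 = u\<^sup>2" if "k < 7" for k u
    using sq[OF that] by (simp add: power2_eq_square mult_ac)
  have "to_oct ts x =
     ((Complex (component x 0) (component x 1), Complex (component x 2) (component x 4 * ts ! 0)),
      (Complex (component x 3) (component x 7 * ts ! 1), Complex (component x 5 * ts ! 3) (- (component x 6 * ts ! 0 * ts ! 5))))"
    by (simp add: to_oct_def sum_atMost_7 gauge_def oct_unit_def complex_eq_iff)
  then have "(norm (to_oct ts x))\<^sup>2 = (norm x)\<^sup>2"
    by (simp add: oct_norm_square norm_components sum_atMost_7 sq2)
  then show ?thesis by simp
qed

lemma to_oct_bij:
  assumes ts: "ts \<in> sign_patterns"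
  shows "bij (to_oct ts)"
proof -
  have "inj (to_oct ts)"
    using norm_to_oct[OF ts] by (subst linear_injective_0[OF to_oct_linear]) (metis norm_eq_zero)
  moreover have "surj (to_oct ts)"
    unfolding surj_def
  proof
    fix z :: oct
    obtain a b c d where z: "z = ((a, b), (c, d))" by (metis surj_pair)
    have sq: "real_of_int (ts ! k) * real_of_int (ts ! k) = 1" "real_of_int (ts ! k) * (real_of_int (ts ! k) * u) = u"
      if "k < 7" for k u
      using pattern_signs(1)[OF ts that] by (auto simp flip: mult.assoc of_int_mult)
    interpret linear "to_oct ts" by (rule to_oct_linear)
    let ?c = "[Re a, Im a, Re b, Re c, Im b, Re d, - Im d, Im c]"
    have "to_oct ts (\<Sum>k\<le>7. (of_int (gauge ts k) * ?c ! k) *\<^sub>R alg_p k) = z"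
      by (simp add: sum add diff scale to_oct_alg_p sum_atMost_7 gauge_def oct_unit_def z complex_eq_iff sq mult_ac)
    then show "\<exists>x. z = to_oct ts x" by metis
  qed
  ultimately show ?thesis by (simp add: bij_def)
qed

section \<open>Octonionic rows and calibrations\<close>

context primary_row
begin

lemma relabel_degenerate_square:
  assumes ss: "ss \<in> sign_patterns" and "has_degenerate_square (alg_mult 11 (relative_signs i ss))"
  shows "has_degenerate_square (alg_mult i ss)"
proof -
  from assms(2) obtain a b c d q r s s' s'' where *: "{a, b, c, d, q, r} \<subseteq> {1..7}" "distinct [a, b, c, d, q, r]"
    "s \<in> {1, -1}" "s' \<in> {1, -1}" "s'' \<in> {1, -1}"
    and zero: "alg_mult 11 (relative_signs i ss) (alg_p a + alg_p b) (alg_p c - s *\<^sub>R alg_p d) = 0"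
    and double: "alg_mult 11 (relative_signs i ss) (alg_p a + alg_p b) (alg_p c + s *\<^sub>R alg_p d) =
      (2 * s') *\<^sub>R alg_p q + (2 * s'') *\<^sub>R alg_p r"
    unfolding has_degenerate_square_def by (elim exE conjE) (rule that)
  have le: "a \<le> 7" "b \<le> 7" "c \<le> 7" "d \<le> 7" "q \<le> 7" "r \<le> 7" using *(1) by auto
  have relabel_diff: "relabel_vec i (x - y) = relabel_vec i x - relabel_vec i y" for x y
    using relabel_vec_bij(1) by (rule linear_diff)
  have "alg_mult i ss (alg_p (label i a) + alg_p (label i b)) (alg_p (label i c) - s *\<^sub>R alg_p (label i d)) = 0"
    using alg_mult_relabel[OF ss, of "alg_p a + alg_p b" "alg_p c - s *\<^sub>R alg_p d"]
    by (simp only: zero relabel_vec_linear relabel_diff relabel_vec_alg_p le)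
  moreover have "alg_mult i ss (alg_p (label i a) + alg_p (label i b)) (alg_p (label i c) + s *\<^sub>R alg_p (label i d)) =
      (2 * s') *\<^sub>R alg_p (label i q) + (2 * s'') *\<^sub>R alg_p (label i r)"
    using alg_mult_relabel[OF ss, of "alg_p a + alg_p b" "alg_p c + s *\<^sub>R alg_p d"]
    by (simp only: double relabel_vec_linear relabel_vec_alg_p le)
  moreover have "{label i a, label i b, label i c, label i d, label i q, label i r} \<subseteq> {1..7}"
    using *(1) in_points by blast
  moreover have "distinct [label i a, label i b, label i c, label i d, label i q, label i r]"
    using *(2) le by (auto simp: label_eq_iff)
  ultimately show ?thesis
    unfolding has_degenerate_square_def using *(3-5)
    by (intro exI[of _ "label i a"] exI[of _ "label i b"] exI[of _ "label i c"] exI[of _ "label i d"]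
      exI[of _ "label i q"] exI[of _ "label i r"] exI[of _ s] exI[of _ s'] exI[of _ s''] conjI)
qed

lemma degenerate_square_if_nontrivial:
  assumes "ss \<in> sign_patterns" "\<not> trivial_character (relative_signs i ss)"
  shows "has_degenerate_square (alg_mult i ss)"
  using assms by (intro relabel_degenerate_square std_degenerate_square relative_signs_signs)

text \<open>
  Relabelling to row 11 and changing signs of basis vectors are isometries, so the norm of the octonions
  carries over together with the product.
\<close>

lemma octonionic_if_trivial:
  assumes ss: "ss \<in> sign_patterns" and triv: "trivial_character (relative_signs i ss)"
  shows "iso_octonions (alg_mult i ss)" "norm (alg_mult i ss x y) = norm x * norm y"
proof -
  note ts = relative_signs_signs[OF ss]
  let ?R = "relabel_vec i" and ?h = "to_oct (relative_signs i ss)"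
  have inv: "?R (inv ?R x) = x" for x
    using relabel_vec_bij(2) by (simp add: bij_is_surj surj_f_inv_f)
  have mult: "?h (inv ?R (alg_mult i ss x y)) = oct_mult (?h (inv ?R x)) (?h (inv ?R y))" for x y
  proof -
    have "alg_mult i ss x y = ?R (alg_mult 11 (relative_signs i ss) (inv ?R x) (inv ?R y))"
      using alg_mult_relabel[OF ss, of "inv ?R x" "inv ?R y"] by (simp only: inv)
    then show ?thesis
      using relabel_vec_bij(2) by (simp add: bij_is_inj inv_f_f to_oct_mult[OF ts triv])
  qed
  have lin: "linear (inv ?R)"
  proof (rule linearI)
    have inj: "inj ?R" using relabel_vec_bij(2) by (rule bij_is_inj)
    show "inv ?R (x + y) = inv ?R x + inv ?R y" for x y
      by (rule inv_f_eq[OF inj]) (simp add: inv)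
    show "inv ?R (r *\<^sub>R x) = r *\<^sub>R inv ?R x" for r x
      by (rule inv_f_eq[OF inj]) (simp add: inv)
  qed
  have "linear (?h \<circ> inv ?R)" "bij (?h \<circ> inv ?R)"
    using relabel_vec_bij(2) to_oct_bij[OF ts] to_oct_linear lin
    by (auto intro: linear_compose bij_comp bij_imp_bij_inv)
  then show "iso_octonions (alg_mult i ss)"
    unfolding iso_octonions_def using mult by (intro exI[of _ "?h \<circ> inv ?R"]) simp
  have norm: "norm (?h (inv ?R x)) = norm x" for x
    using norm_relabel_vec[of "inv ?R x"] by (simp add: norm_to_oct[OF ts] inv)
  show "norm (alg_mult i ss x y) = norm x * norm y"
    using arg_cong[OF mult[of x y], of norm] by (simp add: norm norm_oct_mult)
qed

end

text \<open>
  The norm of the octonions is multiplicative, so they have no zero divisors.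
\<close>

lemma degenerate_square_not_octonions:
  assumes "has_degenerate_square f"
  shows "\<not> iso_octonions f"
proof
  assume "iso_octonions f"
  then obtain h :: "real^8 \<Rightarrow> oct" where h: "linear h" "bij h" "\<And>x y. h (f x y) = oct_mult (h x) (h y)"
    unfolding iso_octonions_def by blast
  from assms obtain a b c d q r s s' s'' where abcd: "{a, b, c, d, q, r} \<subseteq> {1..7}" "distinct [a, b, c, d, q, r]"
    "s \<in> {1, -1}" "s' \<in> {1, -1}" "s'' \<in> {1, -1}"
    and zero: "f (alg_p a + alg_p b) (alg_p c - s *\<^sub>R alg_p d) = 0"
    and double: "f (alg_p a + alg_p b) (alg_p c + s *\<^sub>R alg_p d) = (2 * s') *\<^sub>R alg_p q + (2 * s'') *\<^sub>R alg_p r"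
    unfolding has_degenerate_square_def by (elim exE conjE) (rule that)
  have h0: "h 0 = 0" by (rule linear_0[OF h(1)])
  then have nz: "h x = 0 \<Longrightarrow> x = 0" for x using h(2) by (metis bij_is_inj injD)
  have "norm (h (alg_p a + alg_p b)) * norm (h (alg_p c - s *\<^sub>R alg_p d)) = 0"
    using h(3)[of "alg_p a + alg_p b" "alg_p c - s *\<^sub>R alg_p d"] by (simp add: zero h0 norm_oct_mult flip: norm_oct_mult)
  then have "alg_p a + alg_p b = 0 \<or> alg_p c - s *\<^sub>R alg_p d = 0"
    unfolding mult_eq_0_iff norm_eq_zero using nz by blast
  then have "component (alg_p a + alg_p b) a = 0 \<or> component (alg_p c - s *\<^sub>R alg_p d) c = 0"
    by (metis component_linear(5))
  then show False using abcd by auto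
qed

text \<open>
  Vectors of \<open>\<real>\<^sup>7\<close> as imaginary elements of the algebra.
\<close>

definition embed7 :: "real^7 \<Rightarrow> real^8" where
  "embed7 u = (\<Sum>a\<in>{1..7}. u $ of_nat a *\<^sub>R alg_p a)"

definition unit7 :: "nat \<Rightarrow> real^7" where
  "unit7 a = axis (of_nat a) 1"

lemma of_nat_7_inj: "a \<in> {1..7} \<Longrightarrow> b \<in> {1..7} \<Longrightarrow> (of_nat a :: 7) = of_nat b \<longleftrightarrow> a = b"
  unfolding points_cases
  by (elim insertE emptyE; simp add: bit1.of_nat_eq Abs_bit1_inject)

lemma of_nat_7_surj: "bij_betw (of_nat :: nat \<Rightarrow> 7) {1..7} UNIV"
proof -
  have inj: "inj_on (of_nat :: nat \<Rightarrow> 7) {1..7}" using of_nat_7_inj by (auto simp: inj_on_def)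
  then have "of_nat ` {1..7::nat} = (UNIV :: 7 set)" by (intro card_subset_eq) (auto simp: card_image)
  with inj show ?thesis by (simp add: bij_betw_def)
qed

lemma component_embed7: "a \<le> 7 \<Longrightarrow> component (embed7 u) a = (if a = 0 then 0 else u $ of_nat a)"
  by (simp add: embed7_def component_sum if_distrib cong: if_cong)

lemma inner_embed7: "embed7 u \<bullet> embed7 v = u \<bullet> v"
proof -
  have "{..7} - {0} = {1..7::nat}" by auto
  then have "embed7 u \<bullet> embed7 v = (\<Sum>a\<in>{1..7}. component (embed7 u) a * component (embed7 v) a)"
    unfolding inner_components using sum.remove[of "{..7::nat}" 0 "\<lambda>a. component (embed7 u) a * component (embed7 v) a"]
    by (simp add: component_embed7)
  also have "\<dots> = (\<Sum>a\<in>{1..7}. u $ of_nat a * v $ of_nat a)"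
    by (rule sum.cong) (auto simp: component_embed7)
  also have "\<dots> = u \<bullet> v"
    using sum.reindex_bij_betw[OF of_nat_7_surj, of "\<lambda>j. u $ j * v $ j"] by (simp add: inner_vec_def)
  finally show ?thesis .
qed

lemma norm_embed7: "norm (embed7 u) = norm u"
  by (simp add: norm_eq_sqrt_inner inner_embed7)

lemma embed7_linear [simp]: "embed7 (u + v) = embed7 u + embed7 v" "embed7 (r *\<^sub>R u) = r *\<^sub>R embed7 u"
  by (simp_all add: embed7_def scaleR_add_left sum.distrib scaleR_sum_right)

lemma embed7_unit7: "a \<in> {1..7} \<Longrightarrow> embed7 (unit7 a) = alg_p a"
proof (rule component_eqI)
  fix b :: nat assume a: "a \<in> {1..7}" and "b \<le> 7"
  then show "component (embed7 (unit7 a)) b = component (alg_p a) b"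
    using of_nat_7_inj[of b a] by (cases "b = 0") (auto simp: component_embed7 unit7_def axis_def)
qed

lemma inner_unit7: "a \<in> {1..7} \<Longrightarrow> b \<in> {1..7} \<Longrightarrow> unit7 a \<bullet> unit7 b = (if a = b then 1 else 0)"
  by (simp add: unit7_def inner_axis_axis of_nat_7_inj del: atLeastAtMost_iff)

definition det_at :: "real^7 \<Rightarrow> real^7 \<Rightarrow> real^7 \<Rightarrow> triple \<Rightarrow> real" where
  "det_at u v w = (\<lambda>(a, b, c). det (vector [vector [u $ of_nat a, u $ of_nat b, u $ of_nat c],
                  vector [v $ of_nat a, v $ of_nat b, v $ of_nat c],
                  vector [w $ of_nat a, w $ of_nat b, w $ of_nat c]] :: real^3^3))"

lemma finite_unique_triples: "finite unique_triples"
  by (rule finite_subset[of _ "{..7} \<times> {..7} \<times> {..7}"]) (auto simp: unique_triples_def)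

lemma sum_two_deltas:
  assumes "finite A" "p \<in> A" "q \<in> A"
  shows "(\<Sum>a\<in>A. \<Sum>b\<in>A. f a * g b * (if a = p \<and> b = q then x else 0)) = f p * g q * (x::real)"
proof -
  have "(\<Sum>a\<in>A. \<Sum>b\<in>A. f a * g b * (if a = p \<and> b = q then x else 0)) =
      (\<Sum>a\<in>A. if a = p then \<Sum>b\<in>A. if b = q then f p * g q * x else 0 else 0)"
    by (intro sum.cong refl) (auto intro!: sum.cong)
  then show ?thesis using assms by simp
qed

lemma det_at_term_product:
  assumes "1 \<le> p" "p < q" "q < r" "r \<le> 7"
  shows "det_at u v w (p, q, r) =
    (\<Sum>a\<in>{1..7}. \<Sum>b\<in>{1..7}. u $ of_nat a * v $ of_nat b * (term_product a b (1, (p, q, r)) \<bullet> embed7 w))"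
proof -
  have in7: "p \<in> {1..7}" "q \<in> {1..7}" "r \<in> {1..7}" using assms by auto
  have inner: "alg_p a \<bullet> embed7 w = w $ of_nat a" if "a \<in> {1..7}" for a
    unfolding embed7_unit7[OF that, symmetric] inner_embed7 by (simp add: unit7_def inner_axis')
  have eq: "term_product a b (1, (p, q, r)) \<bullet> embed7 w =
     (if a = p \<and> b = q then w $ of_nat r else 0) + (if a = q \<and> b = r then w $ of_nat p else 0) +
     (if a = r \<and> b = p then w $ of_nat q else 0) + (if a = q \<and> b = p then - w $ of_nat r else 0) +
     (if a = r \<and> b = q then - w $ of_nat p else 0) + (if a = p \<and> b = r then - w $ of_nat q else 0)" for a b
    using assms(2,3) in7 by (simp add: inner del: atLeastAtMost_iff)
  show ?thesis
    unfolding eq using in7 by (simp only: distrib_left sum.distrib sum_two_deltas finite_atLeastAtMost)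
      (simp add: det_at_def det_3 algebra_simps)
qed

context primary_row
begin

lemma form3_signed_form:
  "form3 (signed_form i ss) u v w = (\<Sum>m<7. of_int (ss ! m) * det_at u v w (primary_terms i ! m))"
proof -
  have sorted: "\<exists>a b c. primary_terms i ! m = (a, b, c) \<and> 1 \<le> a \<and> a < b \<and> b < c \<and> c \<le> 7" if "m < 7" for m
    using terms(1,2) that by (metis nth_mem)
  have coeff: "cl_coeff (signed_form i ss) {a, b, c} = (\<Sum>m<7. of_int (ss ! m) * (if primary_terms i ! m = (a, b, c) then 1 else 0))"
    if "(a, b, c) \<in> unique_triples" for a b c
    unfolding signed_form_def cl_coeff_sum scaleR_cl7.rep_eq
  proof (rule sum.cong[OF refl], rule arg_cong[of _ _ "(*) _"])
    fix m :: nat assume "m \<in> {..<7}"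
    then obtain a' b' c' where t: "primary_terms i ! m = (a', b', c')" "1 \<le> a'" "a' < b'" "b' < c'" "c' \<le> 7"
      using sorted by blast
    have "{a, b, c} = {a', b', c'} \<longleftrightarrow> (a', b', c') = (a, b, c)"
      using sorted_triple_eq[of a b c a' b' c'] t(2-5) that by (auto simp: unique_triples_def)
    then show "cl_coeff (e3 (primary_terms i ! m)) {a, b, c} = (if primary_terms i ! m = (a, b, c) then 1 else 0)"
      using t by (simp add: cl_coeff_e3 del: e3.simps)
  qed
  have "form3 (signed_form i ss) u v w =
      (\<Sum>t\<in>unique_triples. (\<Sum>m<7. of_int (ss ! m) * (if primary_terms i ! m = t then 1 else 0)) * det_at u v w t)"
    unfolding form3_def by (rule sum.cong) (auto simp: coeff det_at_def)
  also have "\<dots> = (\<Sum>m<7. \<Sum>t\<in>unique_triples. if primary_terms i ! m = t then of_int (ss ! m) * det_at u v w t else 0)"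
    unfolding sum_distrib_right by (subst sum.swap) (auto intro!: sum.cong)
  also have "\<dots> = (\<Sum>m<7. of_int (ss ! m) * det_at u v w (primary_terms i ! m))"
  proof (rule sum.cong[OF refl])
    fix m :: nat assume "m \<in> {..<7}"
    then have "primary_terms i ! m \<in> unique_triples" using sorted[of m] by (auto simp: unique_triples_def)
    then show "(\<Sum>t\<in>unique_triples. if primary_terms i ! m = t then of_int (ss ! m) * det_at u v w t else 0) =
        of_int (ss ! m) * det_at u v w (primary_terms i ! m)"
      using finite_unique_triples by simp
  qed
  finally show ?thesis .
qed

text \<open>
  Both sides are sums over the terms of the form; one term contributes a determinant, whose six products
  are the six structure constants of the term.
\<close>

lemma form3_alg_mult:
  assumes "ss \<in> sign_patterns"
  shows "form3 (signed_form i ss) u v w = alg_mult i ss (embed7 u) (embed7 v) \<bullet> embed7 w"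
proof -
  have split: "(\<Sum>a\<le>7. g a) = g 0 + (\<Sum>a\<in>{1..7}. g a)" for g :: "nat \<Rightarrow> real"
  proof -
    have "{..7} - {0} = {1..7::nat}" by auto
    then show ?thesis using sum.remove[of "{..7::nat}" 0 g] by simp
  qed
  have basis: "basis_product i ss a b \<bullet> embed7 w =
      (\<Sum>m<7. of_int (ss ! m) * (term_product a b (1, primary_terms i ! m) \<bullet> embed7 w))"
    if "a \<in> {1..7}" "b \<in> {1..7}" for a b
  proof (cases "a = b")
    case True
    have "alg_p 0 \<bullet> embed7 w = 0"
      unfolding inner_components by (rule sum.neutral) (auto simp: component_embed7)
    moreover have "term_product a a (1, primary_terms i ! m) = 0" if m: "m < 7" for m
    proof -
      obtain p q r where "primary_terms i ! m = (p, q, r)" "p < q" "q < r"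
        using terms(1,2) m by (metis nth_mem)
      then show ?thesis by auto
    qed
    ultimately show ?thesis using True that by (simp add: basis_product_def)
  next
    case False
    then show ?thesis
      using assms terms(1) that by (simp add: basis_product_sum inner_sum_left sign_patterns_def del: term_product.simps)
  qed
  have "alg_mult i ss (embed7 u) (embed7 v) \<bullet> embed7 w =
      (\<Sum>a\<in>{1..7}. \<Sum>b\<in>{1..7}. u $ of_nat a * v $ of_nat b * (basis_product i ss a b \<bullet> embed7 w))"
    unfolding alg_mult_components inner_sum_left split
    by (simp add: component_embed7)
  also have "\<dots> = (\<Sum>a\<in>{1..7}. \<Sum>b\<in>{1..7}. \<Sum>m<7. of_int (ss ! m) *
      (u $ of_nat a * v $ of_nat b * (term_product a b (1, primary_terms i ! m) \<bullet> embed7 w)))"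
    by (intro sum.cong refl) (simp only: basis sum_distrib_left mult_ac)
  also have "\<dots> = (\<Sum>m<7. of_int (ss ! m) * (\<Sum>a\<in>{1..7}. \<Sum>b\<in>{1..7}.
      u $ of_nat a * v $ of_nat b * (term_product a b (1, primary_terms i ! m) \<bullet> embed7 w)))"
    by (simp only: sum_distrib_left sum.swap[of _ "{..<7}"])
  also have "\<dots> = (\<Sum>m<7. of_int (ss ! m) * det_at u v w (primary_terms i ! m))"
  proof (rule sum.cong[OF refl])
    fix m :: nat assume "m \<in> {..<7}"
    then obtain p q r where "primary_terms i ! m = (p, q, r)" "1 \<le> p" "p < q" "q < r" "r \<le> 7"
      using terms(1,2) by (metis lessThan_iff nth_mem)
    then show "of_int (ss ! m) * (\<Sum>a\<in>{1..7}. \<Sum>b\<in>{1..7}.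
        u $ of_nat a * v $ of_nat b * (term_product a b (1, primary_terms i ! m) \<bullet> embed7 w)) =
        of_int (ss ! m) * det_at u v w (primary_terms i ! m)"
      by (simp only: det_at_term_product)
  qed
  finally show ?thesis by (simp only: form3_signed_form)
qed

lemma iso_octonions_iff:
  assumes "ss \<in> sign_patterns"
  shows "iso_octonions (alg_mult i ss) \<longleftrightarrow> trivial_character (relative_signs i ss)"
  using octonionic_if_trivial(1) degenerate_square_if_nontrivial degenerate_square_not_octonions assms by blast

text \<open>
  The value 1 is attained on \<open>p\<^sub>a\<close>, \<open>p\<^sub>b\<close> and their product;
  Cauchy-Schwarz and the multiplicative norm give the upper bound.
\<close>

lemma calibration_if_trivial:
  assumes ss: "ss \<in> sign_patterns" and triv: "trivial_character (relative_signs i ss)"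
  shows "calibration (signed_form i ss)"
  unfolding calibration_def comass_def
proof (rule cSup_eq_maximum)
  define l where "l = label i"
  have l: "l 1 \<in> {1..7}" "l 2 \<in> {1..7}" "l 4 \<in> {1..7}" "l 1 \<noteq> l 2" "l 1 \<noteq> l 4" "l 2 \<noteq> l 4"
    unfolding l_def using in_points[of 1] in_points[of 2] in_points[of 4] by (auto simp: label_eq_iff)
  define s where "s = real_of_int (relative_signs i ss ! 0)"
  have s: "s = 1 \<or> s = -1" using pattern_signs(2)[OF relative_signs_signs[OF ss], of 0] by (auto simp: s_def)
  have "length (relative_signs i ss) = 7" by (simp add: relative_signs_def)
  then have "alg_mult i ss (alg_p (l 1)) (alg_p (l 2)) = s *\<^sub>R alg_p (l 4)"
    using alg_mult_relabel[OF ss, of "alg_p 1" "alg_p 2"]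
    by (simp add: relabel_vec_alg_p std_product std_third std_sign s_def l_def)
  then have "form3 (signed_form i ss) (unit7 (l 1)) (unit7 (l 2)) (s *\<^sub>R unit7 (l 4)) = s * (s * (unit7 (l 4) \<bullet> unit7 (l 4)))"
    by (simp only: form3_alg_mult[OF ss] embed7_linear embed7_unit7[symmetric] l inner_scaleR_left inner_scaleR_right inner_embed7)
  then have "form3 (signed_form i ss) (unit7 (l 1)) (unit7 (l 2)) (s *\<^sub>R unit7 (l 4)) = 1"
    using s l by (auto simp: inner_unit7 simp del: atLeastAtMost_iff)
  moreover have "norm (unit7 (l 1)) = 1" "norm (unit7 (l 2)) = 1" "norm (s *\<^sub>R unit7 (l 4)) = 1"
    "unit7 (l 1) \<bullet> unit7 (l 2) = 0" "unit7 (l 1) \<bullet> (s *\<^sub>R unit7 (l 4)) = 0" "unit7 (l 2) \<bullet> (s *\<^sub>R unit7 (l 4)) = 0"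
    using s l by (auto simp: norm_eq_sqrt_inner inner_unit7 simp del: atLeastAtMost_iff)
  ultimately show "1 \<in> {form3 (signed_form i ss) u v w |u v w.
      norm u = 1 \<and> norm v = 1 \<and> norm w = 1 \<and> u \<bullet> v = 0 \<and> u \<bullet> w = 0 \<and> v \<bullet> w = 0}"
    by (intro CollectI exI[of _ "unit7 (l 1)"] exI[of _ "unit7 (l 2)"] exI[of _ "s *\<^sub>R unit7 (l 4)"]) simp
next
  fix x assume "x \<in> {form3 (signed_form i ss) u v w |u v w.
      norm u = 1 \<and> norm v = 1 \<and> norm w = 1 \<and> u \<bullet> v = 0 \<and> u \<bullet> w = 0 \<and> v \<bullet> w = 0}"
  then obtain u v w where x: "x = form3 (signed_form i ss) u v w" and uvw: "norm u = 1" "norm v = 1" "norm w = 1" by blast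
  have "x \<le> norm (alg_mult i ss (embed7 u) (embed7 v)) * norm (embed7 w)"
    unfolding x form3_alg_mult[OF ss] by (rule norm_cauchy_schwarz)
  then show "x \<le> 1"
    by (simp add: octonionic_if_trivial(2)[OF ss triv] norm_embed7 uvw)
qed

text \<open>
  Needed because the supremum of an unbounded set of reals has no specified value.
\<close>

lemma bdd_above_form3:
  assumes ss: "ss \<in> sign_patterns"
  shows "bdd_above {form3 (signed_form i ss) u v w |u v w.
      norm u = 1 \<and> norm v = 1 \<and> norm w = 1 \<and> u \<bullet> v = 0 \<and> u \<bullet> w = 0 \<and> v \<bullet> w = 0}"
proof -
  have "bilinear (alg_mult i ss)"
    unfolding bilinear_def by (auto intro!: linearI)
  then obtain K where K: "norm (alg_mult i ss x y) \<le> norm x * norm y * K" for x y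
    using bilinear_conv_bounded_bilinear bounded_bilinear.bounded by metis
  show ?thesis
  proof (rule bdd_aboveI)
    fix x assume "x \<in> {form3 (signed_form i ss) u v w |u v w.
      norm u = 1 \<and> norm v = 1 \<and> norm w = 1 \<and> u \<bullet> v = 0 \<and> u \<bullet> w = 0 \<and> v \<bullet> w = 0}"
    then obtain u v w where x: "x = form3 (signed_form i ss) u v w" and uvw: "norm u = 1" "norm v = 1" "norm w = 1" by blast
    have "x \<le> norm (alg_mult i ss (embed7 u) (embed7 v)) * norm (embed7 w)"
      unfolding x form3_alg_mult[OF ss] by (rule norm_cauchy_schwarz)
    then show "x \<le> K" using K[of "embed7 u" "embed7 v"] by (simp add: norm_embed7 uvw)
  qed
qed

text \<open>
  The normalised factors of the second product of a degenerate square, together with its normalised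
  value, are orthonormal, and the form takes the value \<open>sqrt 2\<close> on them.
\<close>

lemma not_calibration_if_nontrivial:
  assumes ss: "ss \<in> sign_patterns" and "\<not> trivial_character (relative_signs i ss)"
  shows "\<not> calibration (signed_form i ss)"
proof
  assume "calibration (signed_form i ss)"
  then have sup: "Sup {form3 (signed_form i ss) u v w |u v w.
      norm u = 1 \<and> norm v = 1 \<and> norm w = 1 \<and> u \<bullet> v = 0 \<and> u \<bullet> w = 0 \<and> v \<bullet> w = 0} = 1"
    by (simp add: calibration_def comass_def)
  from degenerate_square_if_nontrivial[OF assms] obtain a b c d q r s s' s'' where
    pts: "{a, b, c, d, q, r} \<subseteq> {1..7}" "distinct [a, b, c, d, q, r]" "s \<in> {1, -1}" "s' \<in> {1, -1}" "s'' \<in> {1, -1}"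
    and zero: "alg_mult i ss (alg_p a + alg_p b) (alg_p c - s *\<^sub>R alg_p d) = 0"
    and double: "alg_mult i ss (alg_p a + alg_p b) (alg_p c + s *\<^sub>R alg_p d) = (2 * s') *\<^sub>R alg_p q + (2 * s'') *\<^sub>R alg_p r"
    unfolding has_degenerate_square_def by (elim exE conjE) (rule that)
  have p: "a \<in> {1..7}" "b \<in> {1..7}" "c \<in> {1..7}" "d \<in> {1..7}" "q \<in> {1..7}" "r \<in> {1..7}"
    using pts(1) by auto
  have ne: "a \<noteq> b" "a \<noteq> c" "a \<noteq> d" "a \<noteq> q" "a \<noteq> r" "b \<noteq> c" "b \<noteq> d" "b \<noteq> q" "b \<noteq> r" "c \<noteq> d" "c \<noteq> q"
    "c \<noteq> r" "d \<noteq> q" "d \<noteq> r" "q \<noteq> r" using pts(2) by auto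
  have ss1: "s * s = 1" "s' * s' = 1" "s'' * s'' = 1" using pts(3-5) by auto
  define h :: real where "h = 1 / sqrt 2"
  have h: "h * h = 1 / 2" by (simp add: h_def)
  define u v w where "u = h *\<^sub>R (unit7 a + unit7 b)" and "v = h *\<^sub>R (unit7 c + s *\<^sub>R unit7 d)"
    and "w = h *\<^sub>R (s' *\<^sub>R unit7 q + s'' *\<^sub>R unit7 r)"
  note expand = u_def v_def w_def inner_add_left inner_add_right inner_scaleR_left inner_scaleR_right
  have "u \<bullet> u = 1" "v \<bullet> v = 1" "w \<bullet> w = 1" "u \<bullet> v = 0" "u \<bullet> w = 0" "v \<bullet> w = 0"
    using h ss1 by (simp_all add: expand inner_unit7 p ne ne[symmetric] mult.assoc del: atLeastAtMost_iff)
      (simp_all add: algebra_simps)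
  then have mem: "form3 (signed_form i ss) u v w \<in> {form3 (signed_form i ss) u v w |u v w.
      norm u = 1 \<and> norm v = 1 \<and> norm w = 1 \<and> u \<bullet> v = 0 \<and> u \<bullet> w = 0 \<and> v \<bullet> w = 0}"
    by (intro CollectI exI[of _ u] exI[of _ v] exI[of _ w]) (simp add: norm_eq_sqrt_inner)
  have "alg_mult i ss (embed7 u) (embed7 v) = (h * h) *\<^sub>R embed7 ((2 * s') *\<^sub>R unit7 q + (2 * s'') *\<^sub>R unit7 r)"
    unfolding u_def v_def embed7_linear embed7_unit7[OF p(1)] embed7_unit7[OF p(2)] embed7_unit7[OF p(3)]
      embed7_unit7[OF p(4)] embed7_unit7[OF p(5)] embed7_unit7[OF p(6)] double[symmetric] alg_mult_bilinear(5,6) by simp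
  then have "form3 (signed_form i ss) u v w =
      h * h * (((2 * s') *\<^sub>R unit7 q + (2 * s'') *\<^sub>R unit7 r) \<bullet> w)"
    by (simp only: form3_alg_mult[OF ss] inner_scaleR_left inner_embed7)
  also have "\<dots> = h * h * (h * (2 * (s' * s') + 2 * (s'' * s'')))"
    by (simp add: expand inner_unit7 p ne ne[symmetric] algebra_simps del: atLeastAtMost_iff)
  also have "\<dots> = 2 * h" by (simp add: ss1 h)
  also have "\<dots> > 1" by (simp add: h_def field_simps real_less_lsqrt)
  finally have "1 < form3 (signed_form i ss) u v w" .
  then show False using cSup_upper[OF mem bdd_above_form3[OF ss]] sup by simp
qed

lemma calibration_iff:
  assumes "ss \<in> sign_patterns"
  shows "calibration (signed_form i ss) \<longleftrightarrow> trivial_character (relative_signs i ss)"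
  using calibration_if_trivial not_calibration_if_nontrivial assms by blast

end

section \<open>Counting triples\<close>

definition triple_list :: "triple list" where
  "triple_list = [(1,2,3), (1,2,4), (1,2,5), (1,2,6), (1,2,7), (1,3,4), (1,3,5), (1,3,6), (1,3,7), (1,4,5),
    (1,4,6), (1,4,7), (1,5,6), (1,5,7), (1,6,7), (2,3,4), (2,3,5), (2,3,6), (2,3,7), (2,4,5), (2,4,6), (2,4,7),
    (2,5,6), (2,5,7), (2,6,7), (3,4,5), (3,4,6), (3,4,7), (3,5,6), (3,5,7), (3,6,7), (4,5,6), (4,5,7), (4,6,7), (5,6,7)]"

text \<open>
  For each triple off the lines, the point that decides its associativity.
\<close>

definition thirds :: "triple list \<Rightarrow> nat list" where
  "thirds ts = map (\<lambda>(a, b, c). third ts a c) (filter (\<lambda>(a, b, c). third ts a b \<noteq> c) triple_list)"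

text \<open>
  Recursion over the lines, so that simplification counts one line at a time instead of expanding the
  count for a variable line.
\<close>

primrec line_counts :: "nat list \<Rightarrow> triple list \<Rightarrow> nat list" where
  "line_counts qs [] = []"
| "line_counts qs (t # ts) = length (filter (\<lambda>q. on_line q t) qs) # line_counts qs ts"

lemma line_counts_map: "line_counts qs ts = map (\<lambda>t. length (filter (\<lambda>q. on_line q t) qs)) ts"
  by (induction ts) auto

definition counts_match :: "triple list \<Rightarrow> nat list \<Rightarrow> nat list \<Rightarrow> bool" where
  "counts_match ts ns qs \<longleftrightarrow> length qs = 28 \<and> line_counts qs ts = ns"

lemma triple_list: "set triple_list = unique_triples" "distinct triple_list"
proof -
  have "\<forall>a\<in>{1, 2, 3, 4, 5, 6, 7}. \<forall>b\<in>{1, 2, 3, 4, 5, 6, 7}. a < b \<longrightarrow>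
      (\<forall>c\<in>{1, 2, 3, 4, 5, 6, 7}. b < c \<longrightarrow> (a, b, c) \<in> set triple_list)"
    by (simp add: triple_list_def)
  then have "unique_triples \<subseteq> set triple_list"
    unfolding points_cases[symmetric] by (auto simp: unique_triples_def)
  moreover have "set triple_list \<subseteq> unique_triples"
    by (simp add: triple_list_def unique_triples_def)
  ultimately show "set triple_list = unique_triples" by blast
  show "distinct triple_list" by (simp add: triple_list_def)
qed

lemma rows_counts: "list_all (\<lambda>r. counts_match (fst r) (fst (snd r)) (thirds (fst r))) primary_table"
  unfolding primary_table_def list.pred_inject fst_conv snd_conv
  by (intro conjI TrueI; simp add: counts_match_def thirds_def triple_list_def third_def)

lemma rows_numbers: "list_all (\<lambda>r. set (fst (snd r)) \<subseteq> {4, 8, 10, 12, 14, 16}) primary_table"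
  unfolding primary_table_def by simp

text \<open>
  With all signs +1 the relative signs are the orientations, so the remainder of the all-positive form
  can be evaluated. The remainder is -1 times the kernel line because \<open>(-1)\<^sup>\<sigma> =
  1\<close>. As above, the two predicates after this one only control evaluation.
\<close>

definition remainder_matches :: "triple list \<Rightarrow> (int \<times> triple) option \<Rightarrow> nat list \<Rightarrow> int list \<Rightarrow> bool" where
  "remainder_matches ts rem ms os \<longleftrightarrow> (case rem of
     None \<Rightarrow> (\<forall>p\<in>{1, 2, 3, 4, 5, 6, 7}. point_sign os p = 1)
   | Some (s, t) \<Rightarrow> s = -1 \<and> (\<exists>k\<in>{0, 1, 2, 3, 4, 5, 6}. t = ts ! (ms ! k) \<and>
       (\<forall>p\<in>{1, 2, 3, 4, 5, 6, 7}. point_sign os p = (if on_line p (std ! k) then 1 else -1))))"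

definition remainder_matches_lines :: "triple list \<Rightarrow> (int \<times> triple) option \<Rightarrow> nat list \<Rightarrow> nat list \<Rightarrow> bool" where
  "remainder_matches_lines ts rem l ms \<longleftrightarrow> remainder_matches ts rem ms (orientations ts l ms)"

definition remainder_matches_labels :: "triple list \<Rightarrow> (int \<times> triple) option \<Rightarrow> nat list \<Rightarrow> bool" where
  "remainder_matches_labels ts rem l \<longleftrightarrow> remainder_matches_lines ts rem l (line_order ts l)"

lemma rows_remainder: "list_all (\<lambda>r. remainder_matches_labels (fst r) (snd (snd r)) (labelling (fst r))) primary_table"
  unfolding primary_table_def list.pred_inject fst_conv snd_conv
  by (intro conjI TrueI; simp add: labelling_def third_def Let_def remainder_matches_labels_def remainder_matches_lines_def
    line_order_def orientations_def std_terms upt_rec)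
    (simp_all add: remainder_matches_def point_sign_products std_terms)

context primary_row
begin

lemma on_line_label:
  assumes "k < 7" "q \<in> {1..7}"
  shows "on_line (label i q) (primary_terms i ! line i k) \<longleftrightarrow> on_line q (std ! k)"
proof -
  obtain a b c where t: "primary_terms i ! line i k = (a, b, c)" using term_at_line[OF assms(1)] by blast
  obtain u v w where s: "std ! k = (u, v, w)" by (cases "std ! k")
  have "orient (a, b, c) (relabel (label i) (std ! k)) \<noteq> 0"
    using orientation[OF assms(1)] unfolding orientation_def t(1)
    by (metis insert_iff singletonD zero_neq_neg_one zero_neq_one)
  then have "on_line (label i q) (a, b, c) \<longleftrightarrow> on_line (label i q) (label i u, label i v, label i w)"
    unfolding s by (auto split: if_splits)
  moreover have "u \<le> 7" "v \<le> 7" "w \<le> 7" using std_in[OF assms(1)] s by (auto simp: std_terms)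
  ultimately show ?thesis using assms(2) by (simp add: t s label_eq_iff)
qed

text \<open>
  The criterion for row 11, read in the indices of the row. The order of \<open>a\<close>,
  \<open>b\<close>, \<open>c\<close> matters: the deciding point is the third point of the outer two.
\<close>

lemma assoc_iff:
  assumes ss: "ss \<in> sign_patterns" and abc: "(a, b, c) \<in> unique_triples"
  obtains q where "q \<in> {1..7}" "third (primary_terms i) a b \<noteq> c \<Longrightarrow> third (primary_terms i) a c = label i q"
    "assoc_at (alg_mult i ss) (alg_p a) (alg_p b) (alg_p c) \<longleftrightarrow>
      third (primary_terms i) a b = c \<or> point_sign (relative_signs i ss) q = -1"
proof -
  have "a \<in> label i ` {1..7}" "b \<in> label i ` {1..7}" "c \<in> label i ` {1..7}"
    using abc label_bij by (auto simp: unique_triples_def bij_betw_def)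
  then obtain x y z where x: "x \<in> {1..7}" "a = label i x" and y: "y \<in> {1..7}" "b = label i y"
    and z: "z \<in> {1..7}" "c = label i z" by blast
  have ne: "x \<noteq> y" "x \<noteq> z" "y \<noteq> z" using abc x y z by (auto simp: unique_triples_def)
  have pt: "third std x y \<in> {1..7}" "third std x z \<in> {1..7}"
    using third_std_points(1) x y z ne by blast+
  have "assoc_at (alg_mult i ss) (alg_p a) (alg_p b) (alg_p c) \<longleftrightarrow>
      assoc_at (alg_mult 11 (relative_signs i ss)) (alg_p x) (alg_p y) (alg_p z)"
    using assoc_at_relabel[OF ss, of "alg_p x" "alg_p y" "alg_p z"] x y z by (simp add: relabel_vec_alg_p)
  also have "\<dots> \<longleftrightarrow> third std x y = z \<or> point_sign (relative_signs i ss) (third std x z) = -1"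
    by (rule std_assoc_iff[OF relative_signs_signs[OF ss] x(1) y(1) z(1) ne])
  also have "third std x y = z \<longleftrightarrow> third (primary_terms i) a b = c"
    using third_relabel[OF x(1) y(1) ne(1)] pt z x(2) y(2) by (simp add: label_eq_iff)
  finally show ?thesis
    using that[OF pt(2)] third_relabel[OF x(1) z(1) ne(2)] x(2) z(2) by simp
qed

lemma counts: "counts_match (primary_terms i) (primary_numbers i) (thirds (primary_terms i))"
  using rows_counts row_in_table[OF row] by (auto simp: list_all_iff primary_terms_def primary_numbers_def)

lemma card_triples: "card {t \<in> unique_triples. P t} = length (filter P triple_list)"
proof -
  have "{t \<in> unique_triples. P t} = set (filter P triple_list)" using triple_list(1) by auto
  moreover have "card (set (filter P triple_list)) = length (filter P triple_list)"
    by (rule distinct_card) (simp add: triple_list(2))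
  ultimately show ?thesis by (simp only:)
qed

lemma count_trivial:
  assumes ss: "ss \<in> sign_patterns" and triv: "trivial_character (relative_signs i ss)"
  shows "card (nonassoc_triples (alg_mult i ss)) = 28" "card (assoc_triples (alg_mult i ss)) = 7"
proof -
  let ?P = "\<lambda>(a, b, c). third (primary_terms i) a b \<noteq> c"
  have iff: "assoc_at (alg_mult i ss) (alg_p a) (alg_p b) (alg_p c) \<longleftrightarrow> \<not> ?P (a, b, c)"
    if "(a, b, c) \<in> unique_triples" for a b c
    using assoc_iff[OF ss that] triv unfolding trivial_character_def by fastforce
  have "nonassoc_triples (alg_mult i ss) = {t \<in> unique_triples. ?P t}"
    unfolding nonassoc_triples_def using iff by auto
  then have non: "card (nonassoc_triples (alg_mult i ss)) = length (filter ?P triple_list)"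
    by (simp only: card_triples)
  then show "card (nonassoc_triples (alg_mult i ss)) = 28"
    using counts by (simp add: counts_match_def thirds_def)
  have "assoc_triples (alg_mult i ss) = {t \<in> unique_triples. \<not> ?P t}"
    unfolding assoc_triples_def using iff by auto
  then have "card (assoc_triples (alg_mult i ss)) = length (filter (\<lambda>t. \<not> ?P t) triple_list)"
    by (simp only: card_triples)
  moreover have "length triple_list = 35" by (simp add: triple_list_def)
  ultimately show "card (assoc_triples (alg_mult i ss)) = 7"
    using counts sum_length_filter_compl[of ?P triple_list] by (simp add: counts_match_def thirds_def)
qed

text \<open>
  A triple off the lines is non-associative iff its deciding point has point sign 1, that is, lies on the
  kernel line.
\<close>

lemma count_kernel:
  assumes ss: "ss \<in> sign_patterns" and ker: "kernel_line (relative_signs i ss) k"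
  shows "card (nonassoc_triples (alg_mult i ss)) = primary_numbers i ! line i k"
proof -
  have k: "k < 7" using ker by (simp add: kernel_line_def)
  have lk: "line i k < length (primary_terms i)" using line_bij k terms(1) by (auto simp: bij_betw_def)
  let ?t = "primary_terms i ! line i k"
  let ?P = "\<lambda>(a, b, c). third (primary_terms i) a b \<noteq> c"
  let ?Q = "\<lambda>(a, b, c). on_line (third (primary_terms i) a c) ?t"
  have iff: "\<not> assoc_at (alg_mult i ss) (alg_p a) (alg_p b) (alg_p c) \<longleftrightarrow> ?P (a, b, c) \<and> ?Q (a, b, c)"
    if "(a, b, c) \<in> unique_triples" for a b c
  proof -
    obtain q where q: "q \<in> {1..7}" "third (primary_terms i) a b \<noteq> c \<Longrightarrow> third (primary_terms i) a c = label i q"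
      "assoc_at (alg_mult i ss) (alg_p a) (alg_p b) (alg_p c) \<longleftrightarrow>
        third (primary_terms i) a b = c \<or> point_sign (relative_signs i ss) q = -1"
      using assoc_iff[OF ss \<open>(a, b, c) \<in> unique_triples\<close>] by blast
    have "point_sign (relative_signs i ss) q = -1 \<longleftrightarrow> \<not> on_line q (std ! k)"
      using ker q(1) by (simp add: kernel_line_def del: atLeastAtMost_iff)
    then show ?thesis using q on_line_label[OF k q(1)] by auto
  qed
  have "nonassoc_triples (alg_mult i ss) = {t \<in> unique_triples. ?P t \<and> ?Q t}"
    unfolding nonassoc_triples_def using iff by auto
  then have "card (nonassoc_triples (alg_mult i ss)) = length (filter (\<lambda>t. ?P t \<and> ?Q t) triple_list)"
    by (simp only: card_triples)
  also have "\<dots> = length (filter (\<lambda>q. on_line q ?t) (thirds (primary_terms i)))"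
    unfolding thirds_def filter_map length_map filter_filter
    by (rule arg_cong[where f = length], rule filter_cong) auto
  also have "\<dots> = primary_numbers i ! line i k"
  proof -
    have "primary_numbers i = map (\<lambda>t. length (filter (\<lambda>q. on_line q t) (thirds (primary_terms i)))) (primary_terms i)"
      using counts by (simp add: counts_match_def line_counts_map)
    then show ?thesis using lk by simp
  qed
  finally show ?thesis .
qed

lemma numbers_in:
  assumes "m < 7"
  shows "primary_numbers i ! m \<in> {4, 8, 10, 12, 14, 16}"
proof -
  have "length (primary_numbers i) = 7" using counts terms(1) by (metis counts_match_def line_counts_map length_map)
  then have "primary_numbers i ! m \<in> set (primary_numbers i)" using assms by simp
  moreover have "set (primary_numbers i) \<subseteq> {4, 8, 10, 12, 14, 16}"
    using rows_numbers row_in_table[OF row] by (auto simp: list_all_iff primary_numbers_def)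
  ultimately show ?thesis by blast
qed

lemma relative_signs_ones: "relative_signs i (replicate 7 1) =
    orientations (primary_terms i) (labelling (primary_terms i)) (line_order (primary_terms i) (labelling (primary_terms i)))"
proof -
  have "line i k < 7" if "k < 7" for k using line_bij that by (auto simp: bij_betw_def)
  then have "relative_signs i (replicate 7 1) = map (orientation i) [0..<7]"
    by (auto simp: relative_signs_def)
  then show ?thesis by (simp only: orientation_map)
qed

lemma ones_signs: "replicate 7 1 \<in> sign_patterns"
  by (simp add: sign_patterns_def)

lemma remainder_ones:
  "case primary_remainder i of
     None \<Rightarrow> trivial_character (relative_signs i (replicate 7 1))
   | Some (s, t) \<Rightarrow> has_remainder i (replicate 7 1) s t"
proof -
  have *: "remainder_matches (primary_terms i) (primary_remainder i) (line_order (primary_terms i) (labelling (primary_terms i)))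
      (relative_signs i (replicate 7 1))"
    using rows_remainder row_in_table[OF row]
    by (auto simp: list_all_iff primary_terms_def primary_remainder_def relative_signs_ones remainder_matches_labels_def remainder_matches_lines_def)
  show ?thesis
  proof (cases "primary_remainder i")
    case None
    then show ?thesis using * by (simp add: remainder_matches_def trivial_character_def points_cases)
  next
    case (Some st)
    obtain s t where st: "st = (s, t)" by (cases st)
    with Some * obtain k where k: "k \<in> {0, 1, 2, 3, 4, 5, 6}" "t = primary_terms i ! line i k" "s = -1"
      "\<forall>p\<in>{1..7}. point_sign (relative_signs i (replicate 7 1)) p = (if on_line p (std ! k) then 1 else -1)"
      unfolding remainder_matches_def points_cases line_def by auto
    then have "kernel_line (relative_signs i (replicate 7 1)) k"
      by (simp add: kernel_line_def less_7_cases)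
    note rem = has_remainder_if_kernel[OF ones_signs this]
    have "k < 7" using k(1) unfolding less_7_cases .
    then have "line i k < 7" using line_bij by (auto simp: bij_betw_def)
    then have "- ((-1) ^ num_minus (replicate 7 1)) * (replicate 7 1 :: int list) ! line i k = -1"
      by (simp add: num_minus_def count_list_0_iff)
    then show ?thesis using rem k Some st by simp
  qed
qed

end

theorem theorem1:
  fixes sg :: "nat \<Rightarrow> int list"
  assumes "bij_betw sg {1..128} sign_patterns"
    and "sg 1 = replicate 7 1"
  shows
    "(\<forall>i\<in>{1..30}. \<forall>j\<in>{1..128}.
        ((rho i (sg j))\<^sup>2 = -1 \<or> (\<exists>s t. has_remainder i (sg j) s t)) \<and>
        \<not> ((rho i (sg j))\<^sup>2 = -1 \<and> (\<exists>s t. has_remainder i (sg j) s t)) \<and>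
        ((rho i (sg j))\<^sup>2 = -1 \<longleftrightarrow> calibration (signed_form i (sg j))) \<and>
        ((rho i (sg j))\<^sup>2 = -1 \<longleftrightarrow> iso_octonions (alg_mult i (sg j))) \<and>
        ((rho i (sg j))\<^sup>2 = -1 \<longrightarrow>
           card (nonassoc_triples (alg_mult i (sg j))) = 28 \<and>
           card (assoc_triples (alg_mult i (sg j))) = 7) \<and>
        (\<forall>s. \<forall>m<7. has_remainder i (sg j) s (primary_terms i ! m) \<longrightarrow>
           \<not> (\<forall>x y z. assoc_at (alg_mult i (sg j)) x y z) \<and>
           card (nonassoc_triples (alg_mult i (sg j))) = primary_numbers i ! m \<and>
           primary_numbers i ! m \<in> {4, 8, 10, 12, 14, 16})) \<and>
     (\<forall>i\<in>{1..30}. case primary_remainder i of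
        None \<Rightarrow> (rho i (sg 1))\<^sup>2 = -1
      | Some (s, t) \<Rightarrow> has_remainder i (sg 1) s t) \<and>
     (\<forall>i\<in>{11, 20}. (rho i (sg 1))\<^sup>2 = -1 \<and> iso_octonions (alg_mult i (sg 1)))"
proof (intro conjI ballI)
  fix i j :: nat assume i: "i \<in> {1..30}" and j: "j \<in> {1..128}"
  interpret primary_row i by unfold_locales (rule i)
  have ss: "sg j \<in> sign_patterns" using assms(1) j by (auto simp: bij_betw_def)
  note ts = relative_signs_signs[OF ss]
  show "(rho i (sg j))\<^sup>2 = -1 \<or> (\<exists>s t. has_remainder i (sg j) s t)"
    using character_cases[OF ts] rho_square_iff[OF ss] has_remainder_if_kernel[OF ss] by blast
  show "\<not> ((rho i (sg j))\<^sup>2 = -1 \<and> (\<exists>s t. has_remainder i (sg j) s t))"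
    using rho_square_iff[OF ss] kernel_if_has_remainder[OF ss] kernel_line_nontrivial by metis
  show "(rho i (sg j))\<^sup>2 = -1 \<longleftrightarrow> calibration (signed_form i (sg j))"
    by (simp only: rho_square_iff[OF ss] calibration_iff[OF ss])
  show "(rho i (sg j))\<^sup>2 = -1 \<longleftrightarrow> iso_octonions (alg_mult i (sg j))"
    by (simp only: rho_square_iff[OF ss] iso_octonions_iff[OF ss])
  show "(rho i (sg j))\<^sup>2 = -1 \<longrightarrow>
      card (nonassoc_triples (alg_mult i (sg j))) = 28 \<and> card (assoc_triples (alg_mult i (sg j))) = 7"
    using rho_square_iff[OF ss] count_trivial[OF ss] by blast
  show "\<forall>s. \<forall>m<7. has_remainder i (sg j) s (primary_terms i ! m) \<longrightarrow>
      \<not> (\<forall>x y z. assoc_at (alg_mult i (sg j)) x y z) \<and>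
      card (nonassoc_triples (alg_mult i (sg j))) = primary_numbers i ! m \<and>
      primary_numbers i ! m \<in> {4, 8, 10, 12, 14, 16}"
  proof (intro allI impI)
    fix s m assume m: "m < (7::nat)" and rem: "has_remainder i (sg j) s (primary_terms i ! m)"
    obtain n where n: "kernel_line (relative_signs i (sg j)) n" "primary_terms i ! m = primary_terms i ! line i n"
      using kernel_if_has_remainder[OF ss rem] by blast
    have "line i n < 7" using n(1) line_bij by (auto simp: kernel_line_def bij_betw_def)
    then have "m = line i n" using n(2) m terms(1,3) by (simp add: nth_eq_iff_index_eq)
    then have card: "card (nonassoc_triples (alg_mult i (sg j))) = primary_numbers i ! m"
      using count_kernel[OF ss n(1)] by simp
    then have "nonassoc_triples (alg_mult i (sg j)) \<noteq> {}" using numbers_in[OF m] by auto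
    then have "\<not> (\<forall>x y z. assoc_at (alg_mult i (sg j)) x y z)" by (auto simp: nonassoc_triples_def)
    then show "\<not> (\<forall>x y z. assoc_at (alg_mult i (sg j)) x y z) \<and>
        card (nonassoc_triples (alg_mult i (sg j))) = primary_numbers i ! m \<and>
        primary_numbers i ! m \<in> {4, 8, 10, 12, 14, 16}"
      using card numbers_in[OF m] by blast
  qed
next
  fix i :: nat assume i: "i \<in> {1..30}"
  interpret primary_row i by unfold_locales (rule i)
  show "case primary_remainder i of None \<Rightarrow> (rho i (sg 1))\<^sup>2 = -1 | Some (s, t) \<Rightarrow> has_remainder i (sg 1) s t"
    using remainder_ones rho_square_iff[OF ones_signs] unfolding assms(2)
    by (auto split: option.splits prod.splits)
next
  fix i :: nat assume i: "i \<in> {11, 20}"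
  interpret primary_row i by unfold_locales (use i in auto)
  have "primary_remainder i = None" using i by (auto simp: primary_remainder_def primary_table_def)
  then have "trivial_character (relative_signs i (replicate 7 1))" using remainder_ones by simp
  then show "(rho i (sg 1))\<^sup>2 = -1" "iso_octonions (alg_mult i (sg 1))"
    unfolding assms(2) by (simp_all add: rho_square_iff iso_octonions_iff ones_signs)
qed

end
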